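(* Let $D=[0,1]^d$ and $\gamma\in\Gamma(D)$. Then, for any probability measure $\boldsymbol\eta$ on $\Omega(D)$ such that $$(e_t)_\#\boldsymbol\eta=\mu_D\quad\forall t\in[0,T],\qquad (e_0,e_T)_\#\boldsymbol\eta=\gamma,$$ and $\mathscr A_T(\boldsymbol\eta)<\infty$, there exists a sequence of flows $(g_k(t,\cdot))_{k\in\mathbb N}\subset W^{1,2}([0,T];L^2(D))$ such that: (i) $g_k(t,\cdot)\in S(D)$ for all $t\in[0,T]$, hence $\boldsymbol\eta_k:=(\Phi_{g_k})_\#\mu_D$, with $\Phi_{g_k}(x)=g_k(\cdot,x)$, are generalized incompressible flows; (ii) $\boldsymbol\eta_k$ narrowly converge in $\Omega(D)$ to $\boldsymbol\eta$ and $\mathscr A_T(g_k)=\mathscr A_T(\boldsymbol\eta_k)\to\mathscr A_T(\boldsymbol\eta)$ as $k\to\infty$.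
   Context: $d\ge1$ is arbitrary, $T>0$ is fixed, and $\mu_D$ is Lebesgue measure on $D=[0,1]^d$. $\Omega(D)=C([0,T];D)$ and $e_t(\omega)=\omega(t)$. $f_\#\mu$ denotes push-forward. Narrow convergence of probability measures is convergence in duality with bounded continuous functions. $\Gamma(D)$ is the set of Borel probability measures on $D\times D$ with both marginals equal to $\mu_D$. $S(D)$ is the set of measure-preserving maps $g:D\to D$, i.e. $g_\#\mu_D=\mu_D$ (not necessarily injective or smooth). Here a generalized incompressible flow is a Borel probability measure $\boldsymbol\eta$ on $\Omega(D)$ with $(e_t)_\#\boldsymbol\eta=\mu_D$ for all $t\in[0,T]$. Its action is $\mathscr A_T(\boldsymbol\eta)=\int_{\Omega(D)}\mathscr A_T(\omega)\,d\boldsymbol\eta(\omega)$, where $\mathscr A_T(\omega)=T\int_0^T\frac12|\dot\omega(t)|^2dt$ if $\omega$ is absolutely continuous in $[0,T]$ and $+\infty$ otherwise. For a flow of maps $g$, $\mathscr A_T(g)=T\int_0^T\int_D\frac12|\dot g(t,x)|^2\,d\mu_D(x)\,dt$. *)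

theory Defs
  imports "HOL-Probability.Probability"
begin

definition unit_cube :: "(real^'n) set" where
  "unit_cube = cbox 0 1"

definition mu_D :: "(real^'n) measure" where
  "mu_D = restrict_space lborel unit_cube"

definition time_measure :: "real \<Rightarrow> real measure" where
  "time_measure T = restrict_space lborel {0..T}"

subsection \<open>The path space\<close>

text \<open>
  \<open>\<Omega>(D) = C([0,T]; D)\<close> with the uniform distance. As always for \<^const>\<open>cfunspace\<close>, its elements
  are functions on the whole real line that are \<^const>\<open>undefined\<close> outside \<open>[0,T]\<close>.
\<close>

definition path_metric :: "real \<Rightarrow> (real \<Rightarrow> real^'n) metric" where
  "path_metric T = cfunspace (top_of_set {0..T}) (submetric euclidean_metric unit_cube)"

definition path_topology :: "real \<Rightarrow> (real \<Rightarrow> real^'n) topology" where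
  "path_topology T = mtopology_of (path_metric T)"

definition path_borel :: "real \<Rightarrow> (real \<Rightarrow> real^'n) measure" where
  "path_borel T = sigma (topspace (path_topology T)) {U. openin (path_topology T) U}"

definition narrowly_converges :: "'a topology \<Rightarrow> (nat \<Rightarrow> 'a measure) \<Rightarrow> 'a measure \<Rightarrow> bool" where
  "narrowly_converges X \<mu>s \<mu> \<longleftrightarrow>
     (\<forall>f :: 'a \<Rightarrow> real. continuous_map X euclidean f \<and> bounded (f ` topspace X) \<longrightarrow>
        (\<lambda>k. \<integral>\<omega>. f \<omega> \<partial>\<mu>s k) \<longlonglongrightarrow> (\<integral>\<omega>. f \<omega> \<partial>\<mu>))"

subsection \<open>Measure-preserving maps, plans and generalized incompressible flows\<close>

definition measure_preserving_maps :: "(real^'n \<Rightarrow> real^'n) set" where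
  "measure_preserving_maps = {h \<in> mu_D \<rightarrow>\<^sub>M mu_D. distr mu_D mu_D h = mu_D}"

definition measure_preserving_plans :: "((real^'n) \<times> (real^'n)) measure set" where
  "measure_preserving_plans =
     {\<gamma>. prob_space \<gamma> \<and> sets \<gamma> = sets (mu_D \<Otimes>\<^sub>M mu_D) \<and>
         distr \<gamma> mu_D fst = mu_D \<and> distr \<gamma> mu_D snd = mu_D}"

definition generalized_incompressible_flow :: "real \<Rightarrow> (real \<Rightarrow> real^'n) measure \<Rightarrow> bool" where
  "generalized_incompressible_flow T \<eta> \<longleftrightarrow>
     prob_space \<eta> \<and> sets \<eta> = sets (path_borel T) \<and>
     (\<forall>t\<in>{0..T}. distr \<eta> mu_D (\<lambda>\<omega>. \<omega> t) = mu_D)"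

subsection \<open>The action of a generalized flow\<close>

definition abs_continuous_path :: "real \<Rightarrow> (real \<Rightarrow> 'a::real_normed_vector) \<Rightarrow> bool" where
  "abs_continuous_path T \<omega> \<longleftrightarrow>
     (\<forall>\<epsilon>>0. \<exists>\<delta>>0. \<forall>(n::nat) a b.
        (\<forall>i<n. 0 \<le> a i \<and> a i \<le> b i \<and> b i \<le> T) \<and>
        (\<forall>i<n. \<forall>j<n. i \<noteq> j \<longrightarrow> {a i<..<b i} \<inter> {a j<..<b j} = {}) \<and>
        (\<Sum>i<n. b i - a i) < \<delta> \<longrightarrow>
        (\<Sum>i<n. norm (\<omega> (b i) - \<omega> (a i))) < \<epsilon>)"

text \<open>
  An absolutely continuous path is differentiable at almost every time; the arbitrary value of
  \<^const>\<open>vector_derivative\<close> at the exceptional times does not affect the integral.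
\<close>

definition path_action :: "real \<Rightarrow> (real \<Rightarrow> real^'n) \<Rightarrow> ennreal" where
  "path_action T \<omega> =
     (if abs_continuous_path T \<omega>
      then ennreal T *
        (\<integral>\<^sup>+t. ennreal (1/2 * (norm (vector_derivative \<omega> (at t within {0..T})))\<^sup>2) \<partial>time_measure T)
      else \<infinity>)"

definition generalized_flow_action :: "real \<Rightarrow> (real \<Rightarrow> real^'n) measure \<Rightarrow> ennreal" where
  "generalized_flow_action T \<eta> = (\<integral>\<^sup>+\<omega>. path_action T \<omega> \<partial>\<eta>)"

subsection \<open>Flows of maps in \<open>W\<^sup>1\<^sup>,\<^sup>2([0,T]; L\<^sup>2(D))\<close>\<close>

text \<open>
  Elements of \<open>L\<^sup>2([0,T]; L\<^sup>2(D))\<close>, where \<open>L\<^sup>2(D)\<close> consists of vector fields on \<open>D\<close>, are represented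
  by jointly measurable functions of time and space.
\<close>

definition L2_time_space :: "real \<Rightarrow> (real \<Rightarrow> real^'n \<Rightarrow> real^'n) \<Rightarrow> bool" where
  "L2_time_space T u \<longleftrightarrow>
     (\<lambda>(t, x). u t x) \<in> borel_measurable (time_measure T \<Otimes>\<^sub>M mu_D) \<and>
     (\<integral>\<^sup>+t. \<integral>\<^sup>+x. ennreal ((norm (u t x))\<^sup>2) \<partial>mu_D \<partial>time_measure T) < \<infinity>"

text \<open>
  \<open>\<phi>\<close> ranges over the test functions in \<open>C\<^sup>1\<^sub>c(0,T)\<close>, with derivative \<open>\<psi>\<close>. The equation is the identity
  \<open>\<integral> \<phi>'(t) g(t,\<cdot>) dt = - \<integral> \<phi>(t) v(t,\<cdot>) dt\<close> in \<open>L\<^sup>2(D)\<close>: for jointly measurable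
  representatives, the \<open>L\<^sup>2(D)\<close>-valued integral is computed pointwise at almost every \<open>x\<close>.
\<close>

definition has_weak_time_derivative ::
    "real \<Rightarrow> (real \<Rightarrow> real^'n \<Rightarrow> real^'n) \<Rightarrow> (real \<Rightarrow> real^'n \<Rightarrow> real^'n) \<Rightarrow> bool" where
  "has_weak_time_derivative T g v \<longleftrightarrow>
     (\<forall>(\<phi> :: real \<Rightarrow> real) \<psi>.
        (\<forall>t. (\<phi> has_real_derivative \<psi> t) (at t)) \<and> continuous_on UNIV \<psi> \<and>
        (\<exists>a b. 0 < a \<and> b < T \<and> (\<forall>t. t \<notin> {a..b} \<longrightarrow> \<phi> t = 0)) \<longrightarrow>
        (AE x in mu_D. (\<integral>t. \<psi> t *\<^sub>R g t x \<partial>time_measure T) =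
                       - (\<integral>t. \<phi> t *\<^sub>R v t x \<partial>time_measure T)))"

definition W12_flow :: "real \<Rightarrow> (real \<Rightarrow> real^'n \<Rightarrow> real^'n) \<Rightarrow> bool" where
  "W12_flow T g \<longleftrightarrow>
     L2_time_space T g \<and> (\<exists>v. L2_time_space T v \<and> has_weak_time_derivative T g v)"

text \<open>
  The velocity of a flow satisfying \<^const>\<open>W12_flow\<close>, which is unique up to null sets of \<open>[0,T] \<times> D\<close>.
\<close>

definition flow_velocity ::
    "real \<Rightarrow> (real \<Rightarrow> real^'n \<Rightarrow> real^'n) \<Rightarrow> real \<Rightarrow> real^'n \<Rightarrow> real^'n" where
  "flow_velocity T g = (SOME v. L2_time_space T v \<and> has_weak_time_derivative T g v)"

definition flow_action :: "real \<Rightarrow> (real \<Rightarrow> real^'n \<Rightarrow> real^'n) \<Rightarrow> ennreal" where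
  "flow_action T g =
     ennreal T *
       (\<integral>\<^sup>+t. \<integral>\<^sup>+x. ennreal (1/2 * (norm (flow_velocity T g t x))\<^sup>2) \<partial>mu_D \<partial>time_measure T)"

text \<open>\<open>\<Phi>\<^sub>g(x) = g(\<cdot>, x)\<close>, as an element of the path space.\<close>

definition trajectory_map :: "real \<Rightarrow> (real \<Rightarrow> real^'n \<Rightarrow> real^'n) \<Rightarrow> real^'n \<Rightarrow> (real \<Rightarrow> real^'n)" where
  "trajectory_map T g x = (\<lambda>t\<in>{0..T}. g t x)"

definition flow_measure :: "real \<Rightarrow> (real \<Rightarrow> real^'n \<Rightarrow> real^'n) \<Rightarrow> (real \<Rightarrow> real^'n) measure" where
  "flow_measure T g = distr mu_D (path_borel T) (trajectory_map T g)"

end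

theory Submission
  imports Defs
begin

text \<open>
  The maps in \<open>S(D)\<close> preserve Lebesgue measure but may be far from injective. This makes it possible to
  realise \<open>\<eta>\<close> itself as a flow of maps. The cube with Lebesgue measure has no atoms, and the path space
  is a separable complete metric space, so \<open>\<eta>\<close> is the law of a random path on the cube: there is a Borel
  map \<open>G\<close> from \<open>D\<close> to the paths whose image measure is \<open>\<eta>\<close>
  (\<open>path_measure_represented_on_cube\<close>). Put \<open>g(t, x) = G(x)(t)\<close>. Then \<open>g(t, \<cdot>)\<close> maps Lebesgue measure to
  the image of \<open>\<eta>\<close> under evaluation at \<open>t\<close>, which is Lebesgue measure again, and the measure carried by
  the trajectories of \<open>g\<close> is \<open>\<eta>\<close>. The constant sequence \<open>g\<^sub>k = g\<close> therefore converges for trivial reasons.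

  The map \<open>G\<close> is obtained from a Borel code. A path is determined by its values on a countable dense set
  of times, these values are determined by countably many bits, and the bits can be stored in and read
  off from a real number (\<open>cube_decode_code\<close>). The image of \<open>\<eta>\<close> under the code is a law on the line, which is
  the image of the uniform law under its quantile function, and a coordinate of the cube is uniform.

  What remains is that \<open>g\<close> belongs to \<open>W\<^sup>1\<^sup>,\<^sup>2([0,T]; L\<^sup>2(D))\<close> and that its action, defined by the weak time
  derivative, equals the action of \<open>\<eta>\<close>, defined by the classical derivatives of absolutely continuous
  paths. This rests on the fundamental theorem of calculus for absolutely continuous paths
  (\<open>abs_continuous_path_fundamental\<close>): such a path is almost everywhere differentiable and is the integral
  of its derivative. The existence of a density comes from the Radon-Nikodym theorem, applied to the
  Stieltjes measures of two increasing absolutely continuous functions whose difference is a component of the path; that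
  the density is the derivative is the Lebesgue differentiation theorem, which comes from the Vitali
  covering theorem (\<open>AE_Lebesgue_point\<close>).

  Integrals over \<open>\<eta>\<close> can be moved to the cube only for measurable integrands. The action of a path is
  measurable because absolute continuity can be tested on the countable dense set of times, and because the
  derivative, where it exists, is the limit of a sequence of difference quotients
  (\<open>path_action_measurable\<close>). Tonelli's theorem then identifies the two actions, once the weak derivative
  is known to be unique (\<open>weak_derivative_unique\<close>).
\<close>

section \<open>Lebesgue points on the line\<close>

text \<open>Vitali covering: balls that carry \<open>M\<close>-mass at least \<open>c\<close> times their radius and lie in an open set of
small \<open>M\<close>-measure around \<open>A\<close> cover almost all of the exceptional set, and disjoint ones among them have
small total length.\<close>

lemma frequently_dense_null:
  fixes M :: "real measure"
  assumes "finite_measure M" and sets: "sets M = sets borel"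
    and A: "A \<in> sets borel" "emeasure M A = 0" and c: "0 < c"
  shows "negligible {x\<in>A. \<forall>d>0. \<exists>r. 0 < r \<and> r < d \<and> c * r < measure M (cball x r)}"
    (is "negligible ?S")
proof -
  interpret finite_measure M by fact
  have sp: "space M = UNIV" using sets_eq_imp_space_eq[OF sets] by simp
  show ?thesis
    unfolding negligible_outer_le
  proof (intro allI impI)
    fix e :: real assume e: "0 < e"
    \<comment> \<open>a ball of radius \<open>r\<close> has length \<open>2 r\<close>, hence length at most \<open>2 / c\<close> times its \<open>M\<close>-mass\<close>
    define \<delta> where "\<delta> = c * e / 2"
    have "\<delta> > 0" using e c by (simp add: \<delta>_def)
    have "(INF U \<in> {U. A \<subseteq> U \<and> open U}. emeasure M U) = 0"
      using outer_regular[OF sets _ A(1)] A(2) by simp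
    then have "(INF U \<in> {U. A \<subseteq> U \<and> open U}. emeasure M U) < ennreal \<delta>"
      using \<open>\<delta> > 0\<close> by simp
    then obtain U where U: "A \<subseteq> U" "open U" "emeasure M U < ennreal \<delta>"
      unfolding INF_less_iff by auto
    have mU: "measure M U < \<delta>"
      using U(3) \<open>\<delta> > 0\<close> by (simp add: emeasure_eq_measure ennreal_less_iff)
    define K where "K = {p :: real \<times> real. 0 < snd p \<and> cball (fst p) (snd p) \<subseteq> U \<and>
                         c * snd p < measure M (cball (fst p) (snd p))}"
    obtain C where C: "countable C" "C \<subseteq> K"
      "pairwise (\<lambda>i j. disjnt (cball (fst i) (snd i)) (cball (fst j) (snd j))) C"
      "negligible (?S - (\<Union>i\<in>C. cball (fst i) (snd i)))"
    proof (rule Vitali_covering_theorem_cballs[of K snd ?S fst])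
      show "0 < snd i" if "i \<in> K" for i using that by (simp add: K_def)
      show "\<exists>i. i \<in> K \<and> x \<in> cball (fst i) (snd i) \<and> snd i < d" if "x \<in> ?S" "0 < d" for x d
      proof -
        have "x \<in> U" using that(1) U(1) by blast
        then obtain \<rho> where "\<rho> > 0" "cball x \<rho> \<subseteq> U"
          using U(2) open_contains_cball by blast
        have "0 < min d \<rho>" using that(2) \<open>\<rho> > 0\<close> by simp
        moreover have "\<forall>d>0. \<exists>r. 0 < r \<and> r < d \<and> c * r < measure M (cball x r)"
          using that(1) by simp
        ultimately obtain r where "0 < r" "r < min d \<rho>" "c * r < measure M (cball x r)"
          by meson
        have "(x, r) \<in> K"
          using \<open>cball x \<rho> \<subseteq> U\<close> \<open>0 < r\<close> \<open>r < min d \<rho>\<close> \<open>c * r < measure M (cball x r)\<close> subset_cball[of r \<rho> x] by (auto simp: K_def)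
        then show ?thesis
          using \<open>0 < r\<close> \<open>r < min d \<rho>\<close> by (intro exI[of _ "(x, r)"]) auto
      qed
    qed blast
    define W where "W = (\<Union>i\<in>C. cball (fst i) (snd i))"
    have mW: "W \<in> sets borel" unfolding W_def using C(1) by (intro sets.countable_UN') auto
    have disj: "disjoint_family_on (\<lambda>i. cball (fst i) (snd i)) C"
      using C(3) by (auto simp: disjoint_family_on_def pairwise_def disjnt_def)
    have "emeasure lborel W = (\<integral>\<^sup>+i. emeasure lborel (cball (fst i) (snd i)) \<partial>count_space C)"
      unfolding W_def by (intro emeasure_UN_countable) (use C(1) disj in auto)
    also have "\<dots> \<le> (\<integral>\<^sup>+i. ennreal (2 / c) * emeasure M (cball (fst i) (snd i)) \<partial>count_space C)"
    proof (intro nn_integral_mono)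
      fix i assume "i \<in> space (count_space C)"
      then have i: "0 < snd i" "c * snd i < measure M (cball (fst i) (snd i))"
        using C(2) by (auto simp: K_def)
      have "emeasure lborel (cball (fst i) (snd i)) = ennreal (2 * snd i)"
        using i(1) by (simp add: cball_eq_atLeastAtMost)
      also have "\<dots> \<le> ennreal (2 / c * measure M (cball (fst i) (snd i)))"
        using i c by (intro ennreal_leI) (simp add: field_simps)
      finally show "emeasure lborel (cball (fst i) (snd i)) \<le> ennreal (2 / c) * emeasure M (cball (fst i) (snd i))"
        using c by (simp add: emeasure_eq_measure flip: ennreal_mult)
    qed
    also have "\<dots> = ennreal (2 / c) * emeasure M W"
      unfolding W_def using C(1) disj sets
      by (subst emeasure_UN_countable) (auto simp: nn_integral_cmult)
    also have "\<dots> \<le> ennreal (2 / c) * ennreal \<delta>"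
    proof (intro mult_left_mono)
      have "emeasure M W \<le> emeasure M U"
        using C(2) U(2) sets by (intro emeasure_mono) (auto simp: W_def K_def)
      then show "emeasure M W \<le> ennreal \<delta>" using U(3) by simp
    qed simp
    also have "\<dots> = ennreal e" using c e by (simp add: \<delta>_def flip: ennreal_mult)
    finally have W: "emeasure lborel W \<le> ennreal e" .
    define N where "N = ?S - W"
    have N: "negligible N" using C(4) by (simp add: N_def W_def)
    have WN: "W \<in> lmeasurable"
      using W mW by (intro fmeasurableI) (auto simp: le_less_trans[OF W])
    have "measure lebesgue (W \<union> N) \<le> measure lebesgue W + measure lebesgue N"
      by (rule measure_Un_le) (use WN N negligible_imp_sets in auto)
    also have "\<dots> \<le> e"
    proof -
      have "measure lebesgue W = enn2real (emeasure lborel W)"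
        using mW by (simp add: measure_def)
      also have "\<dots> \<le> e" using W e by (intro enn2real_leI) auto
      finally show ?thesis using negligible_imp_measure0[OF N] by simp
    qed
    finally show "\<exists>T. ?S \<subseteq> T \<and> T \<in> lmeasurable \<and> measure lebesgue T \<le> e"
    proof (intro exI[of _ "W \<union> N"] conjI)
      show "?S \<subseteq> W \<union> N" unfolding N_def by blast
      show "W \<union> N \<in> lmeasurable"
        using fmeasurable.Un[OF WN negligible_imp_measurable[OF N]] .
    qed
  qed
qed

lemma negligible_imp_AE_lborel: "negligible N \<Longrightarrow> AE x in lborel. x \<notin> N"
  unfolding negligible_iff_null_sets using AE_completion_iff AE_not_in by blast


lemma measure_density_eq_set_integral:
  fixes w :: "'a \<Rightarrow> real"
  assumes "integrable M w" "\<And>u. 0 \<le> w u" "B \<in> sets M"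
  shows "measure (density M (\<lambda>u. ennreal (w u))) B = (LINT u:B|M. w u)"
proof -
  have [measurable]: "w \<in> borel_measurable M" "B \<in> sets M" using assms by auto
  have "emeasure (density M (\<lambda>u. ennreal (w u))) B = (\<integral>\<^sup>+u. ennreal (indicator B u *\<^sub>R w u) \<partial>M)"
    by (subst emeasure_density) (auto intro!: nn_integral_cong split: split_indicator)
  also have "\<dots> = ennreal (LINT u:B|M. w u)"
    unfolding set_lebesgue_integral_def
    by (rule nn_integral_eq_integral) (use assms integrable_mult_indicator[OF assms(3,1)] in auto)
  finally show ?thesis
    unfolding measure_def using assms(2)
    by (simp add: set_lebesgue_integral_def integral_nonneg_AE)
qed

text \<open>For a rational \<open>q\<close> the measure with density \<open>max 0 (h - q)\<close> vanishes on the set where \<open>h \<le> q\<close>. By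
\<open>frequently_dense_null\<close> its averages over small balls tend to zero at almost every point of this set, so the
upper limit of the averages of \<open>h\<close> is at most \<open>q\<close> there. Choosing \<open>q\<close> between \<open>h t\<close> and \<open>c\<close> gives the claim.\<close>

lemma AE_upper_density_le:
  fixes h :: "real \<Rightarrow> real"
  assumes h: "integrable lborel h"
  shows "AE t in lborel. \<forall>c>h t. \<exists>d>0. \<forall>a b. a \<le> t \<and> t \<le> b \<and> b - a < d \<longrightarrow>
           (LINT u:{a..b}|lborel. h u) \<le> c * (b - a)"
proof -
  have [measurable]: "h \<in> borel_measurable borel" using h by auto
  \<comment> \<open>the cut-off to a bounded interval keeps the measure finite when \<open>r\<close> is negative\<close>
  define w where "w m r u = indicator {- real m..real m} u * max 0 (h u - r)" for m :: nat and r u :: real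
  define M where "M m r = density lborel (\<lambda>u. ennreal (w m r u))" for m r
  define A where "A r = {u. h u \<le> r}" for r
  have A: "A r \<in> sets borel" for r unfolding A_def by measurable
  have wi: "integrable lborel (w m r)" for m r
  proof (rule Bochner_Integration.integrable_bound)
    show "integrable lborel (\<lambda>u. \<bar>h u\<bar> + indicator {- real m..real m} u * \<bar>r\<bar>)"
      using h by (intro Bochner_Integration.integrable_add integrable_abs integrable_mult_left) auto
    show "w m r \<in> borel_measurable lborel" unfolding w_def by measurable
  qed (auto simp: w_def split: split_indicator)
  have w0: "0 \<le> w m r u" for m r u by (simp add: w_def)
  have "finite_measure (M m r)" for m r
  proof
    have "emeasure (M m r) (space (M m r)) = (\<integral>\<^sup>+u. ennreal (w m r u) \<partial>lborel)"
      unfolding M_def using borel_measurable_integrable[OF wi[of m r]]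
      by (subst emeasure_density) auto
    then show "emeasure (M m r) (space (M m r)) \<noteq> \<infinity>"
      using nn_integral_eq_integral[OF wi[of m r]] w0 by simp
  qed
  moreover have "emeasure (M m r) (A r) = 0" for m r
    unfolding M_def using borel_measurable_integrable[OF wi[of m r]] A
    by (subst emeasure_density) (auto simp: w_def A_def nn_integral_0_iff_AE split: split_indicator)
  ultimately have neg: "negligible {x\<in>A (of_rat r). \<forall>d>0. \<exists>s. 0 < s \<and> s < d \<and>
      1 / real (Suc n) * s < measure (M m (of_rat r)) (cball x s)}" for m n and r :: rat
    by (intro frequently_dense_null A) (auto simp: M_def)
  have "AE t in lborel. \<forall>m (r::rat) n. t \<notin> {x\<in>A (of_rat r). \<forall>d>0. \<exists>s. 0 < s \<and> s < d \<and>
      1 / real (Suc n) * s < measure (M m (of_rat r)) (cball x s)}"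
    unfolding AE_all_countable using neg negligible_imp_AE_lborel by blast
  then show ?thesis
  proof (rule AE_mp, intro AE_I2 impI allI)
    fix t c
    assume t: "\<forall>m (r::rat) n. t \<notin> {x\<in>A (of_rat r). \<forall>d>0. \<exists>s. 0 < s \<and> s < d \<and>
      1 / real (Suc n) * s < measure (M m (of_rat r)) (cball x s)}" and c: "h t < c"
    obtain r where r: "h t < of_rat r" "of_rat r < c" using of_rat_dense[OF c] by blast
    obtain n where n: "1 / real (Suc n) < c - of_rat r"
      using r(2) reals_Archimedean[of "c - of_rat r"] by (auto simp: inverse_eq_divide)
    obtain m where m: "\<bar>t\<bar> < real m" using reals_Archimedean2 by blast
    have "t \<in> A (of_rat r)" using r by (simp add: A_def)
    then have "\<exists>d>0. \<forall>s. \<not> (0 < s \<and> s < d \<and>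
        1 / real (Suc n) * s < measure (M m (of_rat r)) (cball t s))"
      using t[THEN spec, of m, THEN spec, of r, THEN spec, of n] by blast
    then obtain d where d: "d > 0" "\<And>s. 0 < s \<Longrightarrow> s < d \<Longrightarrow>
        measure (M m (of_rat r)) (cball t s) \<le> 1 / real (Suc n) * s"
      by (meson not_less)
    show "\<exists>d>0. \<forall>a b. a \<le> t \<and> t \<le> b \<and> b - a < d \<longrightarrow> (LINT u:{a..b}|lborel. h u) \<le> c * (b - a)"
    proof (intro exI[of _ "min d (real m - \<bar>t\<bar>)"] conjI allI impI)
      show "0 < min d (real m - \<bar>t\<bar>)" using d m by simp
      fix a b assume ab: "a \<le> t \<and> t \<le> b \<and> b - a < min d (real m - \<bar>t\<bar>)"
      have hi: "set_integrable lborel S h" if "S \<in> sets borel" for S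
        using h that unfolding set_integrable_def by (intro integrable_mult_indicator) auto
      show "(LINT u:{a..b}|lborel. h u) \<le> c * (b - a)"
      proof (cases "a = b")
        case True
        have "(LINT u:{b..b}|lborel. h u) = 0"
          unfolding set_lebesgue_integral_def
          by (rule integral_eq_zero_AE)
            (rule AE_mp[OF AE_lborel_singleton[of b]], auto split: split_indicator)
        then show ?thesis using True by simp
      next
        case False
        define s where "s = b - a"
        have s: "0 < s" "s < d" using False ab by (auto simp: s_def)
        have sub: "{a..b} \<subseteq> cball t s" "{a..b} \<subseteq> {- real m..real m}"
          using ab by (auto simp: s_def dist_real_def)
        have ci: "set_integrable lborel {a..b} (\<lambda>_. of_rat r :: real)"
          unfolding set_integrable_def using lmeasurable_cbox[of a b]
          by (auto simp: integrable_indicator_iff emeasure_lborel_Icc_eq)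
        have "(LINT u:{a..b}|lborel. of_rat r :: real) = of_rat r * s"
          using ab unfolding set_lebesgue_integral_def by (simp add: s_def)
        then have "(LINT u:{a..b}|lborel. h u) = (LINT u:{a..b}|lborel. h u - of_rat r) + of_rat r * s"
          using set_integral_diff(2)[OF hi ci] by simp
        also have "(LINT u:{a..b}|lborel. h u - of_rat r) \<le> (LINT u:cball t s|lborel. w m (of_rat r) u)"
          unfolding set_lebesgue_integral_def
        proof (rule integral_mono)
          show "integrable lborel (\<lambda>u. indicator {a..b} u *\<^sub>R (h u - of_rat r))"
            using set_integral_diff(1)[OF hi ci] unfolding set_integrable_def by auto
          show "integrable lborel (\<lambda>u. indicator (cball t s) u *\<^sub>R w m (of_rat r) u)"
            by (intro integrable_mult_indicator wi) auto
          show "indicator {a..b} u *\<^sub>R (h u - of_rat r) \<le> indicator (cball t s) u *\<^sub>R w m (of_rat r) u" for u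
            using sub w0[of m "of_rat r" u] by (auto simp: w_def split: split_indicator)
        qed
        also have "(LINT u:cball t s|lborel. w m (of_rat r) u) = measure (M m (of_rat r)) (cball t s)"
          unfolding M_def using wi w0 by (subst measure_density_eq_set_integral) auto
        also have "\<dots> \<le> (c - of_rat r) * s"
          using d(2)[OF s] n s(1) mult_right_mono[of "1 / real (Suc n)" "c - of_rat r" s] by linarith
        finally show ?thesis by (simp add: s_def algebra_simps)
      qed
    qed
  qed
qed

text \<open>The upper bound for \<open>h\<close> and for \<open>- h\<close>. The intervals may have \<open>t\<close> as an end point, which yields the
derivative of an indefinite integral without passing through centred balls.\<close>

theorem AE_Lebesgue_point:
  fixes h :: "real \<Rightarrow> real"
  assumes h: "integrable lborel h"
  shows "AE t in lborel. \<forall>\<epsilon>>0. \<exists>d>0. \<forall>a b. a \<le> t \<and> t \<le> b \<and> b - a < d \<longrightarrow>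
           \<bar>(LINT u:{a..b}|lborel. h u) - h t * (b - a)\<bar> \<le> \<epsilon> * (b - a)"
  using AE_upper_density_le[OF h] AE_upper_density_le[OF integrable_minus[OF h]]
proof eventually_elim
  case (elim t)
  show ?case
  proof (intro allI impI)
    fix \<epsilon> :: real assume "0 < \<epsilon>"
    obtain d1 where d1: "d1 > 0" "\<And>a b. a \<le> t \<and> t \<le> b \<and> b - a < d1 \<Longrightarrow>
        (LINT u:{a..b}|lborel. h u) \<le> (h t + \<epsilon>) * (b - a)"
      using elim(1)[rule_format, of "h t + \<epsilon>"] \<open>0 < \<epsilon>\<close> by auto
    obtain d2 where d2: "d2 > 0" "\<And>a b. a \<le> t \<and> t \<le> b \<and> b - a < d2 \<Longrightarrow>
        (LINT u:{a..b}|lborel. - h u) \<le> (- h t + \<epsilon>) * (b - a)"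
      using elim(2)[rule_format, of "- h t + \<epsilon>"] \<open>0 < \<epsilon>\<close> by auto
    show "\<exists>d>0. \<forall>a b. a \<le> t \<and> t \<le> b \<and> b - a < d \<longrightarrow>
           \<bar>(LINT u:{a..b}|lborel. h u) - h t * (b - a)\<bar> \<le> \<epsilon> * (b - a)"
    proof (intro exI[of _ "min d1 d2"] conjI allI impI)
      fix a b assume "a \<le> t \<and> t \<le> b \<and> b - a < min d1 d2"
      then show "\<bar>(LINT u:{a..b}|lborel. h u) - h t * (b - a)\<bar> \<le> \<epsilon> * (b - a)"
        using d1(2)[of a b] d2(2)[of a b]
        by (auto simp: abs_le_iff algebra_simps set_lebesgue_integral_def)
    qed (use d1 d2 in auto)
  qed
qed

section \<open>Absolute continuity and variation\<close>

definition nonoverlapping :: "'i set \<Rightarrow> ('i \<Rightarrow> real) \<Rightarrow> ('i \<Rightarrow> real) \<Rightarrow> bool" where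
  "nonoverlapping I a b \<longleftrightarrow> finite I \<and> (\<forall>i\<in>I. a i \<le> b i) \<and>
     (\<forall>i\<in>I. \<forall>j\<in>I. i \<noteq> j \<longrightarrow> {a i<..<b i} \<inter> {a j<..<b j} = {})"

text \<open>Absolute continuity on the whole line. A path on \<open>[0,T]\<close> is put into this form by freezing it outside
\<open>[0,T]\<close>, which removes the constraints on the end points of the intervals.\<close>

definition abs_continuous :: "(real \<Rightarrow> real) \<Rightarrow> bool" where
  "abs_continuous f \<longleftrightarrow> (\<forall>\<epsilon>>0. \<exists>\<delta>>0. \<forall>(I :: nat set) a b.
     nonoverlapping I a b \<and> (\<Sum>i\<in>I. b i - a i) < \<delta> \<longrightarrow> (\<Sum>i\<in>I. \<bar>f (b i) - f (a i)\<bar>) \<le> \<epsilon>)"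

text \<open>The total variation on \<open>[x,y]\<close>, as an extended number so that the supremum always exists.\<close>

definition variation :: "(real \<Rightarrow> real) \<Rightarrow> real \<Rightarrow> real \<Rightarrow> ennreal" where
  "variation f x y = (SUP (n :: nat, a, b) \<in> {(n, a, b). nonoverlapping {..<n} a b \<and>
     (\<forall>i<n. x \<le> a i \<and> b i \<le> y)}. \<Sum>i<n. ennreal \<bar>f (b i) - f (a i)\<bar>)"

lemma nonoverlapping_reindex:
  assumes "nonoverlapping I a b" "bij_betw g J I"
  shows "nonoverlapping J (a \<circ> g) (b \<circ> g)"
proof -
  have "finite J" using assms bij_betw_finite by (auto simp: nonoverlapping_def)
  moreover have "g i \<in> I" if "i \<in> J" for i using assms(2) that by (auto simp: bij_betw_def)
  moreover have "g i \<noteq> g j" if "i \<in> J" "j \<in> J" "i \<noteq> j" for i j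
    using assms(2) that by (auto simp: bij_betw_def inj_on_def)
  ultimately show ?thesis using assms(1) unfolding nonoverlapping_def by auto
qed

text \<open>The index set is arbitrary, because families of families of intervals and sets of intervals occur as well.\<close>

lemma abs_continuousE:
  assumes "abs_continuous f" "0 < \<epsilon>"
  obtains \<delta> where "0 < \<delta>" "\<And>(I :: 'i set) a b. nonoverlapping I a b \<Longrightarrow>
      (\<Sum>i\<in>I. b i - a i) < \<delta> \<Longrightarrow> (\<Sum>i\<in>I. \<bar>f (b i) - f (a i)\<bar>) \<le> \<epsilon>"
proof -
  obtain \<delta> where \<delta>: "\<delta> > 0" "\<And>(I :: nat set) a b. nonoverlapping I a b \<Longrightarrow>
      (\<Sum>i\<in>I. b i - a i) < \<delta> \<Longrightarrow> (\<Sum>i\<in>I. \<bar>f (b i) - f (a i)\<bar>) \<le> \<epsilon>"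
    using assms unfolding abs_continuous_def by meson
  have "(\<Sum>i\<in>I. \<bar>f (b i) - f (a i)\<bar>) \<le> \<epsilon>"
    if I: "nonoverlapping I a b" "(\<Sum>i\<in>I. b i - a i) < \<delta>" for I :: "'i set" and a b
  proof -
    obtain g where g: "bij_betw g {0..<card I} I"
      using I(1) ex_bij_betw_nat_finite[of I] by (auto simp: nonoverlapping_def)
    then show ?thesis
      using \<delta>(2)[OF nonoverlapping_reindex[OF I(1) g]] I(2)
        sum.reindex_bij_betw[OF g, of "\<lambda>i. b i - a i"]
        sum.reindex_bij_betw[OF g, of "\<lambda>i. \<bar>f (b i) - f (a i)\<bar>"] by simp
  qed
  then show thesis using \<delta>(1) that by blast
qed

lemma sum_length_nonoverlapping_le:
  assumes "nonoverlapping I a b" "\<And>i. i \<in> I \<Longrightarrow> x \<le> a i \<and> b i \<le> y" "x \<le> y"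
  shows "(\<Sum>i\<in>I. b i - a i) \<le> y - x"
proof -
  have "(\<Sum>i\<in>I. b i - a i) = (\<Sum>i\<in>I. measure lborel {a i<..<b i})"
    using assms(1) by (intro sum.cong) (auto simp: nonoverlapping_def)
  also have "\<dots> = measure lborel (\<Union>i\<in>I. {a i<..<b i})"
    using assms(1)
    by (intro measure_finite_Union[symmetric])
      (auto simp: nonoverlapping_def disjoint_family_on_def emeasure_lborel_Ioo)
  also have "\<dots> \<le> measure lborel {x..y}"
  proof (rule measure_mono_fmeasurable)
    show "(\<Union>i\<in>I. {a i<..<b i}) \<subseteq> {x..y}" using assms(2) by fastforce
    show "(\<Union>i\<in>I. {a i<..<b i}) \<in> sets lborel" using assms(1) by (auto simp: nonoverlapping_def)
  qed (auto simp: fmeasurable_def emeasure_lborel_Icc_eq)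
  finally show ?thesis using assms(3) by simp
qed

lemma nonoverlapping_subintervals:
  assumes "nonoverlapping I a b" "\<And>i. i \<in> I \<Longrightarrow> a' i \<le> b' i"
    and sub: "\<And>i. {a' i<..<b' i} \<subseteq> {a i<..<b i}"
  shows "nonoverlapping I a' b'"
  unfolding nonoverlapping_def
proof (intro conjI ballI impI)
  fix i j assume "i \<in> I" "j \<in> I" "i \<noteq> j"
  then have "{a i<..<b i} \<inter> {a j<..<b j} = {}" using assms(1) unfolding nonoverlapping_def by blast
  then show "{a' i<..<b' i} \<inter> {a' j<..<b' j} = {}" using sub[of i] sub[of j] by blast
qed (use assms in \<open>auto simp: nonoverlapping_def\<close>)

lemma nonoverlapping_min: "nonoverlapping I a b \<Longrightarrow> nonoverlapping I (\<lambda>i. min (a i) y) (\<lambda>i. min (b i) y)"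
  by (rule nonoverlapping_subintervals[of I a b]) (auto simp: nonoverlapping_def intro: min.mono)

lemma nonoverlapping_max: "nonoverlapping I a b \<Longrightarrow> nonoverlapping I (\<lambda>i. max (a i) y) (\<lambda>i. max (b i) y)"
  by (rule nonoverlapping_subintervals[of I a b]) (auto simp: nonoverlapping_def intro: max.mono)

lemma variation_upper:
  fixes n :: nat
  assumes "nonoverlapping {..<n} a b" "\<And>i. i < n \<Longrightarrow> x \<le> a i \<and> b i \<le> y"
  shows "(\<Sum>i<n. ennreal \<bar>f (b i) - f (a i)\<bar>) \<le> variation f x y"
  unfolding variation_def
  by (rule SUP_upper2[of "(n, a, b)"]) (use assms in auto)

lemma variation_least:
  assumes "\<And>(n :: nat) a b. nonoverlapping {..<n} a b \<Longrightarrow> (\<And>i. i < n \<Longrightarrow> x \<le> a i \<and> b i \<le> y) \<Longrightarrow>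
      (\<Sum>i<n. ennreal \<bar>f (b i) - f (a i)\<bar>) \<le> c"
  shows "variation f x y \<le> c"
  unfolding variation_def by (rule SUP_least) (use assms in auto)

text \<open>Every interval is cut at \<open>y\<close>; the two pieces of an interval that does not contain \<open>y\<close> are the interval
itself and a degenerate one.\<close>

lemma variation_triangle:
  assumes "x \<le> y" "y \<le> z"
  shows "variation f x z \<le> variation f x y + variation f y z"
proof (rule variation_least)
  fix n :: nat and a b assume ab: "nonoverlapping {..<n} a b" "\<And>i. i < n \<Longrightarrow> x \<le> a i \<and> b i \<le> z"
  have "(\<Sum>i<n. ennreal \<bar>f (b i) - f (a i)\<bar>) \<le>
      (\<Sum>i<n. ennreal \<bar>f (min (b i) y) - f (min (a i) y)\<bar> + ennreal \<bar>f (max (b i) y) - f (max (a i) y)\<bar>)"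
  proof (rule sum_mono)
    fix i assume "i \<in> {..<n}"
    have "\<bar>f (b i) - f (a i)\<bar> \<le> \<bar>f (min (b i) y) - f (min (a i) y)\<bar> + \<bar>f (max (b i) y) - f (max (a i) y)\<bar>"
      by (auto simp: min_def max_def)
    then show "ennreal \<bar>f (b i) - f (a i)\<bar> \<le>
      ennreal \<bar>f (min (b i) y) - f (min (a i) y)\<bar> + ennreal \<bar>f (max (b i) y) - f (max (a i) y)\<bar>"
      by (simp flip: ennreal_plus add: ennreal_leI)
  qed
  also have "\<dots> \<le> variation f x y + variation f y z"
    unfolding sum.distrib
  proof (rule add_mono)
    show "(\<Sum>i<n. ennreal \<bar>f (min (b i) y) - f (min (a i) y)\<bar>) \<le> variation f x y"
      by (rule variation_upper[OF nonoverlapping_min[OF ab(1)]]) (use ab(2) assms in auto)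
    show "(\<Sum>i<n. ennreal \<bar>f (max (b i) y) - f (max (a i) y)\<bar>) \<le> variation f y z"
      by (rule variation_upper[OF nonoverlapping_max[OF ab(1)]]) (use ab(2) assms in auto)
  qed
  finally show "(\<Sum>i<n. ennreal \<bar>f (b i) - f (a i)\<bar>) \<le> variation f x y + variation f y z" .
qed

lemma variation_add_increment:
  assumes "x \<le> y" "y \<le> z"
  shows "variation f x y + ennreal \<bar>f z - f y\<bar> \<le> variation f x z"
proof -
  have ne: "{(n :: nat, a, b). nonoverlapping {..<n} a b \<and> (\<forall>i<n. x \<le> a i \<and> b i \<le> y)} \<noteq> {}"
    by (auto intro!: exI[of _ "0::nat"] simp: nonoverlapping_def)
  show ?thesis
    unfolding variation_def[of f x y] ennreal_SUP_add_left[OF ne, symmetric]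
  proof (rule SUP_least, clarify)
    fix n :: nat and a b assume ab: "nonoverlapping {..<n} a b" "\<forall>i<n. x \<le> a i \<and> b i \<le> y"
    have "nonoverlapping {..<Suc n} (a(n := y)) (b(n := z))"
      using ab assms unfolding nonoverlapping_def lessThan_Suc disjoint_iff
      by (auto; fastforce)
    then have "(\<Sum>i<Suc n. ennreal \<bar>f ((b(n := z)) i) - f ((a(n := y)) i)\<bar>) \<le> variation f x z"
      by (rule variation_upper) (use ab assms in \<open>auto simp: less_Suc_eq\<close>)
    then show "(\<Sum>i<n. ennreal \<bar>f (b i) - f (a i)\<bar>) + ennreal \<bar>f z - f y\<bar> \<le> variation f x z" by simp
  qed
qed

lemma variation_mono:
  assumes "x \<le> y" "y \<le> z" shows "variation f x y \<le> variation f x z"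
  by (rule variation_least) (use assms in \<open>fastforce intro: variation_upper\<close>)

text \<open>The summand \<open>r\<close> holds, during the induction on the index set, the terms whose choice is already fixed.\<close>

lemma sum_SUP_le:
  fixes g :: "'i \<Rightarrow> 'j \<Rightarrow> ennreal"
  assumes "finite I" "\<And>i. i \<in> I \<Longrightarrow> J i \<noteq> {}"
    and "\<And>c. (\<forall>i\<in>I. c i \<in> J i) \<Longrightarrow> (\<Sum>i\<in>I. g i (c i)) + r \<le> e"
  shows "(\<Sum>i\<in>I. SUP j\<in>J i. g i j) + r \<le> e"
  using assms
proof (induction I arbitrary: r rule: finite_induct)
  case empty
  then show ?case by simp
next
  case (insert i I)
  have *: "(\<Sum>i\<in>I. SUP j\<in>J i. g i j) + (g i j + r) \<le> e" if "j \<in> J i" for j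
  proof (rule insert.IH)
    fix c assume c: "\<forall>i\<in>I. c i \<in> J i"
    have "(\<Sum>k\<in>I. g k ((c(i := j)) k)) = (\<Sum>k\<in>I. g k (c k))"
      by (intro sum.cong) (use insert.hyps in auto)
    then show "(\<Sum>k\<in>I. g k (c k)) + (g i j + r) \<le> e"
      using insert.prems(2)[of "c(i := j)"] insert.hyps c that by (auto simp: ac_simps)
  qed (use insert.prems in auto)
  have "(SUP j\<in>J i. g i j) + ((\<Sum>i\<in>I. SUP j\<in>J i. g i j) + r) \<le> e"
    using insert.prems(1)[of i]
    by (subst ennreal_SUP_add_left[symmetric])
      (auto intro!: SUP_least simp: ac_simps dest: *)
  then show ?case using insert.hyps by (simp add: ac_simps)
qed

text \<open>Replacing each interval by an arbitrary subdivision of it does not increase the total length, so the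
condition of absolute continuity passes from the increments of \<open>f\<close> to its variations.\<close>

lemma abs_continuous_sum_variation:
  assumes "abs_continuous f" "0 < \<epsilon>"
  obtains \<delta> where "0 < \<delta>" "\<And>(I :: nat set) a b. nonoverlapping I a b \<Longrightarrow>
      (\<Sum>i\<in>I. b i - a i) < \<delta> \<Longrightarrow> (\<Sum>i\<in>I. variation f (a i) (b i)) \<le> ennreal \<epsilon>"
proof -
  obtain \<delta> where \<delta>: "\<delta> > 0" "\<And>(I :: (nat \<times> nat) set) a b. nonoverlapping I a b \<Longrightarrow>
      (\<Sum>i\<in>I. b i - a i) < \<delta> \<Longrightarrow> (\<Sum>i\<in>I. \<bar>f (b i) - f (a i)\<bar>) \<le> \<epsilon>"
    by (rule abs_continuousE[OF assms]) (rule that)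
  have "(\<Sum>i\<in>I. variation f (a i) (b i)) + 0 \<le> ennreal \<epsilon>"
    if I: "nonoverlapping I a b" "(\<Sum>i\<in>I. b i - a i) < \<delta>" for I :: "nat set" and a b
    unfolding variation_def
  proof (rule sum_SUP_le)
    show "finite I" using I(1) by (simp add: nonoverlapping_def)
    show "{(n :: nat, a', b'). nonoverlapping {..<n} a' b' \<and> (\<forall>k<n. a i \<le> a' k \<and> b' k \<le> b i)} \<noteq> {}" for i
      by (auto intro!: exI[of _ "0::nat"] simp: nonoverlapping_def)
    fix c :: "nat \<Rightarrow> nat \<times> (nat \<Rightarrow> real) \<times> (nat \<Rightarrow> real)"
    assume c: "\<forall>i\<in>I. c i \<in> {(n, a', b'). nonoverlapping {..<n} a' b' \<and> (\<forall>k<n. a i \<le> a' k \<and> b' k \<le> b i)}"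
    define n where "n i = fst (c i)" for i
    define a' where "a' i = fst (snd (c i))" for i
    define b' where "b' i = snd (snd (c i))" for i
    have c': "nonoverlapping {..<n i} (a' i) (b' i)" "\<And>k. k < n i \<Longrightarrow> a i \<le> a' i k \<and> b' i k \<le> b i"
      if "i \<in> I" for i using c that by (auto simp: n_def a'_def b'_def)
    have no: "nonoverlapping (Sigma I (\<lambda>i. {..<n i})) (\<lambda>(i, k). a' i k) (\<lambda>(i, k). b' i k)"
      unfolding nonoverlapping_def
    proof (intro conjI ballI impI)
      show "finite (Sigma I (\<lambda>i. {..<n i}))" using \<open>finite I\<close> by auto
      fix p assume p: "p \<in> Sigma I (\<lambda>i. {..<n i})"
      obtain i k where ik: "p = (i, k)" "i \<in> I" "k < n i" using p by auto
      show "(case p of (i, k) \<Rightarrow> a' i k) \<le> (case p of (i, k) \<Rightarrow> b' i k)"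
        using ik c'(1)[OF ik(2)] by (auto simp: nonoverlapping_def)
      fix q assume q: "q \<in> Sigma I (\<lambda>i. {..<n i})" "p \<noteq> q"
      obtain j l where jl: "q = (j, l)" "j \<in> I" "l < n j" using q by auto
      show "{(case p of (i, k) \<Rightarrow> a' i k)<..<(case p of (i, k) \<Rightarrow> b' i k)} \<inter>
            {(case q of (i, k) \<Rightarrow> a' i k)<..<(case q of (i, k) \<Rightarrow> b' i k)} = {}"
      proof (cases "i = j")
        case True
        then show ?thesis using ik jl q(2) c'(1)[OF ik(2)] by (auto simp: nonoverlapping_def)
      next
        case False
        have "{a' i k<..<b' i k} \<subseteq> {a i<..<b i}" "{a' j l<..<b' j l} \<subseteq> {a j<..<b j}"
          using c'(2)[OF ik(2,3)] c'(2)[OF jl(2,3)] by auto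
        moreover have "{a i<..<b i} \<inter> {a j<..<b j} = {}"
          using False I(1) ik jl by (auto simp: nonoverlapping_def)
        ultimately have "{a' i k<..<b' i k} \<inter> {a' j l<..<b' j l} = {}" by blast
        then show ?thesis unfolding ik(1) jl(1) prod.case .
      qed
    qed
    have "(\<Sum>(i, k)\<in>Sigma I (\<lambda>i. {..<n i}). b' i k - a' i k) = (\<Sum>i\<in>I. \<Sum>k<n i. b' i k - a' i k)"
      using \<open>finite I\<close> by (subst sum.Sigma) auto
    also have "\<dots> \<le> (\<Sum>i\<in>I. b i - a i)"
    proof (rule sum_mono)
      fix i assume "i \<in> I"
      then show "(\<Sum>k<n i. b' i k - a' i k) \<le> b i - a i"
        using c' I(1) by (intro sum_length_nonoverlapping_le) (auto simp: nonoverlapping_def)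
    qed
    also have "\<dots> < \<delta>" by fact
    finally have "(\<Sum>(i, k)\<in>Sigma I (\<lambda>i. {..<n i}). \<bar>f (b' i k) - f (a' i k)\<bar>) \<le> \<epsilon>"
      using \<delta>(2)[OF no] by (simp add: case_prod_beta)
    then have "(\<Sum>i\<in>I. \<Sum>k<n i. \<bar>f (b' i k) - f (a' i k)\<bar>) \<le> \<epsilon>"
      using \<open>finite I\<close> by (subst sum.Sigma) auto
    then have "(\<Sum>i\<in>I. \<Sum>k<n i. ennreal \<bar>f (b' i k) - f (a' i k)\<bar>) \<le> ennreal \<epsilon>"
      by (simp add: sum_nonneg ennreal_leI)
    then show "(\<Sum>i\<in>I. case c i of (n, a, b) \<Rightarrow> \<Sum>i<n. ennreal \<bar>f (b i) - f (a i)\<bar>) + 0 \<le> ennreal \<epsilon>"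
      by (simp add: n_def a'_def b'_def case_prod_beta)
  qed
  then have "(\<Sum>i\<in>I. variation f (a i) (b i)) \<le> ennreal \<epsilon>"
    if "nonoverlapping I a b" "(\<Sum>i\<in>I. b i - a i) < \<delta>" for I :: "nat set" and a b
    using that by simp
  then show thesis by (rule that[OF \<delta>(1)])
qed

lemma variation_finite:
  assumes "abs_continuous f" "x \<le> y"
  shows "variation f x y < \<infinity>"
proof -
  obtain \<delta> where \<delta>: "\<delta> > 0" "\<And>(I :: nat set) a b. nonoverlapping I a b \<Longrightarrow>
      (\<Sum>i\<in>I. b i - a i) < \<delta> \<Longrightarrow> (\<Sum>i\<in>I. variation f (a i) (b i)) \<le> ennreal 1"
    by (rule abs_continuous_sum_variation[OF assms(1) zero_less_one]) (rule that)
  have 1: "variation f s t \<le> 1" if "s \<le> t" "t - s < \<delta>" for s t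
    using \<delta>(2)[of "{0}" "\<lambda>_. s" "\<lambda>_. t"] that by (simp add: nonoverlapping_def)
  have 2: "variation f x (x + real k * (\<delta> / 2)) \<le> of_nat (Suc k)" for k
  proof (induction k)
    case 0
    then show ?case using 1[of x x] \<delta>(1) by simp
  next
    case (Suc k)
    have "variation f x (x + real (Suc k) * (\<delta> / 2)) \<le>
        variation f x (x + real k * (\<delta> / 2)) + variation f (x + real k * (\<delta> / 2)) (x + real (Suc k) * (\<delta> / 2))"
      using \<delta>(1) by (intro variation_triangle) (auto simp: field_simps)
    also have "\<dots> \<le> of_nat (Suc k) + 1"
      using \<delta>(1) by (intro add_mono Suc.IH 1) (auto simp: field_simps)
    finally show ?case by (simp add: ac_simps)
  qed
  obtain k where "(y - x) / (\<delta> / 2) < real k" using reals_Archimedean2 by blast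
  then have "y \<le> x + real k * (\<delta> / 2)" using \<delta>(1) by (simp add: field_simps)
  then have "variation f x y \<le> of_nat (Suc k)"
    using variation_mono[OF assms(2)] 2 order_trans by blast
  then show ?thesis
    by (simp add: of_nat_less_top le_less_trans del: of_nat_Suc)
qed

section \<open>Absolutely continuous functions are indefinite integrals\<close>

lemma abs_continuous_imp_continuous:
  assumes "abs_continuous f" shows "continuous_on UNIV f"
proof (rule continuous_onI)
  fix s e :: real assume "0 < e"
  obtain \<delta> where \<delta>: "\<delta> > 0" "\<And>(I :: nat set) a b. nonoverlapping I a b \<Longrightarrow>
      (\<Sum>i\<in>I. b i - a i) < \<delta> \<Longrightarrow> (\<Sum>i\<in>I. \<bar>f (b i) - f (a i)\<bar>) \<le> e"
    by (rule abs_continuousE[OF assms \<open>0 < e\<close>]) (rule that)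
  show "\<exists>d>0. \<forall>t\<in>UNIV. dist t s < d \<longrightarrow> dist (f t) (f s) \<le> e"
  proof (intro exI[of _ \<delta>] conjI ballI impI)
    fix t assume "dist t s < \<delta>"
    then show "dist (f t) (f s) \<le> e"
      using \<delta>(2)[of "{0}" "\<lambda>_. min s t" "\<lambda>_. max s t"]
      by (cases "s \<le> t") (auto simp: nonoverlapping_def dist_real_def)
  qed fact
qed

text \<open>A null set is contained in an open set of small length, hence is covered by countably many
nonoverlapping intervals of small total length. By absolute continuity the increments of \<open>F\<close> over finitely
many of them have a small sum, and these increments are the Stieltjes measures of the intervals.\<close>

lemma interval_measure_null:
  assumes mono: "mono F" and ac: "abs_continuous F" and N: "N \<in> null_sets lborel"
  shows "emeasure (interval_measure F) N = 0"
proof -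
  have mF: "\<And>x y. x \<le> y \<Longrightarrow> F x \<le> F y" using mono by (simp add: monoD)
  note cF = abs_continuous_imp_continuous[OF ac]
  let ?M = "interval_measure F"
  have [measurable]: "N \<in> sets borel" using N by (auto simp: null_sets_def)
  have "emeasure ?M (N \<inter> {- real (Suc m)..real (Suc m)}) \<le> ennreal \<epsilon>" (is "emeasure ?M ?S \<le> _")
    if "0 < \<epsilon>" for m \<epsilon>
  proof -
    obtain \<delta> where \<delta>: "\<delta> > 0" "\<And>(I :: real set set) a b. nonoverlapping I a b \<Longrightarrow>
        (\<Sum>i\<in>I. b i - a i) < \<delta> \<Longrightarrow> (\<Sum>i\<in>I. \<bar>F (b i) - F (a i)\<bar>) \<le> \<epsilon>"
      by (rule abs_continuousE[OF ac \<open>0 < \<epsilon>\<close>]) (rule that)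
    obtain U where U: "open U" "N \<subseteq> U" "emeasure lborel (U - N) < ennreal \<delta>"
      using outer_regular_lborel[of N \<delta>] \<delta>(1) by auto
    have "emeasure lborel U \<le> emeasure lborel (U - N) + emeasure lborel N"
      using U by (subst emeasure_Un_null_set[symmetric]) (auto simp: N intro!: emeasure_mono order_trans[OF _ emeasure_subadditive])
    then have lU: "emeasure lborel U < ennreal \<delta>" using U(3) N by (simp add: null_sets_def)
    obtain \<D> where D: "countable \<D>" "\<And>K. K \<in> \<D> \<Longrightarrow> interior K \<noteq> {} \<and> (\<exists>c d. K = cbox c d)"
      "pairwise (\<lambda>A B. interior A \<inter> interior B = {}) \<D>"
      "\<And>K. K \<in> \<D> \<Longrightarrow> \<exists>x \<in> ?S \<inter> K. K \<subseteq> (if x \<in> U then U else UNIV)" "?S \<subseteq> \<Union>\<D>"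
    proof (rule covering_lemma[of ?S "- real (Suc m)" "real (Suc m)" "\<lambda>x. if x \<in> U then U else UNIV"])
      show "gauge (\<lambda>x. if x \<in> U then U else UNIV)" using U(1) by (auto simp: gauge_def)
    qed (auto)
    have K: "K = {Inf K..Sup K} \<and> Inf K < Sup K \<and> K \<subseteq> U \<and> interior K = {Inf K<..<Sup K}" if "K \<in> \<D>" for K
    proof -
      have K: "interior K \<noteq> {}" "\<exists>c d. K = cbox c d" using D(2)[OF that] by auto
      then obtain c d where "K = cbox c d" by blast
      moreover have "K \<subseteq> U"
      proof -
        obtain z where "z \<in> N" "K \<subseteq> (if z \<in> U then U else UNIV)"
          using D(4)[OF \<open>K \<in> \<D>\<close>] by blast
        then show ?thesis using U(2) subsetD[OF U(2)] by simp
      qed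
      ultimately show ?thesis using K(1) by (auto simp: interior_atLeastAtMost_real)
    qed
    have fin: "(\<Sum>K\<in>\<K>. emeasure ?M K) \<le> ennreal \<epsilon>" if KD: "\<K> \<subseteq> \<D>" "finite \<K>" for \<K>
    proof -
      have KK: "K = {Inf K..Sup K}" "Inf K < Sup K" "K \<subseteq> U" "interior K = {Inf K<..<Sup K}"
        if "K \<in> \<K>" for K using K[of K] that KD by auto
      have no: "nonoverlapping \<K> Inf Sup"
        unfolding nonoverlapping_def
      proof (intro conjI ballI impI)
        fix A B assume "A \<in> \<K>" "B \<in> \<K>" "A \<noteq> B"
        then show "{Inf A<..<Sup A} \<inter> {Inf B<..<Sup B} = {}"
          using D(3) KD KK(4)[of A] KK(4)[of B] unfolding pairwise_def by blast
      qed (use KD KK(2) in \<open>auto intro: less_imp_le\<close>)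
      have "(\<Sum>K\<in>\<K>. Sup K - Inf K) = (\<Sum>K\<in>\<K>. measure lborel {Inf K<..<Sup K})"
        using KK(2) by (intro sum.cong) (auto simp: less_imp_le)
      also have "\<dots> = measure lborel (\<Union>K\<in>\<K>. {Inf K<..<Sup K})"
        using no KK(2)
        by (intro measure_finite_Union[symmetric])
          (auto simp: nonoverlapping_def disjoint_family_on_def emeasure_lborel_Ioo less_imp_le)
      also have "\<dots> \<le> measure lborel U"
      proof (rule measure_mono_fmeasurable)
        show "(\<Union>K\<in>\<K>. {Inf K<..<Sup K}) \<subseteq> U" using KK(3,4) interior_subset by blast
        show "(\<Union>K\<in>\<K>. {Inf K<..<Sup K}) \<in> sets lborel" using KD(2) by auto
        show "U \<in> fmeasurable lborel" using lU U(1) by (auto simp: fmeasurable_def intro: less_trans)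
      qed
      also have "\<dots> < \<delta>"
        using lU \<delta>(1) unfolding measure_def
        by (metis enn2real_less_iff ennreal_less_top less_trans order_less_imp_not_less ennreal_enn2real ennreal_less_iff enn2real_nonneg)
      finally have "(\<Sum>K\<in>\<K>. \<bar>F (Sup K) - F (Inf K)\<bar>) \<le> \<epsilon>" by (rule \<delta>(2)[OF no])
      moreover have "emeasure ?M K = ennreal \<bar>F (Sup K) - F (Inf K)\<bar>" if "K \<in> \<K>" for K
        using emeasure_interval_measure_Icc[of "Inf K" "Sup K" F, OF _ mF cF] KK(1,2)[OF that] mF[of "Inf K" "Sup K"]
        by simp
      ultimately show ?thesis by (simp add: ennreal_leI)
    qed
    have sets\<D>: "K \<in> sets ?M" if "K \<in> \<D>" for K
      using K[OF that] by (metis atLeastAtMost_borel sets_interval_measure)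
    have "emeasure ?M (\<Union>\<D>) \<le> ennreal \<epsilon>"
    proof (cases "\<D> = {}")
      case False
      define A where "A n = (\<Union>i\<le>n. from_nat_into \<D> i)" for n
      have in\<D>: "from_nat_into \<D> i \<in> \<D>" for i using False by (rule from_nat_into)
      have "emeasure ?M (\<Union>n. A n) = (SUP n. emeasure ?M (A n))"
        using in\<D> sets\<D>
        by (intro SUP_emeasure_incseq[symmetric]) (auto simp: A_def incseq_def intro: order_trans)
      also have "\<dots> \<le> ennreal \<epsilon>"
      proof (rule SUP_least)
        fix n
        have An: "A n = (\<Union>K\<in>from_nat_into \<D> ` {..n}. K)" by (auto simp: A_def)
        have "emeasure ?M (A n) \<le> (\<Sum>K\<in>from_nat_into \<D> ` {..n}. emeasure ?M K)"
          unfolding An by (rule emeasure_subadditive_finite) (use in\<D> sets\<D> in auto)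
        also have "\<dots> \<le> ennreal \<epsilon>" using in\<D> by (intro fin) auto
        finally show "emeasure ?M (A n) \<le> ennreal \<epsilon>" .
      qed
      also have "(\<Union>n. A n) = \<Union>\<D>"
      proof -
        have "(\<Union>n. A n) = \<Union>(range (from_nat_into \<D>))" unfolding A_def by blast
        then show ?thesis using range_from_nat_into[OF False D(1)] by simp
      qed
      finally show ?thesis .
    qed simp
    moreover have "emeasure ?M ?S \<le> emeasure ?M (\<Union>\<D>)"
      using D(5) sets\<D> D(1) by (intro emeasure_mono sets.countable_Union) auto
    ultimately show ?thesis by order
  qed
  then have "emeasure ?M (N \<inter> {- real (Suc m)..real (Suc m)}) = 0" for m
    by (metis ennreal_le_epsilon add_0 le_zero_eq)
  then have "(\<Union>m. N \<inter> {- real (Suc m)..real (Suc m)}) \<in> null_sets ?M"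
    by (intro null_sets_UN) (auto simp: null_sets_def)
  moreover have "(\<Union>m. N \<inter> {- real (Suc m)..real (Suc m)}) = N"
  proof -
    have "\<exists>m. x \<in> {- real (Suc m)..real (Suc m)}" for x
    proof -
      obtain m where "\<bar>x\<bar> < real m" using reals_Archimedean2 by blast
      then show ?thesis by (intro exI[of _ m]) auto
    qed
    then show ?thesis by blast
  qed
  ultimately show ?thesis by auto
qed

lemma mono_abs_continuous_density:
  assumes mono: "mono F" and ac: "abs_continuous F"
  shows "\<exists>h. (\<forall>x y. x \<le> y \<longrightarrow> set_integrable lborel {x..y} h \<and> (LINT u:{x..y}|lborel. h u) = F y - F x)"
proof -
  have mF: "\<And>x y. x \<le> y \<Longrightarrow> F x \<le> F y" using mono by (simp add: monoD)
  note cF = abs_continuous_imp_continuous[OF ac]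
  have "absolutely_continuous lborel (interval_measure F)"
    unfolding absolutely_continuous_def
    using interval_measure_null[OF mono ac] by (auto simp: null_sets_def)
  then obtain k where k: "k \<in> borel_measurable lborel" "density lborel k = interval_measure F"
    using sigma_finite_measure.Radon_Nikodym[OF sigma_finite_lborel] by (metis sets_interval_measure sets_lborel)
  have [measurable]: "k \<in> borel_measurable borel" using k by simp
  have int: "(\<integral>\<^sup>+u. k u * indicator {x..y} u \<partial>lborel) = ennreal (F y - F x)" if "x \<le> y" for x y
  proof -
    have "emeasure (interval_measure F) {x..y} = ennreal (F y - F x)"
      by (rule emeasure_interval_measure_Icc[OF that _ cF]) (rule mF)
    then show ?thesis unfolding k(2)[symmetric] by (subst (asm) emeasure_density) auto
  qed
  have AEfin: "AE u in lborel. k u * indicator {x..y} u \<noteq> \<infinity>" if "x \<le> y" for x y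
    using int[OF that] by (intro nn_integral_noteq_infinite) auto
  show ?thesis
  proof (intro exI[of _ "\<lambda>u. enn2real (k u)"] allI impI)
    fix x y :: real assume "x \<le> y"
    have "(\<integral>\<^sup>+u. ennreal (indicator {x..y} u *\<^sub>R enn2real (k u)) \<partial>lborel) = (\<integral>\<^sup>+u. k u * indicator {x..y} u \<partial>lborel)"
      by (intro nn_integral_cong_AE)
        (use AEfin[OF \<open>x \<le> y\<close>] in \<open>eventually_elim, auto split: split_indicator simp: less_top\<close>)
    then have "has_bochner_integral lborel (\<lambda>u. indicator {x..y} u *\<^sub>R enn2real (k u)) (F y - F x)"
      using int[OF \<open>x \<le> y\<close>] mF[OF \<open>x \<le> y\<close>]
      by (intro has_bochner_integral_nn_integral) (auto split: split_indicator)
    then show "set_integrable lborel {x..y} (\<lambda>u. enn2real (k u)) \<and> (LINT u:{x..y}|lborel. enn2real (k u)) = F y - F x"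
      unfolding set_integrable_def set_lebesgue_integral_def
      using has_bochner_integral_iff by blast
  qed
qed

text \<open>The Jordan decomposition \<open>f = V - (V - f)\<close> into increasing functions, where \<open>V\<close> is the variation of \<open>f\<close> on
\<open>[0,t]\<close>. It vanishes for negative \<open>t\<close>, where \<open>V - f\<close> is monotone because \<open>f\<close> is constant.\<close>

lemma abs_continuous_density:
  assumes ac: "abs_continuous f" and const: "\<And>t. t \<le> 0 \<Longrightarrow> f t = f 0"
  shows "\<exists>h. (\<forall>x y. x \<le> y \<longrightarrow> set_integrable lborel {x..y} h \<and> (LINT u:{x..y}|lborel. h u) = f y - f x)"
proof -
  define V where "V t = enn2real (variation f 0 (max 0 t))" for t
  have ennV: "ennreal (V t) = variation f 0 (max 0 t)" for t
    using variation_finite[OF ac, of 0 "max 0 t"] by (simp add: V_def)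
  have V0: "0 \<le> V t" for t by (simp add: V_def)
  have inc: "\<bar>f t - f s\<bar> \<le> V t - V s" if "s \<le> t" for s t
  proof -
    have "f (max 0 r) = f r" for r using const[of r] by (auto simp: max_def)
    moreover have "ennreal (V s) + ennreal \<bar>f (max 0 t) - f (max 0 s)\<bar> \<le> ennreal (V t)"
      unfolding ennV using that by (intro variation_add_increment) auto
    ultimately show ?thesis using V0 by (simp flip: ennreal_plus)
  qed
  have le: "ennreal (V t - V s) \<le> variation f (max 0 s) (max 0 t)" if "s \<le> t" for s t
  proof -
    have "ennreal (V t) \<le> ennreal (V s) + variation f (max 0 s) (max 0 t)"
      unfolding ennV using that by (intro variation_triangle) auto
    then show ?thesis using V0 by (simp add: ennreal_minus_le_iff flip: ennreal_minus)
  qed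
  have "abs_continuous V"
    unfolding abs_continuous_def
  proof (intro allI impI)
    fix \<epsilon> :: real assume "0 < \<epsilon>"
    obtain \<delta> where \<delta>: "\<delta> > 0" "\<And>(I :: nat set) a b. nonoverlapping I a b \<Longrightarrow>
        (\<Sum>i\<in>I. b i - a i) < \<delta> \<Longrightarrow> (\<Sum>i\<in>I. variation f (a i) (b i)) \<le> ennreal \<epsilon>"
      by (rule abs_continuous_sum_variation[OF ac \<open>0 < \<epsilon>\<close>]) (rule that)
    show "\<exists>\<delta>>0. \<forall>(I :: nat set) a b. nonoverlapping I a b \<and> (\<Sum>i\<in>I. b i - a i) < \<delta> \<longrightarrow>
        (\<Sum>i\<in>I. \<bar>V (b i) - V (a i)\<bar>) \<le> \<epsilon>"
    proof (intro exI[of _ \<delta>] conjI allI impI \<delta>(1), elim conjE)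
      fix I :: "nat set" and a b assume I: "nonoverlapping I a b" "(\<Sum>i\<in>I. b i - a i) < \<delta>"
      have ab: "a i \<le> b i" if "i \<in> I" for i using I(1) that by (simp add: nonoverlapping_def)
      have "(\<Sum>i\<in>I. max (b i) 0 - max (a i) 0) \<le> (\<Sum>i\<in>I. b i - a i)"
        using ab by (intro sum_mono) fastforce
      then have "(\<Sum>i\<in>I. variation f (max (a i) 0) (max (b i) 0)) \<le> ennreal \<epsilon>"
        using I(2) by (intro \<delta>(2) nonoverlapping_max I(1)) auto
      moreover have "ennreal (\<Sum>i\<in>I. \<bar>V (b i) - V (a i)\<bar>) \<le> (\<Sum>i\<in>I. variation f (max (a i) 0) (max (b i) 0))"
        unfolding sum_ennreal[symmetric, OF abs_ge_zero]
      proof (rule sum_mono)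
        fix i assume "i \<in> I"
        then show "ennreal \<bar>V (b i) - V (a i)\<bar> \<le> variation f (max (a i) 0) (max (b i) 0)"
          using le[OF ab] inc[OF ab] by (simp add: max.commute) (metis abs_ge_zero abs_of_nonneg order_trans)
      qed
      ultimately have "ennreal (\<Sum>i\<in>I. \<bar>V (b i) - V (a i)\<bar>) \<le> ennreal \<epsilon>" by order
      then show "(\<Sum>i\<in>I. \<bar>V (b i) - V (a i)\<bar>) \<le> \<epsilon>" using \<open>0 < \<epsilon>\<close> by (simp add: ennreal_le_iff)
    qed
  qed
  moreover have "abs_continuous (\<lambda>t. V t - f t)"
    unfolding abs_continuous_def
  proof (intro allI impI)
    fix \<epsilon> :: real assume "0 < \<epsilon>"
    then have "0 < \<epsilon> / 2" by simp
    obtain \<delta> where \<delta>: "\<delta> > 0" "\<And>(I :: nat set) a b. nonoverlapping I a b \<Longrightarrow>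
        (\<Sum>i\<in>I. b i - a i) < \<delta> \<Longrightarrow> (\<Sum>i\<in>I. \<bar>V (b i) - V (a i)\<bar>) \<le> \<epsilon> / 2"
      by (rule abs_continuousE[OF \<open>abs_continuous V\<close> \<open>0 < \<epsilon> / 2\<close>]) (rule that)
    show "\<exists>\<delta>>0. \<forall>(I :: nat set) a b. nonoverlapping I a b \<and> (\<Sum>i\<in>I. b i - a i) < \<delta> \<longrightarrow>
        (\<Sum>i\<in>I. \<bar>(V (b i) - f (b i)) - (V (a i) - f (a i))\<bar>) \<le> \<epsilon>"
    proof (intro exI[of _ \<delta>] conjI allI impI \<delta>(1), elim conjE)
      fix I :: "nat set" and a b assume I: "nonoverlapping I a b" "(\<Sum>i\<in>I. b i - a i) < \<delta>"
      have "(\<Sum>i\<in>I. \<bar>(V (b i) - f (b i)) - (V (a i) - f (a i))\<bar>) \<le> (\<Sum>i\<in>I. 2 * \<bar>V (b i) - V (a i)\<bar>)"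
      proof (rule sum_mono)
        fix i assume "i \<in> I"
        then have "\<bar>f (b i) - f (a i)\<bar> \<le> V (b i) - V (a i)"
          using I(1) by (intro inc) (simp add: nonoverlapping_def)
        then show "\<bar>(V (b i) - f (b i)) - (V (a i) - f (a i))\<bar> \<le> 2 * \<bar>V (b i) - V (a i)\<bar>"
          by (simp add: abs_le_iff)
      qed
      also have "\<dots> \<le> \<epsilon>" using \<delta>(2)[OF I] by (simp flip: sum_distrib_left)
      finally show "(\<Sum>i\<in>I. \<bar>(V (b i) - f (b i)) - (V (a i) - f (a i))\<bar>) \<le> \<epsilon>" .
    qed
  qed
  moreover have "mono V" "mono (\<lambda>t. V t - f t)"
    using inc by (fastforce intro!: monoI)+
  ultimately have "\<exists>h1 h2. (\<forall>x y. x \<le> y \<longrightarrow> set_integrable lborel {x..y} h1 \<and> (LINT u:{x..y}|lborel. h1 u) = V y - V x) \<and>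
    (\<forall>x y. x \<le> y \<longrightarrow> set_integrable lborel {x..y} h2 \<and> (LINT u:{x..y}|lborel. h2 u) = (V y - f y) - (V x - f x))"
    using mono_abs_continuous_density[of V] mono_abs_continuous_density[of "\<lambda>t. V t - f t"] by blast
  then obtain h1 h2 where
    h1: "\<And>x y. x \<le> y \<Longrightarrow> set_integrable lborel {x..y} h1" "\<And>x y. x \<le> y \<Longrightarrow> (LINT u:{x..y}|lborel. h1 u) = V y - V x" and
    h2: "\<And>x y. x \<le> y \<Longrightarrow> set_integrable lborel {x..y} h2"
      "\<And>x y. x \<le> y \<Longrightarrow> (LINT u:{x..y}|lborel. h2 u) = (V y - f y) - (V x - f x)"
    by blast
  then show ?thesis
    by (intro exI[of _ "\<lambda>u. h1 u - h2 u"]) (simp add: set_integral_diff)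
qed

lemma abs_continuous_component:
  fixes \<omega> :: "real \<Rightarrow> real^'n"
  assumes T: "0 < T" and ac: "abs_continuous_path T \<omega>"
  shows "abs_continuous (\<lambda>t. \<omega> (max 0 (min T t)) $ i)"
  unfolding abs_continuous_def
proof (intro allI impI)
  fix \<epsilon> :: real assume "0 < \<epsilon>"
  then have "\<exists>\<delta>>0. \<forall>(n::nat) a b.
        (\<forall>i<n. 0 \<le> a i \<and> a i \<le> b i \<and> b i \<le> T) \<and>
        (\<forall>i<n. \<forall>j<n. i \<noteq> j \<longrightarrow> {a i<..<b i} \<inter> {a j<..<b j} = {}) \<and>
        (\<Sum>i<n. b i - a i) < \<delta> \<longrightarrow> (\<Sum>i<n. norm (\<omega> (b i) - \<omega> (a i))) < \<epsilon>"
    using ac unfolding abs_continuous_path_def by blast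
  then obtain \<delta> where \<delta>: "\<delta> > 0" "\<forall>(n::nat) a b.
        (\<forall>i<n. 0 \<le> a i \<and> a i \<le> b i \<and> b i \<le> T) \<and>
        (\<forall>i<n. \<forall>j<n. i \<noteq> j \<longrightarrow> {a i<..<b i} \<inter> {a j<..<b j} = {}) \<and>
        (\<Sum>i<n. b i - a i) < \<delta> \<longrightarrow> (\<Sum>i<n. norm (\<omega> (b i) - \<omega> (a i))) < \<epsilon>"
    by (elim exE conjE)
  define c where "c t = max 0 (min T t)" for t :: real
  show "\<exists>\<delta>>0. \<forall>(I :: nat set) a b. nonoverlapping I a b \<and> (\<Sum>i\<in>I. b i - a i) < \<delta> \<longrightarrow>
     (\<Sum>j\<in>I. \<bar>\<omega> (max 0 (min T (b j))) $ i - \<omega> (max 0 (min T (a j))) $ i\<bar>) \<le> \<epsilon>"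
    unfolding c_def[symmetric]
  proof (intro exI[of _ \<delta>] conjI allI impI \<delta>(1), elim conjE)
    fix I :: "nat set" and a b assume I: "nonoverlapping I a b" "(\<Sum>i\<in>I. b i - a i) < \<delta>"
    obtain g where g: "bij_betw g {0..<card I} I"
      using I(1) ex_bij_betw_nat_finite[of I] by (auto simp: nonoverlapping_def)
    define n where "n = card I"
    have g': "bij_betw g {..<n} I" using g by (simp add: n_def atLeast0LessThan)
    have ab: "a (g j) \<le> b (g j)" if "j < n" for j
      using I(1) g' that by (auto simp: nonoverlapping_def bij_betw_def)
    have no: "nonoverlapping {..<n} (\<lambda>j. c (a (g j))) (\<lambda>j. c (b (g j)))"
    proof (rule nonoverlapping_subintervals[OF nonoverlapping_reindex[OF I(1) g']])
      show "{c (a (g j))<..<c (b (g j))} \<subseteq> {(a \<circ> g) j<..<(b \<circ> g) j}" for j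
        using T by (auto simp: c_def)
      show "j \<in> {..<n} \<Longrightarrow> c (a (g j)) \<le> c (b (g j))" for j
        using ab[of j] by (auto simp: c_def intro!: max.mono min.mono)
    qed
    have "(\<Sum>j<n. c (b (g j)) - c (a (g j))) \<le> (\<Sum>j<n. b (g j) - a (g j))"
    proof (rule sum_mono)
      fix j assume "j \<in> {..<n}"
      then show "c (b (g j)) - c (a (g j)) \<le> b (g j) - a (g j)"
        using ab[of j] T by (auto simp: c_def max_def min_def)
    qed
    also have "\<dots> < \<delta>" using I(2) sum.reindex_bij_betw[OF g', of "\<lambda>i. b i - a i"] by simp
    finally have "(\<Sum>j<n. norm (\<omega> (c (b (g j))) - \<omega> (c (a (g j))))) < \<epsilon>"
      using no T by (intro \<delta>(2)[rule_format]) (auto simp: nonoverlapping_def c_def)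
    moreover have "(\<Sum>j\<in>I. \<bar>\<omega> (c (b j)) $ i - \<omega> (c (a j)) $ i\<bar>) = (\<Sum>j<n. \<bar>\<omega> (c (b (g j))) $ i - \<omega> (c (a (g j))) $ i\<bar>)"
      using sum.reindex_bij_betw[OF g', of "\<lambda>j. \<bar>\<omega> (c (b j)) $ i - \<omega> (c (a j)) $ i\<bar>"] by simp
    moreover have "\<dots> \<le> (\<Sum>j<n. norm (\<omega> (c (b (g j))) - \<omega> (c (a (g j)))))"
      using component_le_norm_cart[of "\<omega> (c (b (g j))) - \<omega> (c (a (g j)))" i for j]
      by (intro sum_mono) simp
    ultimately show "(\<Sum>j\<in>I. \<bar>\<omega> (c (b j)) $ i - \<omega> (c (a j)) $ i\<bar>) \<le> \<epsilon>" by linarith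
  qed
qed

lemma set_integral_vec_nth:
  fixes h :: "'a \<Rightarrow> real^'n"
  assumes "set_integrable M A h"
  shows "(LINT u:A|M. h u) $ i = (LINT u:A|M. h u $ i)"
  using integral_bounded_linear[OF bounded_linear_vec_nth[of i] assms[unfolded set_integrable_def]]
  unfolding set_lebesgue_integral_def by simp

text \<open>Componentwise, with the error shared equally among the components.\<close>

theorem AE_Lebesgue_point_vec:
  fixes h :: "real \<Rightarrow> real^'n"
  assumes h: "integrable lborel h"
  shows "AE t in lborel. \<forall>\<epsilon>>0. \<exists>d>0. \<forall>a b. a \<le> t \<and> t \<le> b \<and> b - a < d \<longrightarrow>
           norm ((LINT u:{a..b}|lborel. h u) - (b - a) *\<^sub>R h t) \<le> \<epsilon> * (b - a)"
proof -
  have hi: "integrable lborel (\<lambda>u. h u $ i)" for i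
    using integrable_bounded_linear[OF bounded_linear_vec_nth h] .
  have hs: "set_integrable lborel {a..b} h" for a b
    unfolding set_integrable_def by (intro integrable_mult_indicator h) auto
  have "AE t in lborel. \<forall>i. \<forall>\<epsilon>>0. \<exists>d>0. \<forall>a b. a \<le> t \<and> t \<le> b \<and> b - a < d \<longrightarrow>
           \<bar>(LINT u:{a..b}|lborel. h u $ i) - h t $ i * (b - a)\<bar> \<le> \<epsilon> * (b - a)"
    using AE_Lebesgue_point[OF hi] by (simp add: AE_all_countable)
  then show ?thesis
  proof eventually_elim
    case (elim t)
    show ?case
    proof (intro allI impI)
      fix \<epsilon> :: real assume "0 < \<epsilon>"
      define \<epsilon>' where "\<epsilon>' = \<epsilon> / real CARD('n)"
      have "0 < \<epsilon>'" using \<open>0 < \<epsilon>\<close> by (simp add: \<epsilon>'_def)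
      then have "\<forall>i. \<exists>d>0. \<forall>a b. a \<le> t \<and> t \<le> b \<and> b - a < d \<longrightarrow>
           \<bar>(LINT u:{a..b}|lborel. h u $ i) - h t $ i * (b - a)\<bar> \<le> \<epsilon>' * (b - a)"
        using elim by blast
      then obtain d where d: "\<And>i. 0 < d i" "\<And>i a b. a \<le> t \<and> t \<le> b \<and> b - a < d i \<Longrightarrow>
           \<bar>(LINT u:{a..b}|lborel. h u $ i) - h t $ i * (b - a)\<bar> \<le> \<epsilon>' * (b - a)" by metis
      show "\<exists>d>0. \<forall>a b. a \<le> t \<and> t \<le> b \<and> b - a < d \<longrightarrow>
           norm ((LINT u:{a..b}|lborel. h u) - (b - a) *\<^sub>R h t) \<le> \<epsilon> * (b - a)"
      proof (intro exI[of _ "Min (range d)"] conjI allI impI)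
        show "0 < Min (range d)" using d(1) by simp
        fix a b assume ab: "a \<le> t \<and> t \<le> b \<and> b - a < Min (range d)"
        have "norm ((LINT u:{a..b}|lborel. h u) - (b - a) *\<^sub>R h t) \<le>
            (\<Sum>i\<in>UNIV. \<bar>((LINT u:{a..b}|lborel. h u) - (b - a) *\<^sub>R h t) $ i\<bar>)" by (rule norm_le_l1_cart)
        also have "\<dots> \<le> (\<Sum>i\<in>(UNIV :: 'n set). \<epsilon>' * (b - a))"
        proof (rule sum_mono)
          fix i
          have "b - a < d i" using ab by simp
          then show "\<bar>((LINT u:{a..b}|lborel. h u) - (b - a) *\<^sub>R h t) $ i\<bar> \<le> \<epsilon>' * (b - a)"
            using d(2)[of a b i] ab by (simp add: set_integral_vec_nth[OF hs] mult.commute)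
        qed
        also have "\<dots> = \<epsilon> * (b - a)" by (simp add: \<epsilon>'_def)
        finally show "norm ((LINT u:{a..b}|lborel. h u) - (b - a) *\<^sub>R h t) \<le> \<epsilon> * (b - a)" .
      qed
    qed
  qed
qed

theorem abs_continuous_path_fundamental:
  fixes \<omega> :: "real \<Rightarrow> real^'n"
  assumes T: "0 < T" and ac: "abs_continuous_path T \<omega>"
  obtains h where "integrable lborel h"
    and "\<And>x y. 0 \<le> x \<Longrightarrow> x \<le> y \<Longrightarrow> y \<le> T \<Longrightarrow> (LINT u:{x..y}|lborel. h u) = \<omega> y - \<omega> x"
    and "AE t in lborel. 0 < t \<and> t < T \<longrightarrow> (\<omega> has_vector_derivative h t) (at t)"
proof -
  have "\<exists>k. \<forall>x y. x \<le> y \<longrightarrow> set_integrable lborel {x..y} k \<and>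
      (LINT u:{x..y}|lborel. k u) = \<omega> (max 0 (min T y)) $ i - \<omega> (max 0 (min T x)) $ i" for i
    by (rule abs_continuous_density[OF abs_continuous_component[OF T ac]]) (use T in \<open>auto simp: max_def min_def\<close>)
  then obtain k where k: "\<And>i x y. x \<le> y \<Longrightarrow> set_integrable lborel {x..y} (k i)"
      "\<And>i x y. x \<le> y \<Longrightarrow> (LINT u:{x..y}|lborel. k i u) = \<omega> (max 0 (min T y)) $ i - \<omega> (max 0 (min T x)) $ i"
    by metis
  define h where "h u = (\<Sum>i\<in>UNIV. (indicator {0..T} u *\<^sub>R k i u) *\<^sub>R (axis i 1 :: real^'n))" for u
  have h_nth: "h u $ i = indicator {0..T} u * k i u" for u i
    by (simp add: h_def axis_def if_distrib cong: if_cong)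
  have ih: "integrable lborel h"
    unfolding h_def
    by (intro Bochner_Integration.integrable_sum integrable_scaleR_left)
      (use k(1)[of 0 T] T in \<open>simp add: set_integrable_def\<close>)
  have hs: "set_integrable lborel {a..b} h" for a b
    unfolding set_integrable_def by (intro integrable_mult_indicator ih) auto
  have int: "(LINT u:{x..y}|lborel. h u) = \<omega> y - \<omega> x" if "0 \<le> x" "x \<le> y" "y \<le> T" for x y
  proof -
    have "(LINT u:{x..y}|lborel. h u) $ i = (\<omega> y - \<omega> x) $ i" for i
    proof -
      have "(LINT u:{x..y}|lborel. h u) $ i = (LINT u:{x..y}|lborel. h u $ i)"
        by (rule set_integral_vec_nth[OF hs])
      also have "\<dots> = (LINT u:{x..y}|lborel. k i u)"
        unfolding set_lebesgue_integral_def h_nth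
        using that by (intro Bochner_Integration.integral_cong) (auto split: split_indicator)
      also have "\<dots> = (\<omega> y - \<omega> x) $ i" using that k(2)[of x y i] by simp
      finally show ?thesis .
    qed
    then show ?thesis by (simp add: vec_eq_iff)
  qed
  have "AE t in lborel. 0 < t \<and> t < T \<longrightarrow> (\<omega> has_vector_derivative h t) (at t)"
    using AE_Lebesgue_point_vec[OF ih]
  proof eventually_elim
    case (elim t)
    show ?case
      unfolding has_vector_derivative_def has_derivative_at_alt
    proof (intro impI conjI allI)
      show "bounded_linear (\<lambda>x. x *\<^sub>R h t)" by (rule bounded_linear_scaleR_left)
      fix e :: real assume t: "0 < t \<and> t < T" and "0 < e"
      obtain d where d: "d > 0" "\<And>a b. a \<le> t \<and> t \<le> b \<and> b - a < d \<Longrightarrow>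
           norm ((LINT u:{a..b}|lborel. h u) - (b - a) *\<^sub>R h t) \<le> e * (b - a)"
        using elim \<open>0 < e\<close> by blast
      show "\<exists>d>0. \<forall>y. norm (y - t) < d \<longrightarrow> norm (\<omega> y - \<omega> t - (y - t) *\<^sub>R h t) \<le> e * norm (y - t)"
      proof (intro exI[of _ "min d (min t (T - t))"] conjI allI impI)
        show "0 < min d (min t (T - t))" using d t by simp
        fix y assume y: "norm (y - t) < min d (min t (T - t))"
        show "norm (\<omega> y - \<omega> t - (y - t) *\<^sub>R h t) \<le> e * norm (y - t)"
        proof (cases "t \<le> y")
          case True
          then show ?thesis using d(2)[of t y] int[of t y] t y by auto
        next
          case False
          have "norm (\<omega> y - \<omega> t - (y - t) *\<^sub>R h t) = norm ((\<omega> t - \<omega> y) - (t - y) *\<^sub>R h t)"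
            by (subst norm_minus_cancel[symmetric]) (simp add: algebra_simps)
          then show ?thesis using d(2)[of y t] int[of y t] t y False by auto
        qed
      qed
    qed
  qed
  with ih int show thesis by (rule that)
qed

section \<open>The Borel structure of the path space\<close>

text \<open>Freezing time outside \<open>[0,T]\<close>: elements of the path space are undefined there, while the difference
quotients of a path ask for values beyond \<open>T\<close>.\<close>

definition clip :: "real \<Rightarrow> real \<Rightarrow> real" where
  "clip T t = max 0 (min T t)"

lemma topspace_path_topology:
  "topspace (path_topology T) =
     {\<omega> :: real \<Rightarrow> real^'n. \<omega> \<in> extensional {0..T} \<and> \<omega> \<in> {0..T} \<rightarrow> unit_cube \<and> continuous_on {0..T} \<omega>}"
proof -
  have "bounded (unit_cube :: (real^'n) set)" unfolding unit_cube_def by (rule bounded_cbox)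
  then obtain B where B: "\<And>x. x \<in> (unit_cube :: (real^'n) set) \<Longrightarrow> dist 0 x \<le> B"
    unfolding bounded_any_center[of _ 0] by blast
  have 0: "(0 :: real^'n) \<in> unit_cube" by (simp add: unit_cube_def mem_box_cart)
  have "Metric_space.mbounded unit_cube dist (\<omega> ` {0..T})" if "\<omega> \<in> {0..T} \<rightarrow> unit_cube" for \<omega> :: "real \<Rightarrow> real^'n"
  proof -
    interpret Metric_space "unit_cube :: (real^'n) set" dist
      by (rule Met_TC.subspace) simp
    have "\<omega> t \<in> mcball 0 B" if "t \<in> {0..T}" for t
      using B[of "\<omega> t"] 0 that \<open>\<omega> \<in> {0..T} \<rightarrow> unit_cube\<close> by (simp add: Pi_iff)
    then show ?thesis unfolding mbounded_def by blast
  qed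
  then show ?thesis
    by (auto simp: path_topology_def path_metric_def mtopology_of_submetric continuous_map_in_subtopology)
qed

text \<open>The uniform distance, with non-strict inequalities so that it can be tested on a dense set of times.\<close>

lemma openin_path_topology:
  assumes "0 \<le> T"
  shows "openin (path_topology T) U \<longleftrightarrow> U \<subseteq> topspace (path_topology T) \<and>
    (\<forall>\<omega>\<in>U. \<exists>e>0. \<forall>\<omega>'\<in>topspace (path_topology T). (\<forall>t\<in>{0..T}. dist (\<omega> t) (\<omega>' t) \<le> e) \<longrightarrow> \<omega>' \<in> U)"
proof -
  let ?m = "path_metric T :: (real \<Rightarrow> real^'n) metric"
  have top: "topspace (path_topology T) = mspace ?m" by (simp add: path_topology_def)
  have le: "mdist ?m f g \<le> a \<longleftrightarrow> (\<forall>t\<in>{0..T}. dist (f t) (g t) \<le> a)"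
    if "f \<in> mspace ?m" "g \<in> mspace ?m" for f g a
    using cfunspace_mdist_le[OF that[unfolded path_metric_def], of a] assms by (simp add: path_metric_def)
  interpret Metric_space "mspace ?m" "mdist ?m" by (rule Metric_space_mspace_mdist)
  have op: "openin (path_topology T) U \<longleftrightarrow> U \<subseteq> mspace ?m \<and> (\<forall>\<omega>\<in>U. \<exists>r>0. mball \<omega> r \<subseteq> U)"
    unfolding path_topology_def mtopology_of_def openin_mtopology by blast
  have "(\<exists>r>0. mball \<omega> r \<subseteq> U) \<longleftrightarrow>
     (\<exists>e>0. \<forall>\<omega>'\<in>mspace ?m. (\<forall>t\<in>{0..T}. dist (\<omega> t) (\<omega>' t) \<le> e) \<longrightarrow> \<omega>' \<in> U)"
    if "\<omega> \<in> mspace ?m" for \<omega>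
  proof
    assume "\<exists>r>0. mball \<omega> r \<subseteq> U"
    then obtain r where r: "r > 0" "mball \<omega> r \<subseteq> U" by blast
    show "\<exists>e>0. \<forall>\<omega>'\<in>mspace ?m. (\<forall>t\<in>{0..T}. dist (\<omega> t) (\<omega>' t) \<le> e) \<longrightarrow> \<omega>' \<in> U"
    proof (intro exI[of _ "r/2"] conjI ballI impI)
      fix \<omega>' assume "\<omega>' \<in> mspace ?m" "\<forall>t\<in>{0..T}. dist (\<omega> t) (\<omega>' t) \<le> r / 2"
      then have "mdist ?m \<omega> \<omega>' \<le> r / 2" using le that by blast
      then have "\<omega>' \<in> mball \<omega> r" using r(1) that \<open>\<omega>' \<in> mspace ?m\<close> by simp
      then show "\<omega>' \<in> U" using r(2) by blast
    qed (use r in simp)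
  next
    assume "\<exists>e>0. \<forall>\<omega>'\<in>mspace ?m. (\<forall>t\<in>{0..T}. dist (\<omega> t) (\<omega>' t) \<le> e) \<longrightarrow> \<omega>' \<in> U"
    then obtain e where e: "e > 0" "\<forall>\<omega>'\<in>mspace ?m. (\<forall>t\<in>{0..T}. dist (\<omega> t) (\<omega>' t) \<le> e) \<longrightarrow> \<omega>' \<in> U"
      by blast
    have "\<omega>' \<in> U" if "\<omega>' \<in> mball \<omega> e" for \<omega>'
    proof -
      have "\<omega>' \<in> mspace ?m" "mdist ?m \<omega> \<omega>' \<le> e" using that by auto
      then show ?thesis using e(2) le[OF \<open>\<omega> \<in> mspace ?m\<close>] by blast
    qed
    then show "\<exists>r>0. mball \<omega> r \<subseteq> U" using e(1) by blast
  qed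
  then show ?thesis unfolding op top by blast
qed

lemma space_path_borel: "space (path_borel T) = topspace (path_topology T)"
  by (simp add: path_borel_def space_measure_of_conv)

lemma sets_path_borel:
  "sets (path_borel T) = sigma_sets (topspace (path_topology T)) {U. openin (path_topology T) U}"
  unfolding path_borel_def by (rule sets_measure_of) (auto dest: openin_subset)

lemma eval_measurable:
  assumes t: "t \<in> {0..T}"
  shows "(\<lambda>\<omega> :: real \<Rightarrow> real^'n. \<omega> t) \<in> borel_measurable (path_borel T)"
proof (rule borel_measurableI)
  fix V :: "(real^'n) set" assume "open V"
  let ?U = "(\<lambda>\<omega>. \<omega> t) -` V \<inter> space (path_borel T)"
  have "openin (path_topology T) ?U"
  proof (subst openin_path_topology, use t in simp, intro conjI ballI)
    fix \<omega> assume "\<omega> \<in> ?U"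
    then obtain e where e: "e > 0" "cball (\<omega> t) e \<subseteq> V"
      using \<open>open V\<close> open_contains_cball by blast
    show "\<exists>e>0. \<forall>\<omega>'\<in>topspace (path_topology T).
            (\<forall>t\<in>{0..T}. dist (\<omega> t) (\<omega>' t) \<le> e) \<longrightarrow> \<omega>' \<in> ?U"
    proof (intro exI[of _ e] conjI ballI impI e(1))
      fix \<omega>' assume "\<omega>' \<in> topspace (path_topology T)" "\<forall>t\<in>{0..T}. dist (\<omega> t) (\<omega>' t) \<le> e"
      then have "\<omega>' t \<in> cball (\<omega> t) e" using t by simp
      then show "\<omega>' \<in> ?U" using e(2) \<open>\<omega>' \<in> topspace _\<close> by (auto simp: space_path_borel)
    qed
  qed (auto simp: space_path_borel)
  then show "?U \<in> sets (path_borel T)" unfolding sets_path_borel by blast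
qed

lemma dense_dist_le:
  fixes f g :: "real \<Rightarrow> 'a::metric_space"
  assumes "continuous_on X f" "continuous_on X g" "S \<subseteq> X" "X \<subseteq> closure S"
    and "\<And>s. s \<in> S \<Longrightarrow> dist (f s) (g s) \<le> e" "t \<in> X"
  shows "dist (f t) (g t) \<le> e"
proof -
  obtain s where s: "\<And>n. s n \<in> S" "s \<longlonglongrightarrow> t"
    using assms(4,6) closure_sequential by blast
  have "(\<lambda>n. dist (f (s n)) (g (s n))) \<longlonglongrightarrow> dist (f t) (g t)"
  proof (rule tendsto_dist)
    have ev: "\<forall>\<^sub>F n in sequentially. s n \<in> X" using s(1) assms(3) by (auto intro!: always_eventually)
    show "(\<lambda>n. f (s n)) \<longlonglongrightarrow> f t" "(\<lambda>n. g (s n)) \<longlonglongrightarrow> g t"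
      using continuous_on_tendsto_compose[OF assms(1) s(2) assms(6) ev]
        continuous_on_tendsto_compose[OF assms(2) s(2) assms(6) ev] by auto
  qed
  then show ?thesis using assms(5) s(1) by (intro LIMSEQ_le_const2) auto
qed

text \<open>The Borel sets of the path space are generated by the evaluations at a countable dense set of times. By
uniform continuity every path is uniformly close to a step function on a uniform grid with values in a
countable dense set, so every open set is a countable union of sets of paths that stay within \<open>1 / (k + 1)\<close>
of such a step function, and this is a condition on the dense set of times.\<close>

lemma measurable_into_path_borel:
  fixes f :: "'a \<Rightarrow> real \<Rightarrow> real^'n"
  assumes T: "0 \<le> T" and S: "countable S" "S \<subseteq> {0..T}" "{0..T} \<subseteq> closure S"
    and f: "\<And>x. x \<in> space M \<Longrightarrow> f x \<in> topspace (path_topology T)"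
    and meas: "\<And>s. s \<in> S \<Longrightarrow> (\<lambda>x. f x s) \<in> borel_measurable M"
  shows "f \<in> M \<rightarrow>\<^sub>M path_borel T"
  unfolding path_borel_def
proof (rule measurable_measure_of)
  show "{U. openin (path_topology T) U} \<subseteq> Pow (topspace (path_topology T))"
    by (auto dest: openin_subset)
  show "f \<in> space M \<rightarrow> topspace (path_topology T)" using f by blast
  fix U :: "(real \<Rightarrow> real^'n) set" assume "U \<in> {U. openin (path_topology T) U}"
  then have U: "U \<subseteq> topspace (path_topology T)" "\<And>\<omega>. \<omega> \<in> U \<Longrightarrow>
      \<exists>e>0. \<forall>\<omega>'\<in>topspace (path_topology T). (\<forall>t\<in>{0..T}. dist (\<omega> t) (\<omega>' t) \<le> e) \<longrightarrow> \<omega>' \<in> U"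
    using openin_path_topology[OF T, of U] by blast+
  obtain D :: "(real^'n) set" where D: "countable D" "\<And>X. open X \<Longrightarrow> X \<noteq> {} \<Longrightarrow> \<exists>d\<in>D. d \<in> X"
    using countable_dense_exists by blast
  define B where "B = (\<lambda>(N :: nat, cs, k :: nat). {\<omega> \<in> topspace (path_topology T).
      \<forall>s\<in>S. dist (\<omega> s) ((cs :: (real^'n) list) ! nat \<lfloor>real N * s\<rfloor>) \<le> 1 / real (Suc k)})"
  define Q where "Q = {q \<in> UNIV \<times> lists D \<times> UNIV. B q \<subseteq> U}"
  have "countable Q"
    unfolding Q_def by (rule countable_subset[of _ "UNIV \<times> lists D \<times> UNIV"]) (use D(1) in auto)
  have "U \<subseteq> (\<Union>q\<in>Q. B q)"
  proof
    fix \<omega> assume "\<omega> \<in> U"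
    then have \<omega>: "\<omega> \<in> topspace (path_topology T)" "continuous_on {0..T} \<omega>"
      using U(1) by (auto simp: topspace_path_topology)
    obtain e where e: "e > 0" "\<And>\<omega>'. \<omega>' \<in> topspace (path_topology T) \<Longrightarrow>
        (\<forall>t\<in>{0..T}. dist (\<omega> t) (\<omega>' t) \<le> e) \<Longrightarrow> \<omega>' \<in> U"
      using U(2)[OF \<open>\<omega> \<in> U\<close>] by blast
    obtain k where k: "1 / real (Suc k) < e / 2"
      using reals_Archimedean[of "e / 2"] e(1) by (auto simp: inverse_eq_divide)
    define r where "r = 1 / real (Suc k)"
    have "r > 0" by (simp add: r_def)
    have uc: "uniformly_continuous_on {0..T} \<omega>"
      using \<omega>(2) by (intro compact_uniformly_continuous) auto
    have "0 < r / 2" using \<open>r > 0\<close> by simp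
    obtain \<delta> where \<delta>: "\<delta> > 0" "\<And>s t. s \<in> {0..T} \<Longrightarrow> t \<in> {0..T} \<Longrightarrow> dist t s < \<delta> \<Longrightarrow> dist (\<omega> t) (\<omega> s) < r / 2"
      by (rule uniformly_continuous_onE[OF uc \<open>0 < r / 2\<close>]) (rule that)
    obtain N :: nat where N: "1 / \<delta> < real N" using reals_Archimedean2 by blast
    moreover have "0 < 1 / \<delta>" using \<delta>(1) by simp
    ultimately have N0: "0 < real N" by linarith
    have "\<exists>d\<in>D. dist (\<omega> (real i / real N)) d < r / 2" for i :: nat
      using D(2)[of "ball (\<omega> (real i / real N)) (r / 2)"] \<open>r > 0\<close> by (auto simp: mem_ball)
    then obtain d where d: "\<And>i. d i \<in> D" "\<And>i. dist (\<omega> (real i / real N)) (d i) < r / 2" by metis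
    define cs where "cs = map d [0..<Suc (nat \<lfloor>real N * T\<rfloor>)]"
    have near: "dist (\<omega> s) (cs ! nat \<lfloor>real N * s\<rfloor>) \<le> r" if "s \<in> S" for s
    proof -
      have s: "s \<in> {0..T}" using that S by blast
      define i where "i = nat \<lfloor>real N * s\<rfloor>"
      have i: "real i \<le> real N * s" "real N * s < real i + 1"
        using s N0 unfolding i_def by auto
      have "i \<le> nat \<lfloor>real N * T\<rfloor>"
        unfolding i_def using s N0 by (intro nat_mono floor_mono mult_left_mono) auto
      then have "i < length [0..<Suc (nat \<lfloor>real N * T\<rfloor>)]" by simp
      then have cs: "cs ! i = d i" unfolding cs_def by (subst nth_map) (simp_all del: upt_Suc)
      have "real i / real N \<le> s" "s < real i / real N + 1 / real N"
        using i N0 by (auto simp: field_simps)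
      moreover have "1 / real N < \<delta>" using N N0 \<delta>(1) by (simp add: field_simps)
      moreover have "0 \<le> real i / real N" by simp
      ultimately have "dist (\<omega> s) (\<omega> (real i / real N)) < r / 2"
        using s by (intro \<delta>(2)) (auto simp: dist_real_def)
      then have "dist (\<omega> s) (cs ! i) \<le> r"
        unfolding cs using d(2)[of i] dist_triangle[of "\<omega> s" "d i" "\<omega> (real i / real N)"] by linarith
      then show ?thesis by (simp add: i_def)
    qed
    \<comment> \<open>two paths close to the same step function are within \<open>2 / (k + 1) < e\<close> of each other\<close>
    have "B (N, cs, k) \<subseteq> U"
    proof
      fix \<omega>' assume "\<omega>' \<in> B (N, cs, k)"
      then have \<omega>': "\<omega>' \<in> topspace (path_topology T)" "continuous_on {0..T} \<omega>'"
          "\<And>s. s \<in> S \<Longrightarrow> dist (\<omega>' s) (cs ! nat \<lfloor>real N * s\<rfloor>) \<le> r"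
        by (auto simp: B_def r_def topspace_path_topology)
      have "dist (\<omega> s) (\<omega>' s) \<le> e" if "s \<in> S" for s
        using near[OF that] \<omega>'(3)[OF that] k
          dist_triangle2[of "\<omega> s" "\<omega>' s" "cs ! nat \<lfloor>real N * s\<rfloor>"] unfolding r_def by linarith
      then have "dist (\<omega> t) (\<omega>' t) \<le> e" if "t \<in> {0..T}" for t
        using dense_dist_le[OF \<omega>(2) \<omega>'(2) S(2,3)] that by blast
      then show "\<omega>' \<in> U" using e(2) \<omega>'(1) by blast
    qed
    moreover have "cs \<in> lists D" using d(1) by (auto simp: cs_def)
    moreover have "\<omega> \<in> B (N, cs, k)" using near \<omega>(1) by (auto simp: B_def r_def)
    ultimately show "\<omega> \<in> (\<Union>q\<in>Q. B q)" by (auto simp: Q_def)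
  qed
  moreover have "(\<Union>q\<in>Q. B q) \<subseteq> U" by (auto simp: Q_def)
  ultimately have fU: "f -` U \<inter> space M = (\<Union>q\<in>Q. f -` B q \<inter> space M)" by blast
  have "f -` B q \<inter> space M \<in> sets M" for q
  proof -
    obtain N cs k where q: "q = (N, cs, k)" by (cases q)
    have "f -` B q \<inter> space M = {x \<in> space M. \<forall>s\<in>S. dist (f x s) (cs ! nat \<lfloor>real N * s\<rfloor>) \<le> 1 / real (Suc k)}"
      using f by (auto simp: B_def q)
    also have "\<dots> \<in> sets M"
    proof (rule sets.sets_Collect_countable_All'[OF _ S(1)])
      fix s assume "s \<in> S"
      note [measurable] = meas[OF this]
      show "{x \<in> space M. dist (f x s) (cs ! nat \<lfloor>real N * s\<rfloor>) \<le> 1 / real (Suc k)} \<in> sets M" by measurable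
    qed
    finally show ?thesis .
  qed
  then show "f -` U \<inter> space M \<in> sets M"
    unfolding fU by (intro sets.countable_UN' \<open>countable Q\<close>) auto
qed

section \<open>Velocity and action as measurable functions of the path\<close>

text \<open>A path is continuous, so its value at \<open>t\<close> is the limit of its values at \<open>\<lfloor>n t\<rfloor> / n\<close>, and for these only
countably many times occur.\<close>

lemma eval_clip_measurable:
  assumes T: "0 \<le> T"
  shows "(\<lambda>(t, \<omega> :: real \<Rightarrow> real^'n). \<omega> (clip T t)) \<in> borel_measurable (borel \<Otimes>\<^sub>M path_borel T)"
proof (rule borel_measurable_LIMSEQ_metric)
  have clip: "clip T t \<in> {0..T}" for t using T by (auto simp: clip_def)
  show "(\<lambda>p. (snd p :: real \<Rightarrow> real^'n) (clip T (real_of_int \<lfloor>real (Suc n) * fst p\<rfloor> / real (Suc n)))) \<in>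
      borel_measurable (borel \<Otimes>\<^sub>M path_borel T)" for n
  proof (rule measurable_compose_countable[where f = "\<lambda>i p. snd p (clip T (real_of_int i / real (Suc n)))" and
        g = "\<lambda>p. \<lfloor>real (Suc n) * fst p\<rfloor>"])
    show "(\<lambda>p. (snd p :: real \<Rightarrow> real^'n) (clip T (real_of_int i / real (Suc n)))) \<in>
        borel_measurable (borel \<Otimes>\<^sub>M path_borel T)" for i
      using measurable_compose[OF measurable_snd eval_measurable[OF clip]] .
  qed measurable
  fix p :: "real \<times> (real \<Rightarrow> real^'n)" assume "p \<in> space (borel \<Otimes>\<^sub>M path_borel T)"
  then obtain t \<omega> where p: "p = (t, \<omega>)" "continuous_on {0..T} \<omega>"
    by (auto simp: space_pair_measure space_path_borel topspace_path_topology)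
  have "(\<lambda>n. real_of_int \<lfloor>real (Suc n) * t\<rfloor> / real (Suc n)) \<longlonglongrightarrow> t"
  proof (rule tendsto_sandwich)
    show "(\<lambda>n. t - 1 / real (Suc n)) \<longlonglongrightarrow> t"
      using tendsto_diff[OF tendsto_const LIMSEQ_Suc[OF lim_1_over_n], of t] by simp
    show "\<forall>\<^sub>F n in sequentially. t - 1 / real (Suc n) \<le> real_of_int \<lfloor>real (Suc n) * t\<rfloor> / real (Suc n)"
    proof (intro always_eventually allI)
      fix n
      have "real (Suc n) * t - 1 \<le> real_of_int \<lfloor>real (Suc n) * t\<rfloor>" by linarith
      then have "(real (Suc n) * t - 1) / real (Suc n) \<le> real_of_int \<lfloor>real (Suc n) * t\<rfloor> / real (Suc n)"
        by (rule divide_right_mono) simp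
      then show "t - 1 / real (Suc n) \<le> real_of_int \<lfloor>real (Suc n) * t\<rfloor> / real (Suc n)"
        by (simp add: diff_divide_distrib)
    qed
    show "\<forall>\<^sub>F n in sequentially. real_of_int \<lfloor>real (Suc n) * t\<rfloor> / real (Suc n) \<le> t"
    proof (intro always_eventually allI)
      fix n
      have "real_of_int \<lfloor>real (Suc n) * t\<rfloor> / real (Suc n) \<le> (real (Suc n) * t) / real (Suc n)"
        by (rule divide_right_mono) simp_all
      then show "real_of_int \<lfloor>real (Suc n) * t\<rfloor> / real (Suc n) \<le> t" by simp
    qed
  qed simp
  then have "(\<lambda>n. clip T (real_of_int \<lfloor>real (Suc n) * t\<rfloor> / real (Suc n))) \<longlonglongrightarrow> clip T t"
    unfolding clip_def by (intro tendsto_intros)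
  then have "(\<lambda>n. \<omega> (clip T (real_of_int \<lfloor>real (Suc n) * t\<rfloor> / real (Suc n)))) \<longlonglongrightarrow> \<omega> (clip T t)"
    by (rule continuous_on_tendsto_compose[OF p(2)]) (use clip in auto)
  then show "(\<lambda>n. snd p (clip T (real_of_int \<lfloor>real (Suc n) * fst p\<rfloor> / real (Suc n)))) \<longlonglongrightarrow>
      (case p of (t, \<omega>) \<Rightarrow> \<omega> (clip T t))"
    using p(1) by simp
qed

text \<open>The derivative as the limit of one sequence of difference quotients. It is jointly measurable in time and
path; at times where the limit does not exist its value is arbitrary.\<close>

definition right_velocity :: "real \<Rightarrow> (real \<Rightarrow> real^'n) \<Rightarrow> real \<Rightarrow> real^'n" where
  "right_velocity T \<omega> t =
     lim (\<lambda>n. real (Suc n) *\<^sub>R (\<omega> (clip T (t + 1 / real (Suc n))) - \<omega> (clip T t)))"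

lemma right_velocity_measurable:
  assumes T: "0 \<le> T"
  shows "(\<lambda>(t, \<omega> :: real \<Rightarrow> real^'n). right_velocity T \<omega> t) \<in> borel_measurable (borel \<Otimes>\<^sub>M path_borel T)"
  unfolding right_velocity_def case_prod_beta
proof (rule borel_measurable_lim_metric)
  fix n
  have "(\<lambda>p. (snd p :: real \<Rightarrow> real^'n) (clip T (fst p + 1 / real (Suc n)))) \<in> borel_measurable (borel \<Otimes>\<^sub>M path_borel T)"
  proof -
    have "(\<lambda>p. (fst p + 1 / real (Suc n), snd p)) \<in>
        borel \<Otimes>\<^sub>M path_borel T \<rightarrow>\<^sub>M borel \<Otimes>\<^sub>M (path_borel T :: (real \<Rightarrow> real^'n) measure)"
      by (intro measurable_Pair borel_measurable_add measurable_fst measurable_snd) simp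
    from measurable_compose[OF this eval_clip_measurable[OF T]] show ?thesis by (simp add: case_prod_beta)
  qed
  moreover have "(\<lambda>p. (snd p :: real \<Rightarrow> real^'n) (clip T (fst p))) \<in> borel_measurable (borel \<Otimes>\<^sub>M path_borel T)"
    using eval_clip_measurable[OF T] by (simp add: split_beta')
  ultimately show "(\<lambda>p. real (Suc n) *\<^sub>R (snd p (clip T (fst p + 1 / real (Suc n))) - (snd p :: real \<Rightarrow> real^'n) (clip T (fst p))))
      \<in> borel_measurable (borel \<Otimes>\<^sub>M path_borel T)"
    by (intro borel_measurable_scaleR borel_measurable_diff borel_measurable_const)
qed

lemma AE_time_measure:
  "(AE t in time_measure T. P t) \<longleftrightarrow> (AE t in lborel. 0 < t \<and> t < T \<longrightarrow> P t)"
proof -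
  have "(AE t in time_measure T. P t) \<longleftrightarrow> (AE t in lborel. t \<in> {0..T} \<longrightarrow> P t)"
    unfolding time_measure_def by (rule AE_restrict_space_iff) simp
  also have "\<dots> \<longleftrightarrow> (AE t in lborel. 0 < t \<and> t < T \<longrightarrow> P t)"
  proof
    assume "AE t in lborel. 0 < t \<and> t < T \<longrightarrow> P t"
    with AE_lborel_singleton[of 0] AE_lborel_singleton[of T]
    show "AE t in lborel. t \<in> {0..T} \<longrightarrow> P t"
      by eventually_elim auto
  qed (auto elim: eventually_mono)
  finally show ?thesis .
qed

lemma right_velocity_eq:
  assumes \<omega>: "(\<omega> has_vector_derivative v) (at t)" and t: "0 < t" "t < T"
  shows "right_velocity T \<omega> t = v"
proof -
  have "(\<lambda>n. real (Suc n) *\<^sub>R (\<omega> (clip T (t + 1 / real (Suc n))) - \<omega> (clip T t))) \<longlonglongrightarrow> v"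
  proof (rule Lim_transform_eventually)
    have "((\<lambda>h. (1 / h) *\<^sub>R (\<omega> (t + h) - \<omega> t)) \<longlongrightarrow> v) (at 0)"
    proof (rule LIM_zero_cancel, rule tendsto_norm_zero_cancel, rule Lim_transform_eventually)
      show "((\<lambda>h. norm (\<omega> (t + h) - \<omega> t - h *\<^sub>R v) / norm h) \<longlongrightarrow> 0) (at 0)"
        using \<omega> unfolding has_vector_derivative_def has_derivative_at by blast
      show "\<forall>\<^sub>F h in at 0. norm (\<omega> (t + h) - \<omega> t - h *\<^sub>R v) / norm h =
          norm ((1 / h) *\<^sub>R (\<omega> (t + h) - \<omega> t) - v)"
        unfolding eventually_at_filter
      proof (intro always_eventually allI impI)
        fix h :: real assume "h \<noteq> 0"
        then have "(1 / h) *\<^sub>R (\<omega> (t + h) - \<omega> t) - v = (1 / h) *\<^sub>R (\<omega> (t + h) - \<omega> t - h *\<^sub>R v)"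
          by (simp add: algebra_simps)
        then show "norm (\<omega> (t + h) - \<omega> t - h *\<^sub>R v) / norm h =
          norm ((1 / h) *\<^sub>R (\<omega> (t + h) - \<omega> t) - v)" by simp
      qed
    qed
    moreover have "filterlim (\<lambda>n. 1 / real (Suc n)) (at 0) sequentially"
      using LIMSEQ_Suc[OF lim_1_over_n] by (auto simp: filterlim_at)
    ultimately show "(\<lambda>n. (1 / (1 / real (Suc n))) *\<^sub>R (\<omega> (t + 1 / real (Suc n)) - \<omega> t)) \<longlonglongrightarrow> v"
      by (rule filterlim_compose)
    have "\<forall>\<^sub>F n in sequentially. 1 / real (Suc n) < T - t"
      using order_tendstoD(2)[OF LIMSEQ_Suc[OF lim_1_over_n], of "T - t"] t by simp
    then show "\<forall>\<^sub>F n in sequentially. (1 / (1 / real (Suc n))) *\<^sub>R (\<omega> (t + 1 / real (Suc n)) - \<omega> t) =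
        real (Suc n) *\<^sub>R (\<omega> (clip T (t + 1 / real (Suc n))) - \<omega> (clip T t))"
    proof eventually_elim
      case (elim n)
      have "clip T (t + 1 / real (Suc n)) = t + 1 / real (Suc n)" "clip T t = t"
        using elim t by (auto simp: clip_def)
      then show ?case by simp
    qed
  qed
  then show ?thesis unfolding right_velocity_def by (rule limI)
qed

lemma abs_continuous_path_velocity:
  fixes \<omega> :: "real \<Rightarrow> real^'n"
  assumes T: "0 < T" and \<omega>: "\<omega> \<in> topspace (path_topology T)" and ac: "abs_continuous_path T \<omega>"
  shows "AE t in time_measure T. vector_derivative \<omega> (at t within {0..T}) = right_velocity T \<omega> t"
    and "set_integrable lborel {0..T} (right_velocity T \<omega>)"
    and "\<And>x y. 0 \<le> x \<Longrightarrow> x \<le> y \<Longrightarrow> y \<le> T \<Longrightarrow>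
           (LINT u:{x..y}|lborel. right_velocity T \<omega> u) = \<omega> y - \<omega> x"
proof -
  obtain h where h: "integrable lborel h"
      "\<And>x y. 0 \<le> x \<Longrightarrow> x \<le> y \<Longrightarrow> y \<le> T \<Longrightarrow> (LINT u:{x..y}|lborel. h u) = \<omega> y - \<omega> x"
      "AE t in lborel. 0 < t \<and> t < T \<longrightarrow> (\<omega> has_vector_derivative h t) (at t)"
    using abs_continuous_path_fundamental[OF T ac] by blast
  have eq: "AE t in lborel. 0 < t \<and> t < T \<longrightarrow>
      vector_derivative \<omega> (at t within {0..T}) = h t \<and> right_velocity T \<omega> t = h t"
    using h(3)
  proof eventually_elim
    case (elim t)
    have "vector_derivative \<omega> (at t within {0..T}) = h t"
      if t: "0 < t" "t < T" and d: "(\<omega> has_vector_derivative h t) (at t)"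
      using vector_derivative_within_cbox[of 0 T t \<omega> "h t"] has_vector_derivative_at_within[OF d] t by simp
    then show ?case using elim right_velocity_eq by blast
  qed
  show "AE t in time_measure T. vector_derivative \<omega> (at t within {0..T}) = right_velocity T \<omega> t"
    unfolding AE_time_measure using eq by eventually_elim auto
  have eq': "AE u in lborel. indicator {x..y} u *\<^sub>R right_velocity T \<omega> u = indicator {x..y} u *\<^sub>R h u"
    if "0 \<le> x" "y \<le> T" for x y
    using eq AE_lborel_singleton[of 0] AE_lborel_singleton[of T]
    by eventually_elim (use that in \<open>auto split: split_indicator\<close>)
  have [measurable]: "right_velocity T \<omega> \<in> borel_measurable borel" "h \<in> borel_measurable borel"
    using measurable_compose[OF _ right_velocity_measurable[of T], of "\<lambda>t. (t, \<omega>)" borel] T \<omega> h(1)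
    by (auto simp: space_path_borel)
  have "set_integrable lborel {0..T} (right_velocity T \<omega>) \<longleftrightarrow> set_integrable lborel {0..T} h"
    unfolding set_integrable_def by (rule integrable_cong_AE) (use eq' in auto)
  then show "set_integrable lborel {0..T} (right_velocity T \<omega>)"
    using integrable_mult_indicator[OF _ h(1), of "{0..T}"] by (simp add: set_integrable_def)
  show "(LINT u:{x..y}|lborel. right_velocity T \<omega> u) = \<omega> y - \<omega> x" if "0 \<le> x" "x \<le> y" "y \<le> T" for x y
    unfolding h(2)[OF that, symmetric] set_lebesgue_integral_def
    by (rule integral_cong_AE) (use eq' that in auto)
qed

text \<open>The end points of finitely many intervals can be moved slightly inwards to points of the dense set. The
intervals stay disjoint, their total length does not grow, and by continuity the increments of the path
hardly change.\<close>

lemma abs_continuous_path_iff_dense: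
  fixes \<omega> :: "real \<Rightarrow> real^'n" and s :: "nat \<Rightarrow> real"
  assumes T: "0 < T" and \<omega>: "continuous_on {0..T} \<omega>"
    and s: "range s \<subseteq> {0..T}" "{0..T} \<subseteq> closure (range s)"
  shows "abs_continuous_path T \<omega> \<longleftrightarrow> (\<forall>k::nat. \<exists>m::nat. \<forall>ps :: (nat \<times> nat) list.
     (\<forall>i<length ps. s (fst (ps ! i)) \<le> s (snd (ps ! i))) \<and>
     (\<forall>i<length ps. \<forall>j<length ps. i \<noteq> j \<longrightarrow>
        {s (fst (ps ! i))<..<s (snd (ps ! i))} \<inter> {s (fst (ps ! j))<..<s (snd (ps ! j))} = {}) \<and>
     (\<Sum>i<length ps. s (snd (ps ! i)) - s (fst (ps ! i))) < 1 / real (Suc m) \<longrightarrow>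
     (\<Sum>i<length ps. norm (\<omega> (s (snd (ps ! i))) - \<omega> (s (fst (ps ! i))))) \<le> 1 / real (Suc k))"
    (is "_ \<longleftrightarrow> (\<forall>k. \<exists>m. ?P k m)")
proof
  assume ac: "abs_continuous_path T \<omega>"
  show "\<forall>k. \<exists>m. ?P k m"
  proof
    fix k :: nat
    have "0 < 1 / real (Suc k)" by simp
    with ac have "\<exists>\<delta>>0. \<forall>(n::nat) a b.
        (\<forall>i<n. 0 \<le> a i \<and> a i \<le> b i \<and> b i \<le> T) \<and>
        (\<forall>i<n. \<forall>j<n. i \<noteq> j \<longrightarrow> {a i<..<b i} \<inter> {a j<..<b j} = {}) \<and>
        (\<Sum>i<n. b i - a i) < \<delta> \<longrightarrow> (\<Sum>i<n. norm (\<omega> (b i) - \<omega> (a i))) < 1 / real (Suc k)"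
      unfolding abs_continuous_path_def by blast
    then obtain \<delta> where \<delta>: "\<delta> > 0" "\<forall>(n::nat) a b.
        (\<forall>i<n. 0 \<le> a i \<and> a i \<le> b i \<and> b i \<le> T) \<and>
        (\<forall>i<n. \<forall>j<n. i \<noteq> j \<longrightarrow> {a i<..<b i} \<inter> {a j<..<b j} = {}) \<and>
        (\<Sum>i<n. b i - a i) < \<delta> \<longrightarrow> (\<Sum>i<n. norm (\<omega> (b i) - \<omega> (a i))) < 1 / real (Suc k)"
      by (elim exE conjE)
    obtain m where m: "1 / real (Suc m) < \<delta>"
      using reals_Archimedean[OF \<delta>(1)] by (auto simp: inverse_eq_divide)
    have "s j \<in> {0..T}" for j using s(1) by blast
    then have sT: "0 \<le> s j" "s j \<le> T" for j by auto
    have "?P k m"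
    proof (intro allI impI, elim conjE)
      fix ps :: "(nat \<times> nat) list"
      assume ps: "\<forall>i<length ps. s (fst (ps ! i)) \<le> s (snd (ps ! i))"
        "\<forall>i<length ps. \<forall>j<length ps. i \<noteq> j \<longrightarrow>
          {s (fst (ps ! i))<..<s (snd (ps ! i))} \<inter> {s (fst (ps ! j))<..<s (snd (ps ! j))} = {}"
        "(\<Sum>i<length ps. s (snd (ps ! i)) - s (fst (ps ! i))) < 1 / real (Suc m)"
      show "(\<Sum>i<length ps. norm (\<omega> (s (snd (ps ! i))) - \<omega> (s (fst (ps ! i))))) \<le> 1 / real (Suc k)"
        using \<delta>(2)[THEN spec, of "length ps", THEN spec, of "\<lambda>i. s (fst (ps ! i))", THEN spec, of "\<lambda>i. s (snd (ps ! i))"]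
          ps m sT less_trans[OF ps(3) m] less_imp_le by blast
    qed
    then show "\<exists>m. ?P k m" by blast
  qed
next
  assume P: "\<forall>k. \<exists>m. ?P k m"
  have sT: "s j \<in> {0..T}" for j using s(1) by blast
  have approx: "\<exists>p :: nat \<Rightarrow> nat \<times> nat. (\<forall>j. s (fst (p j)) \<le> s (snd (p j)) \<and> s (snd (p j)) - s (fst (p j)) \<le> b - a \<and>
      {s (fst (p j))<..<s (snd (p j))} \<subseteq> {a<..<b}) \<and>
      (\<lambda>j. norm (\<omega> (s (snd (p j))) - \<omega> (s (fst (p j))))) \<longlonglongrightarrow> norm (\<omega> b - \<omega> a)"
    if ab: "0 \<le> a" "a \<le> b" "b \<le> T" for a b
  proof (cases "a = b")
    case True
    then show ?thesis by (intro exI[of _ "\<lambda>_. (0, 0)"]) auto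
  next
    case False
    then have "a < b" using ab by simp
    have pick: "\<exists>i. x < s i \<and> s i < y" if xy: "0 \<le> x" "x < y" "y \<le> T" for x y
    proof -
      have "(x + y) / 2 \<in> closure (range s)" using s(2) xy by auto
      moreover have "open {x<..<y}" "(x + y) / 2 \<in> {x<..<y}" using xy by auto
      ultimately have "{x<..<y} \<inter> range s \<noteq> {}" using open_Int_closure_eq_empty by blast
      then show ?thesis by auto
    qed
    define r where "r j = (b - a) / 2 / real (Suc j)" for j
    have r: "0 < r j" "r j \<le> (b - a) / 2" for j
      using \<open>a < b\<close> divide_left_mono[of 1 "real (Suc j)" "(b - a) / 2"] by (auto simp: r_def)
    have "\<exists>i. a < s i \<and> s i < a + r j" "\<exists>i. b - r j < s i \<and> s i < b" for j
      using pick[of a "a + r j"] pick[of "b - r j" b] r[of j] ab by auto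
    then obtain p q where p: "\<And>j. a < s (p j)" "\<And>j. s (p j) < a + r j"
      and q: "\<And>j. b - r j < s (q j)" "\<And>j. s (q j) < b" by metis
    have r0: "r \<longlonglongrightarrow> 0"
      unfolding r_def using tendsto_mult_right_zero[OF LIMSEQ_Suc[OF lim_1_over_n], of "(b - a) / 2"] by simp
    have "(\<lambda>j. s (p j)) \<longlonglongrightarrow> a"
    proof (rule tendsto_sandwich[OF _ _ tendsto_const])
      show "(\<lambda>j. a + r j) \<longlonglongrightarrow> a" using tendsto_add[OF tendsto_const r0, of a] by simp
    qed (use p in \<open>auto intro!: always_eventually less_imp_le\<close>)
    moreover have "(\<lambda>j. s (q j)) \<longlonglongrightarrow> b"
    proof (rule tendsto_sandwich[OF _ _ _ tendsto_const])
      show "(\<lambda>j. b - r j) \<longlonglongrightarrow> b" using tendsto_diff[OF tendsto_const r0, of b] by simp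
    qed (use q in \<open>auto intro!: always_eventually less_imp_le\<close>)
    ultimately have "(\<lambda>j. norm (\<omega> (s (q j)) - \<omega> (s (p j)))) \<longlonglongrightarrow> norm (\<omega> b - \<omega> a)"
      using ab by (intro tendsto_norm tendsto_diff continuous_on_tendsto_compose[OF \<omega>] always_eventually allI sT) auto
    moreover have "s (p j) \<le> s (q j)" for j
    proof -
      have "2 * r j \<le> b - a" using r(2)[of j] by simp
      then show ?thesis using p(2)[of j] q(1)[of j] by linarith
    qed
    moreover have "s (q j) - s (p j) \<le> b - a" for j using p(1)[of j] q(2)[of j] by linarith
    moreover have "{s (p j)<..<s (q j)} \<subseteq> {a<..<b}" for j using p(1)[of j] q(2)[of j] by auto
    ultimately show ?thesis by (intro exI[of _ "\<lambda>j. (p j, q j)"]) auto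
  qed
  show "abs_continuous_path T \<omega>"
    unfolding abs_continuous_path_def
  proof (intro allI impI)
    fix \<epsilon> :: real assume "0 < \<epsilon>"
    obtain k where k: "1 / real (Suc k) < \<epsilon>"
      using reals_Archimedean[OF \<open>0 < \<epsilon>\<close>] by (auto simp: inverse_eq_divide)
    obtain m where m: "?P k m" using P by blast
    show "\<exists>\<delta>>0. \<forall>(n::nat) a b.
        (\<forall>i<n. 0 \<le> a i \<and> a i \<le> b i \<and> b i \<le> T) \<and>
        (\<forall>i<n. \<forall>j<n. i \<noteq> j \<longrightarrow> {a i<..<b i} \<inter> {a j<..<b j} = {}) \<and>
        (\<Sum>i<n. b i - a i) < \<delta> \<longrightarrow> (\<Sum>i<n. norm (\<omega> (b i) - \<omega> (a i))) < \<epsilon>"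
    proof (intro exI[of _ "1 / real (Suc m)"] conjI allI impI, simp, elim conjE)
      fix n :: nat and a b
      assume ab: "\<forall>i<n. 0 \<le> a i \<and> a i \<le> b i \<and> b i \<le> T"
        "\<forall>i<n. \<forall>j<n. i \<noteq> j \<longrightarrow> {a i<..<b i} \<inter> {a j<..<b j} = {}"
        "(\<Sum>i<n. b i - a i) < 1 / real (Suc m)"
      have "\<forall>i. \<exists>p :: nat \<Rightarrow> nat \<times> nat. i < n \<longrightarrow> (\<forall>j. s (fst (p j)) \<le> s (snd (p j)) \<and> s (snd (p j)) - s (fst (p j)) \<le> b i - a i \<and>
        {s (fst (p j))<..<s (snd (p j))} \<subseteq> {a i<..<b i}) \<and>
        (\<lambda>j. norm (\<omega> (s (snd (p j))) - \<omega> (s (fst (p j))))) \<longlonglongrightarrow> norm (\<omega> (b i) - \<omega> (a i))"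
        using approx ab(1) by meson
      then obtain p :: "nat \<Rightarrow> nat \<Rightarrow> nat \<times> nat" where p0: "\<forall>i. i < n \<longrightarrow> (\<forall>j. s (fst (p i j)) \<le> s (snd (p i j)) \<and> s (snd (p i j)) - s (fst (p i j)) \<le> b i - a i \<and>
        {s (fst (p i j))<..<s (snd (p i j))} \<subseteq> {a i<..<b i}) \<and>
        (\<lambda>j. norm (\<omega> (s (snd (p i j))) - \<omega> (s (fst (p i j))))) \<longlonglongrightarrow> norm (\<omega> (b i) - \<omega> (a i))"
        by (rule choice[THEN exE])
      have p: "s (fst (p i j)) \<le> s (snd (p i j))" "s (snd (p i j)) - s (fst (p i j)) \<le> b i - a i"
        "{s (fst (p i j))<..<s (snd (p i j))} \<subseteq> {a i<..<b i}"
        "(\<lambda>j. norm (\<omega> (s (snd (p i j))) - \<omega> (s (fst (p i j))))) \<longlonglongrightarrow> norm (\<omega> (b i) - \<omega> (a i))"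
        if "i < n" for i j using p0 that by blast+
      have bound: "(\<Sum>i<n. norm (\<omega> (s (snd (p i j))) - \<omega> (s (fst (p i j))))) \<le> 1 / real (Suc k)" for j
      proof -
        define ps where "ps = map (\<lambda>i. p i j) [0..<n]"
        have ps: "length ps = n" "\<And>i. i < n \<Longrightarrow> ps ! i = p i j" by (simp_all add: ps_def)
        have "(\<Sum>i<n. s (snd (p i j)) - s (fst (p i j))) \<le> (\<Sum>i<n. b i - a i)"
          by (rule sum_mono) (use p(2) in auto)
        then have 1: "(\<Sum>i<length ps. s (snd (ps ! i)) - s (fst (ps ! i))) < 1 / real (Suc m)"
          using ab(3) ps by simp
        have 2: "{s (fst (ps ! i))<..<s (snd (ps ! i))} \<inter> {s (fst (ps ! l))<..<s (snd (ps ! l))} = {}"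
          if "i < length ps" "l < length ps" "i \<noteq> l" for i l
        proof -
          have "{a i<..<b i} \<inter> {a l<..<b l} = {}" using ab(2) that ps(1) by blast
          then show ?thesis using p(3)[of i j] p(3)[of l j] that unfolding ps(1) ps(2)[OF that(1)[unfolded ps(1)]] ps(2)[OF that(2)[unfolded ps(1)]] by blast
        qed
        have "(\<Sum>i<length ps. norm (\<omega> (s (snd (ps ! i))) - \<omega> (s (fst (ps ! i))))) \<le> 1 / real (Suc k)"
          by (rule m[rule_format]) (use 1 2 ps p(1) in \<open>auto simp del: greaterThanLessThan_empty_iff2 greaterThanLessThan_empty_iff Int_greaterThanLessThan\<close>)
        then show ?thesis using ps by simp
      qed
      have "(\<lambda>j. \<Sum>i<n. norm (\<omega> (s (snd (p i j))) - \<omega> (s (fst (p i j))))) \<longlonglongrightarrow> (\<Sum>i<n. norm (\<omega> (b i) - \<omega> (a i)))"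
        by (rule tendsto_sum) (use p(4) in auto)
      then have "(\<Sum>i<n. norm (\<omega> (b i) - \<omega> (a i))) \<le> 1 / real (Suc k)"
        by (rule LIMSEQ_le_const2) (use bound in blast)
      then show "(\<Sum>i<n. norm (\<omega> (b i) - \<omega> (a i))) < \<epsilon>" using k by linarith
    qed
  qed
qed


lemma countable_dense_times:
  assumes "0 < T"
  obtains s :: "nat \<Rightarrow> real" where "range s \<subseteq> {0..T}" "{0..T} \<subseteq> closure (range s)"
proof -
  obtain S where S: "countable S" "S \<subseteq> {0..T}" "{0..T} \<subseteq> closure S"
    by (rule separable[of "{0..T}"])
  have "S \<noteq> {}" using S(3) assms by auto
  then have "range (from_nat_into S) = S" using S(1) by (rule range_from_nat_into)
  then show thesis using S by (intro that[of "from_nat_into S"]) auto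
qed

lemma abs_continuous_paths_measurable:
  assumes T: "0 < T"
  shows "{\<omega> \<in> space (path_borel T). abs_continuous_path T (\<omega> :: real \<Rightarrow> real^'n)} \<in> sets (path_borel T)"
proof -
  obtain s :: "nat \<Rightarrow> real" where s: "range s \<subseteq> {0..T}" "{0..T} \<subseteq> closure (range s)"
    by (rule countable_dense_times[OF T])
  have "s j \<in> {0..T}" for j using s(1) by blast
  then have [measurable]: "(\<lambda>\<omega> :: real \<Rightarrow> real^'n. \<omega> (s j)) \<in> borel_measurable (path_borel T)" for j
    by (rule eval_measurable)
  have "{\<omega> \<in> space (path_borel T). abs_continuous_path T (\<omega> :: real \<Rightarrow> real^'n)} =
    {\<omega> \<in> space (path_borel T). (\<forall>k::nat. \<exists>m::nat. \<forall>ps :: (nat \<times> nat) list.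
     (\<forall>i<length ps. s (fst (ps ! i)) \<le> s (snd (ps ! i))) \<and>
     (\<forall>i<length ps. \<forall>j<length ps. i \<noteq> j \<longrightarrow>
        {s (fst (ps ! i))<..<s (snd (ps ! i))} \<inter> {s (fst (ps ! j))<..<s (snd (ps ! j))} = {}) \<and>
     (\<Sum>i<length ps. s (snd (ps ! i)) - s (fst (ps ! i))) < 1 / real (Suc m) \<longrightarrow>
     (\<Sum>i<length ps. norm (\<omega> (s (snd (ps ! i))) - \<omega> (s (fst (ps ! i))))) \<le> 1 / real (Suc k))}"
  proof (rule Collect_cong, rule conj_cong[OF refl])
    fix \<omega> :: "real \<Rightarrow> real^'n" assume "\<omega> \<in> space (path_borel T)"
    then have "continuous_on {0..T} \<omega>" by (simp add: space_path_borel topspace_path_topology)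
    from abs_continuous_path_iff_dense[OF T this s]
    show "abs_continuous_path T \<omega> \<longleftrightarrow> (\<forall>k::nat. \<exists>m::nat. \<forall>ps :: (nat \<times> nat) list.
     (\<forall>i<length ps. s (fst (ps ! i)) \<le> s (snd (ps ! i))) \<and>
     (\<forall>i<length ps. \<forall>j<length ps. i \<noteq> j \<longrightarrow>
        {s (fst (ps ! i))<..<s (snd (ps ! i))} \<inter> {s (fst (ps ! j))<..<s (snd (ps ! j))} = {}) \<and>
     (\<Sum>i<length ps. s (snd (ps ! i)) - s (fst (ps ! i))) < 1 / real (Suc m) \<longrightarrow>
     (\<Sum>i<length ps. norm (\<omega> (s (snd (ps ! i))) - \<omega> (s (fst (ps ! i))))) \<le> 1 / real (Suc k))" .
  qed
  also have "\<dots> \<in> sets (path_borel T)"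
    by (intro sets.sets_Collect_countable_All sets.sets_Collect_countable_Ex sets.sets_Collect_imp
        sets.sets_Collect_const) measurable
  finally show ?thesis .
qed

lemma finite_measure_time_measure: "finite_measure (time_measure T)"
  by (rule finite_measureI)
    (simp add: time_measure_def space_restrict_space emeasure_restrict_space emeasure_lborel_Icc_eq)

lemma measurable_time_measure: "f \<in> borel_measurable borel \<Longrightarrow> f \<in> borel_measurable (time_measure T)"
  unfolding time_measure_def by (rule measurable_restrict_space1) simp

text \<open>The action through a velocity that is measurable in time and path.\<close>

lemma path_action_eq:
  fixes \<omega> :: "real \<Rightarrow> real^'n"
  assumes T: "0 < T" and \<omega>: "\<omega> \<in> topspace (path_topology T)"
  shows "path_action T \<omega> = (if abs_continuous_path T \<omega>
     then ennreal T * (\<integral>\<^sup>+t. ennreal (1/2 * (norm (right_velocity T \<omega> t))\<^sup>2) \<partial>time_measure T) else \<infinity>)"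
proof -
  have "(\<integral>\<^sup>+t. ennreal (1/2 * (norm (vector_derivative \<omega> (at t within {0..T})))\<^sup>2) \<partial>time_measure T) =
        (\<integral>\<^sup>+t. ennreal (1/2 * (norm (right_velocity T \<omega> t))\<^sup>2) \<partial>time_measure T)"
    if "abs_continuous_path T \<omega>"
    by (rule nn_integral_cong_AE)
      (use abs_continuous_path_velocity(1)[OF T \<omega> that] in \<open>eventually_elim, simp\<close>)
  then show ?thesis unfolding path_action_def by simp
qed

lemma path_action_measurable:
  assumes T: "0 < T"
  shows "path_action T \<in> borel_measurable (path_borel T :: (real \<Rightarrow> real^'n) measure)"
proof -
  let ?P = "path_borel T :: (real \<Rightarrow> real^'n) measure"
  interpret finite_measure "time_measure T" by (rule finite_measure_time_measure)
  have "(\<lambda>p. (snd p, fst p)) \<in> ?P \<Otimes>\<^sub>M time_measure T \<rightarrow>\<^sub>M borel \<Otimes>\<^sub>M ?P"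
    by (intro measurable_Pair measurable_fst measurable_compose[OF measurable_snd]
        measurable_time_measure measurable_ident_sets refl)
  from measurable_compose[OF this right_velocity_measurable]
  have [measurable]: "(\<lambda>(\<omega>, t). right_velocity T \<omega> t) \<in> borel_measurable (?P \<Otimes>\<^sub>M time_measure T)"
    using T by (simp add: split_beta')
  have "(\<lambda>(\<omega>, t). ennreal (1/2 * (norm (right_velocity T \<omega> t))\<^sup>2)) \<in> borel_measurable (?P \<Otimes>\<^sub>M time_measure T)"
    by measurable
  then have "(\<lambda>\<omega>. \<integral>\<^sup>+t. ennreal (1/2 * (norm (right_velocity T \<omega> t))\<^sup>2) \<partial>time_measure T) \<in> borel_measurable ?P"
    by (rule borel_measurable_nn_integral)
  then have "(\<lambda>\<omega>. if abs_continuous_path T \<omega>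
     then ennreal T * (\<integral>\<^sup>+t. ennreal (1/2 * (norm (right_velocity T \<omega> t))\<^sup>2) \<partial>time_measure T) else \<infinity>) \<in> borel_measurable ?P"
    using abs_continuous_paths_measurable[OF T]
    by (intro measurable_If borel_measurable_times_ennreal borel_measurable_const)
  then show ?thesis
    by (rule subst[OF measurable_cong, rotated]) (simp add: path_action_eq[OF T] space_path_borel)
qed

section \<open>Every law on the path space is the law of a random path on the cube\<close>

text \<open>With digits 0 and 1 in base 3 the tail after any digit is at most 1/2 of that digit's unit, so rounding down
never produces a carry and the digits can be recovered.\<close>

lemma ternary_digit:
  fixes b :: "nat \<Rightarrow> bool"
  shows "\<lfloor>3 ^ Suc m * (\<Sum>n. of_bool (b n) * (1 / 3) ^ Suc n :: real)\<rfloor> mod 3 = of_bool (b m)"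
proof -
  define x where "x m = (\<Sum>n. of_bool (b (n + m)) * (1 / 3) ^ Suc n :: real)" for m
  have g: "(\<lambda>n. (1 / 3) ^ Suc n :: real) sums (1 / 2)"
    using sums_mult[OF geometric_sums[of "1 / 3 :: real"], of "1/3"] by simp
  have s: "summable (\<lambda>n. of_bool (b (n + m)) * (1 / 3) ^ Suc n :: real)" for m
    by (rule summable_comparison_test'[OF sums_summable[OF g], of 0]) auto
  have x: "0 \<le> x m" "x m \<le> 1 / 2" for m
  proof -
    show "0 \<le> x m" unfolding x_def by (rule suminf_nonneg[OF s]) simp
    show "x m \<le> 1 / 2" unfolding x_def sums_unique[OF g] by (rule suminf_le[OF _ s sums_summable[OF g]]) simp
  qed
  have step: "3 * x m = of_bool (b m) + x (Suc m)" for m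
  proof -
    have "x m = of_bool (b m) * (1 / 3) + (\<Sum>n. of_bool (b (Suc n + m)) * (1 / 3) ^ Suc (Suc n))"
      unfolding x_def using suminf_split_head[OF s[of m]] by simp
    also have "(\<Sum>n. of_bool (b (Suc n + m)) * (1 / 3) ^ Suc (Suc n)) = (1 / 3) * x (Suc m)"
      unfolding x_def by (subst suminf_mult[OF s, symmetric]) (simp add: ac_simps)
    finally show ?thesis by simp
  qed
  have "\<exists>N::int. 3 ^ m * x 0 = of_int N + x m" for m
  proof (induction m)
    case 0
    then show ?case by (intro exI[of _ 0]) simp
  next
    case (Suc m)
    then obtain N :: int where N: "3 ^ m * x 0 = of_int N + x m" by blast
    have "3 ^ Suc m * x 0 = 3 * (3 ^ m * x 0)" by simp
    also have "\<dots> = of_int (3 * N + of_bool (b m)) + x (Suc m)" unfolding N using step[of m] by simp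
    finally show ?case by blast
  qed
  then obtain N :: int where N: "3 ^ m * x 0 = of_int N + x m" by blast
  have "3 ^ Suc m * x 0 = 3 * (3 ^ m * x 0)" by simp
  also have "\<dots> = of_int (3 * N + of_bool (b m)) + x (Suc m)" unfolding N using step[of m] by simp
  finally have eq: "3 ^ Suc m * x 0 = of_int (3 * N + of_bool (b m)) + x (Suc m)" .
  have "\<lfloor>3 ^ Suc m * x 0\<rfloor> = 3 * N + of_bool (b m)"
    unfolding eq using x[of "Suc m"] by (intro floor_unique) linarith+
  then have "\<lfloor>3 ^ Suc m * x 0\<rfloor> mod 3 = of_bool (b m)" by simp
  then show ?thesis by (simp add: x_def)
qed

lemma mu_D_prob_space: "prob_space (mu_D :: (real^'n) measure)"
proof
  have "emeasure lborel (cbox 0 (1 :: real^'n)) = 1"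
  proof -
    have "measure lborel (cbox 0 (1 :: real^'n)) = 1"
      by (subst content_cbox_cart) (auto simp: interval_ne_empty_cart)
    then show ?thesis
      using emeasure_eq_ennreal_measure[of lborel "cbox 0 (1 :: real^'n)"] emeasure_lborel_cbox_finite[of 0 "1 :: real^'n"] by simp
  qed
  then show "emeasure (mu_D :: (real^'n) measure) (space mu_D) = 1"
    unfolding mu_D_def unit_cube_def by (simp add: space_restrict_space emeasure_restrict_space)
qed

lemma measurable_mu_D: "f \<in> measurable borel N \<Longrightarrow> f \<in> measurable mu_D N"
  unfolding mu_D_def by (rule measurable_restrict_space1) simp

lemma measurable_mu_D_iff:
  "f \<in> M \<rightarrow>\<^sub>M (mu_D :: (real^'n) measure) \<longleftrightarrow> f \<in> borel_measurable M \<and> f \<in> space M \<rightarrow> unit_cube"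
  unfolding mu_D_def by (subst measurable_restrict_space2_iff) auto

text \<open>The cube enters only through one coordinate, which already has enough randomness for any law.\<close>

lemma mu_D_coordinate_uniform:
  "distr (mu_D :: (real^'n) measure) borel (\<lambda>x. x $ i) = distr (restrict_space lborel {0<..<1}) borel (\<lambda>x. x)"
proof (rule cdf_unique)
  interpret D: prob_space "mu_D :: (real^'n) measure" by (rule mu_D_prob_space)
  interpret I: prob_space "restrict_space lborel {0<..<1} :: real measure"
    by (auto simp add: emeasure_restrict_space space_restrict_space intro!: prob_spaceI)
  have m: "(\<lambda>x. x $ i) \<in> borel_measurable (mu_D :: (real^'n) measure)" by (rule measurable_mu_D) measurable
  have m': "(\<lambda>x. x) \<in> borel_measurable (restrict_space lborel {0<..<1} :: real measure)"
    by (rule measurable_restrict_space1) simp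
  show "real_distribution (distr (mu_D :: (real^'n) measure) borel (\<lambda>x. x $ i))" using m by simp
  show "real_distribution (distr (restrict_space lborel {0<..<1}) borel (\<lambda>x. x))" using m' by simp
  show "cdf (distr (mu_D :: (real^'n) measure) borel (\<lambda>x. x $ i)) = cdf (distr (restrict_space lborel {0<..<1}) borel (\<lambda>x. x))"
  proof
    fix a :: real
    define c where "c = max 0 (min 1 a)"
    have "cdf (distr (mu_D :: (real^'n) measure) borel (\<lambda>x. x $ i)) a = measure lborel {x \<in> unit_cube. (x :: real^'n) $ i \<le> a}"
      unfolding cdf_def using m
      by (subst measure_distr)
        (auto simp: mu_D_def space_restrict_space measure_restrict_space unit_cube_def intro!: arg_cong[where f = "measure lborel"])
    also have "\<dots> = c"
    proof (cases "a < 0")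
      case True
      have e: "{x \<in> unit_cube. (x :: real^'n) $ i \<le> a} = {}"
      proof (intro equals0I)
        fix x :: "real^'n" assume "x \<in> {x \<in> unit_cube. x $ i \<le> a}"
        then have "0 \<le> x $ i" "x $ i \<le> a" by (auto simp: unit_cube_def mem_box_cart)
        then show False using True by simp
      qed
      show ?thesis unfolding e using True by (simp add: c_def)
    next
      case False
      then have "0 \<le> c" "c \<le> 1" by (auto simp: c_def)
      have "{x \<in> unit_cube. (x :: real^'n) $ i \<le> a} = cbox 0 (\<chi> j. if j = i then c else 1)"
      proof (intro set_eqI iffI)
        fix x :: "real^'n" assume "x \<in> {x \<in> unit_cube. x $ i \<le> a}"
        then show "x \<in> cbox 0 (\<chi> j. if j = i then c else 1)"
          using False by (auto simp: unit_cube_def mem_box_cart c_def)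
      next
        fix x :: "real^'n" assume x: "x \<in> cbox 0 (\<chi> j. if j = i then c else 1)"
        then have x': "0 \<le> x $ j" "x $ j \<le> (if j = i then c else 1)" for j by (auto simp: mem_box_cart)
        have "x $ j \<le> 1" for j using x'(2)[of j] \<open>c \<le> 1\<close> by (cases "j = i") auto
        moreover have "x $ i \<le> a" using x'(2)[of i] False by (auto simp: c_def)
        ultimately show "x \<in> {x \<in> unit_cube. x $ i \<le> a}" using x'(1) by (auto simp: unit_cube_def mem_box_cart)
      qed
      then have "measure lborel {x \<in> unit_cube. (x :: real^'n) $ i \<le> a} =
          measure lborel (cbox 0 (\<chi> j. if j = i then c else 1) :: (real^'n) set)" by simp
      also have "\<dots> = (\<Prod>j\<in>UNIV. if j = i then c else 1)"
        using \<open>0 \<le> c\<close> by (subst content_cbox_cart) (auto simp: interval_ne_empty_cart)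
      also have "\<dots> = c" by simp
      finally show ?thesis .
    qed
    also have "c = measure lborel ({0<..<1} \<inter> {..a})"
    proof (cases "a < 1")
      case True
      then have "{0<..<1} \<inter> {..a} = {0<..a}" by auto
      then show ?thesis using True by (cases "0 \<le> a") (simp_all add: c_def)
    next
      case False
      then have "{0<..<1} \<inter> {..a} = {0<..<1}" by auto
      then show ?thesis using False by (auto simp: c_def)
    qed
    also have "\<dots> = cdf (distr (restrict_space lborel {0<..<1}) borel (\<lambda>x. x)) a"
      unfolding cdf_def using m'
      by (subst measure_distr)
        (auto simp: space_restrict_space measure_restrict_space intro!: arg_cong[where f = "measure lborel"])
    finally show "cdf (distr (mu_D :: (real^'n) measure) borel (\<lambda>x. x $ i)) a = cdf (distr (restrict_space lborel {0<..<1}) borel (\<lambda>x. x)) a" .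
  qed
qed

text \<open>The quantile function maps the uniform law to the given one.\<close>

lemma real_distribution_from_cube:
  assumes "real_distribution M"
  obtains Q :: "real^'n \<Rightarrow> real" where "Q \<in> borel_measurable mu_D" "distr mu_D borel Q = M"
proof -
  interpret cdf_distribution M using assms by (simp add: cdf_distribution_def)
  define q where "q u = (if u \<in> {0<..<1} then I u else 0)" for u
  have q: "q \<in> borel_measurable borel"
    unfolding q_def using measurable_CI
    by (subst (asm) measurable_restrict_space_iff[where c = 0]) auto
  have p: "(\<lambda>x. x $ i) \<in> borel_measurable (mu_D :: (real^'n) measure)" for i by (rule measurable_mu_D) measurable
  have m': "(\<lambda>x. x) \<in> borel_measurable (restrict_space lborel {0<..<1} :: real measure)"
    by (rule measurable_restrict_space1) simp
  fix i :: 'n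
  have "distr mu_D borel (q \<circ> (\<lambda>x :: real^'n. x $ i)) = distr (distr mu_D borel (\<lambda>x :: real^'n. x $ i)) borel q"
    by (rule distr_distr[symmetric, OF q p])
  also have "\<dots> = distr (restrict_space lborel {0<..<1}) borel (q \<circ> (\<lambda>x. x))"
    unfolding mu_D_coordinate_uniform by (rule distr_distr[OF q m'])
  also have "\<dots> = distr (restrict_space lborel {0<..<1}) borel I"
    by (rule distr_cong) (auto simp: q_def space_restrict_space)
  also have "\<dots> = M" by (rule distr_I_eq_M)
  finally show thesis using measurable_comp[OF p q] by (rule that[rotated])
qed

lemma enclosing_rationals_INF:
  fixes y :: real
  assumes "0 \<le> y"
  shows "(INF q\<in>(UNIV :: rat set). if y \<le> of_rat q then ennreal (of_rat q) else \<infinity>) = ennreal y"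
proof (rule antisym)
  show "ennreal y \<le> (INF q\<in>(UNIV :: rat set). if y \<le> of_rat q then ennreal (of_rat q) else \<infinity>)"
    by (rule INF_greatest) (auto intro: ennreal_leI)
  show "(INF q\<in>(UNIV :: rat set). if y \<le> of_rat q then ennreal (of_rat q) else \<infinity>) \<le> ennreal y"
  proof (rule ennreal_le_epsilon)
    fix e :: real assume "0 < e"
    then obtain q where q: "y < of_rat q" "of_rat q < y + e" using of_rat_dense[of y "y + e"] by auto
    have "(INF q\<in>(UNIV :: rat set). if y \<le> of_rat q then ennreal (of_rat q) else \<infinity>) \<le> ennreal (of_rat q)"
      by (rule INF_lower2[of q]) (use q in auto)
    also have "\<dots> \<le> ennreal (y + e)" using q by (intro ennreal_leI) simp
    also have "\<dots> = ennreal y + ennreal e" using assms \<open>0 < e\<close> by simp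
    finally show "(INF q\<in>(UNIV :: rat set). if y \<le> of_rat q then ennreal (of_rat q) else \<infinity>) \<le> ennreal y + ennreal e" .
  qed
qed

text \<open>The bit with index \<open>(j, i, q)\<close> tells whether the \<open>i\<close>-th coordinate of the \<open>j\<close>-th point is at most the
rational number \<open>q\<close>.\<close>

definition rational_bound :: "(nat \<Rightarrow> real^'n) \<Rightarrow> nat \<Rightarrow> bool" where
  "rational_bound w m = (case from_nat m of (j, i, q :: rat) \<Rightarrow> w j $ i \<le> of_rat q)"

definition cube_code :: "(nat \<Rightarrow> real^'n) \<Rightarrow> real" where
  "cube_code w = (\<Sum>m. of_bool (rational_bound w m) * (1 / 3) ^ Suc m)"

definition ternary_bit :: "real \<Rightarrow> nat \<Rightarrow> bool" where
  "ternary_bit u m \<longleftrightarrow> \<lfloor>3 ^ Suc m * u\<rfloor> mod 3 = 1"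

text \<open>A coordinate is the infimum of the rational numbers above it. The infimum is taken in the extended
nonnegative numbers, where it exists for every real code; coordinates of points of the cube are nonnegative.\<close>

definition cube_decode :: "real \<Rightarrow> nat \<Rightarrow> real^'n" where
  "cube_decode u j = (\<chi> i. enn2real
     (INF q\<in>(UNIV :: rat set). if ternary_bit u (to_nat (j, i, q)) then ennreal (of_rat q) else \<infinity>))"

lemma ternary_bit_cube_code: "ternary_bit (cube_code w) m \<longleftrightarrow> rational_bound w m"
  unfolding ternary_bit_def cube_code_def ternary_digit by simp

lemma cube_code_measurable:
  assumes [measurable]: "\<And>j. (\<lambda>x. f x j) \<in> borel_measurable M"
  shows "(\<lambda>x. cube_code (f x :: nat \<Rightarrow> real^'n)) \<in> borel_measurable M"
proof -
  have "Measurable.pred M (\<lambda>x. rational_bound (f x) m)" for m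
  proof -
    obtain j i q where m: "(from_nat m :: nat \<times> 'n \<times> rat) = (j, i, q)" by (metis prod_cases3)
    show ?thesis unfolding rational_bound_def m prod.case by measurable
  qed
  note [measurable] = this
  show ?thesis unfolding cube_code_def by measurable
qed

lemma cube_decode_measurable: "(\<lambda>u. cube_decode u j :: real^'n) \<in> borel_measurable borel"
proof -
  have [measurable]: "Measurable.pred borel (\<lambda>u. ternary_bit u m)" for m unfolding ternary_bit_def by measurable
  have "(\<lambda>u. enn2real (INF q\<in>(UNIV :: rat set). if ternary_bit u (to_nat (j, i, q)) then ennreal (of_rat q) else \<infinity>))
      \<in> borel_measurable borel" for i :: 'n by measurable
  then show ?thesis
    unfolding cube_decode_def by (subst borel_measurable_euclidean_space) (auto simp: Basis_vec_def inner_axis)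
qed

lemma cube_decode_code:
  fixes w :: "nat \<Rightarrow> real^'n"
  assumes w: "\<And>j. w j \<in> unit_cube"
  shows "cube_decode (cube_code w) = w"
proof
  fix j
  have "cube_decode (cube_code w) j $ i = w j $ i" for i
  proof -
    have "0 \<le> w j $ i" using w[of j] by (auto simp: unit_cube_def mem_box_cart)
    then show ?thesis
      by (simp only: cube_decode_def ternary_bit_cube_code rational_bound_def vec_lambda_beta from_nat_to_nat
          prod.case enclosing_rationals_INF enn2real_ennreal)
  qed
  then show "cube_decode (cube_code w) j = w j" by (simp add: vec_eq_iff)
qed

text \<open>Prescribed points of the cube at a dense sequence of times extend to a path exactly if they depend uniformly
continuously on time. This countable condition makes the set of codes of paths Borel.\<close>

lemma path_interpolation_iff:
  fixes w :: "nat \<Rightarrow> real^'n" and s :: "nat \<Rightarrow> real"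
  assumes s: "range s \<subseteq> {0..T}" "{0..T} \<subseteq> closure (range s)"
  shows "(\<exists>\<omega>\<in>topspace (path_topology T). \<forall>j. \<omega> (s j) = w j) \<longleftrightarrow>
    (\<forall>j. w j \<in> unit_cube) \<and> (\<forall>k::nat. \<exists>m::nat. \<forall>i j. dist (s i) (s j) < 1 / real (Suc m) \<longrightarrow>
        dist (w i) (w j) \<le> 1 / real (Suc k))" (is "?L \<longleftrightarrow> ?R")
proof
  have sT: "s j \<in> {0..T}" for j using s(1) by blast
  {
    assume ?L
    then obtain \<omega> where \<omega>: "\<omega> \<in> {0..T} \<rightarrow> unit_cube" "continuous_on {0..T} \<omega>" "\<And>j. \<omega> (s j) = w j"
      by (auto simp: topspace_path_topology)
    have uc: "uniformly_continuous_on {0..T} \<omega>"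
      using \<omega>(2) by (intro compact_uniformly_continuous) auto
    have "\<exists>m::nat. \<forall>i j. dist (s i) (s j) < 1 / real (Suc m) \<longrightarrow> dist (w i) (w j) \<le> 1 / real (Suc k)" for k :: nat
    proof -
      have k: "0 < 1 / real (Suc k)" by simp
      obtain \<delta> where \<delta>: "\<delta> > 0" "\<And>x x'. x \<in> {0..T} \<Longrightarrow> x' \<in> {0..T} \<Longrightarrow> dist x' x < \<delta> \<Longrightarrow> dist (\<omega> x') (\<omega> x) < 1 / real (Suc k)"
        by (rule uniformly_continuous_onE[OF uc k]) (rule that)
      obtain m where m: "1 / real (Suc m) < \<delta>"
        using reals_Archimedean[OF \<delta>(1)] by (auto simp: inverse_eq_divide)
      have "dist (w i) (w j) \<le> 1 / real (Suc k)" if "dist (s i) (s j) < 1 / real (Suc m)" for i j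
        using \<delta>(2)[OF sT sT less_trans[OF that m]] by (simp add: \<omega>(3))
      then show ?thesis by blast
    qed
    moreover have "w j \<in> unit_cube" for j using \<omega>(1) sT[of j] by (auto simp: Pi_iff \<omega>(3)[symmetric])
    ultimately show ?R by blast
  }
  assume R: ?R
  then have cube: "\<And>j. w j \<in> unit_cube" and mod: "\<And>k::nat. \<exists>m::nat. \<forall>i j. dist (s i) (s j) < 1 / real (Suc m) \<longrightarrow>
      dist (w i) (w j) \<le> 1 / real (Suc k)" by auto
  define \<phi> where "\<phi> t = w (inv s t)" for t
  have inv: "s (inv s (s j)) = s j" for j by (rule f_inv_into_f) simp
  have small: "\<exists>\<delta>>0. \<forall>i j. dist (s i) (s j) < \<delta> \<longrightarrow> dist (w i) (w j) < e" if e: "0 < e" for e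
  proof -
    obtain k where k: "1 / real (Suc k) < e" using reals_Archimedean[OF e] by (auto simp: inverse_eq_divide)
    obtain m where m: "\<forall>i j. dist (s i) (s j) < 1 / real (Suc m) \<longrightarrow> dist (w i) (w j) \<le> 1 / real (Suc k)"
      using mod by blast
    have "dist (w i) (w j) < e" if "dist (s i) (s j) < 1 / real (Suc m)" for i j
      using m[rule_format, OF that] k by linarith
    then show ?thesis by (intro exI[of _ "1 / real (Suc m)"]) simp
  qed
  have eqw: "w i = w j" if ij: "s i = s j" for i j
  proof (rule ccontr)
    assume "w i \<noteq> w j"
    then obtain \<delta> where \<delta>: "\<delta> > 0" "\<forall>i' j'. dist (s i') (s j') < \<delta> \<longrightarrow> dist (w i') (w j') < dist (w i) (w j)"
      using small[of "dist (w i) (w j)"] by auto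
    have "dist (w i) (w j) < dist (w i) (w j)" using \<delta>(2)[rule_format, of i j] \<delta>(1) ij by simp
    then show False by simp
  qed
  have \<phi>: "\<phi> (s j) = w j" for j unfolding \<phi>_def using eqw[OF inv] .
  have "uniformly_continuous_on (range s) \<phi>"
    unfolding uniformly_continuous_on_def
  proof (intro allI impI)
    fix e :: real assume "0 < e"
    then obtain \<delta> where "\<delta> > 0" "\<forall>i j. dist (s i) (s j) < \<delta> \<longrightarrow> dist (w i) (w j) < e" using small by blast
    then show "\<exists>d>0. \<forall>x\<in>range s. \<forall>x'\<in>range s. dist x' x < d \<longrightarrow> dist (\<phi> x') (\<phi> x) < e"
      by (intro exI[of _ \<delta>]) (auto simp: \<phi>)
  qed
  note uc = this
  obtain g where g: "uniformly_continuous_on (closure (range s)) g" "\<And>x. x \<in> range s \<Longrightarrow> \<phi> x = g x"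
    by (rule uniformly_continuous_on_extension_on_closure[OF uc]) (rule that)
  have cg: "continuous_on {0..T} g"
    using uniformly_continuous_imp_continuous[OF g(1)] s(2) by (rule continuous_on_subset)
  have gw: "g (s j) = w j" for j using g(2)[of "s j"] \<phi>[of j] by simp
  have "g t \<in> unit_cube" if t: "t \<in> {0..T}" for t
  proof -
    have "g ` closure (range s) \<subseteq> unit_cube"
    proof (rule image_closure_subset[OF uniformly_continuous_imp_continuous[OF g(1)]])
      show "closed (unit_cube :: (real^'n) set)" unfolding unit_cube_def by (rule closed_cbox)
      show "g ` range s \<subseteq> unit_cube" using cube gw by auto
    qed
    then show ?thesis using t s(2) by blast
  qed
  then have "restrict g {0..T} \<in> topspace (path_topology T)"
    using continuous_on_eq[OF cg, of "restrict g {0..T}"] by (auto simp: topspace_path_topology)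
  moreover have "\<forall>j. restrict g {0..T} (s j) = w j" using sT gw by simp
  ultimately show ?L by blast
qed

text \<open>The decoder \<open>P\<close>, extended by a constant path to codes that come from no path, is a left inverse of the code \<open>X\<close>.
Hence \<open>\<eta>\<close> is the image under \<open>P\<close> of the law of \<open>X\<close>, which is the law of a function on the cube.\<close>

theorem path_measure_represented_on_cube:
  fixes \<eta> :: "(real \<Rightarrow> real^'n) measure"
  assumes T: "0 < T" and \<eta>: "prob_space \<eta>" "sets \<eta> = sets (path_borel T)"
  obtains G :: "real^'n \<Rightarrow> real \<Rightarrow> real^'n"
  where "G \<in> mu_D \<rightarrow>\<^sub>M path_borel T" "distr mu_D (path_borel T) G = \<eta>"
proof -
  let ?P = "path_borel T :: (real \<Rightarrow> real^'n) measure"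
  let ?\<Omega> = "topspace (path_topology T) :: (real \<Rightarrow> real^'n) set"
  obtain s :: "nat \<Rightarrow> real" where s: "range s \<subseteq> {0..T}" "{0..T} \<subseteq> closure (range s)"
    by (rule countable_dense_times[OF T])
  have sT: "s j \<in> {0..T}" for j using s(1) by blast
  note [measurable] = cube_decode_measurable
  define X where "X \<omega> = cube_code (\<lambda>j. \<omega> (s j))" for \<omega> :: "real \<Rightarrow> real^'n"
  have X: "X \<in> borel_measurable ?P"
    unfolding X_def by (rule cube_code_measurable) (rule eval_measurable[OF sT])
  define E where "E = {u. \<exists>\<omega>\<in>?\<Omega>. \<forall>j. \<omega> (s j) = cube_decode u j}"
  have "unit_cube \<in> sets (borel :: (real^'n) measure)" by (simp add: unit_cube_def)
  note [measurable] = this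
  have E: "E \<in> sets borel"
    unfolding E_def path_interpolation_iff[OF s] by measurable
  define P where "P u = (if u \<in> E then SOME \<omega>. \<omega> \<in> ?\<Omega> \<and> (\<forall>j. \<omega> (s j) = cube_decode u j)
      else restrict (\<lambda>_. 0) {0..T})" for u
  have P_E: "P u \<in> ?\<Omega>" "P u (s j) = cube_decode u j" if "u \<in> E" for u j
  proof -
    have "\<exists>\<omega>. \<omega> \<in> ?\<Omega> \<and> (\<forall>j. \<omega> (s j) = cube_decode u j)" using that by (auto simp: E_def)
    from someI_ex[OF this] show "P u \<in> ?\<Omega>" "P u (s j) = cube_decode u j" using that by (simp_all add: P_def)
  qed
  have P_notE: "P u = restrict (\<lambda>_. 0) {0..T}" if "u \<notin> E" for u using that by (simp add: P_def)
  have "continuous_on {0..T} (restrict (\<lambda>_. 0 :: real^'n) {0..T})"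
    by (rule continuous_on_eq[OF continuous_on_const]) auto
  then have "restrict (\<lambda>_. 0) {0..T} \<in> ?\<Omega>"
    by (auto simp: topspace_path_topology unit_cube_def mem_box_cart)
  then have P_in: "P u \<in> ?\<Omega>" for u using P_E(1) P_notE by (cases "u \<in> E") auto
  have P: "P \<in> borel \<rightarrow>\<^sub>M ?P"
  proof (rule measurable_into_path_borel[OF _ _ s])
    fix t assume "t \<in> range s"
    then obtain j where j: "t = s j" by blast
    have "(\<lambda>u. P u t) = (\<lambda>u. if u \<in> E then cube_decode u j else 0)"
      using P_E(2) P_notE sT by (auto simp: j)
    then show "(\<lambda>u. P u t) \<in> borel_measurable borel" using E by simp
  qed (use T P_in in auto)
  have PX: "P (X \<omega>) = \<omega>" if \<omega>: "\<omega> \<in> ?\<Omega>" for \<omega>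
  proof -
    have "\<omega> (s j) \<in> unit_cube" for j using \<omega> sT[of j] by (auto simp: topspace_path_topology Pi_iff)
    then have dX: "cube_decode (X \<omega>) = (\<lambda>j. \<omega> (s j))" unfolding X_def by (rule cube_decode_code)
    then have "X \<omega> \<in> E" using \<omega> by (auto simp: E_def)
    then have PX: "P (X \<omega>) \<in> ?\<Omega>" "\<And>j. P (X \<omega>) (s j) = \<omega> (s j)" using P_E dX by auto
    show ?thesis
    proof (rule extensionalityI)
      show "P (X \<omega>) \<in> extensional {0..T}" "\<omega> \<in> extensional {0..T}"
        using PX(1) \<omega> by (auto simp: topspace_path_topology)
      have cont: "continuous_on {0..T} (P (X \<omega>))" "continuous_on {0..T} \<omega>"
        using PX(1) \<omega> by (auto simp: topspace_path_topology)
      fix t assume t: "t \<in> {0..T}"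
      have "dist (P (X \<omega>) t) (\<omega> t) \<le> 0"
        by (rule dense_dist_le[OF cont s _ t]) (use PX(2) in auto)
      then show "P (X \<omega>) t = \<omega> t" by simp
    qed
  qed
  interpret prob_space \<eta> by fact
  have X': "X \<in> borel_measurable \<eta>" using X measurable_cong_sets[OF \<eta>(2) refl] by blast
  have "real_distribution (distr \<eta> borel X)" using X' by simp
  then obtain Q :: "real^'n \<Rightarrow> real" where Q: "Q \<in> borel_measurable mu_D" "distr mu_D borel Q = distr \<eta> borel X"
    by (rule real_distribution_from_cube)
  show thesis
  proof (rule that)
    show "P \<circ> Q \<in> mu_D \<rightarrow>\<^sub>M ?P" by (rule measurable_comp[OF Q(1) P])
    have "distr mu_D ?P (P \<circ> Q) = distr (distr mu_D borel Q) ?P P" by (rule distr_distr[symmetric, OF P Q(1)])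
    also have "\<dots> = distr \<eta> ?P (P \<circ> X)" unfolding Q(2) by (rule distr_distr[OF P X'])
    also have "\<dots> = distr \<eta> \<eta> (\<lambda>\<omega>. \<omega>)"
    proof (rule distr_cong)
      fix \<omega> assume "\<omega> \<in> space \<eta>"
      then have "\<omega> \<in> ?\<Omega>" using sets_eq_imp_space_eq[OF \<eta>(2)] by (simp add: space_path_borel)
      then show "(P \<circ> X) \<omega> = \<omega>" by (simp add: PX)
    qed (use \<eta>(2) in auto)
    also have "\<dots> = \<eta>" by (rule distr_id)
    finally show "distr mu_D ?P (P \<circ> Q) = \<eta>" .
  qed
qed

section \<open>Weak derivatives in time\<close>

lemma has_derivative_max0_square:
  "((\<lambda>t. (max 0 t)\<^sup>2) has_real_derivative 2 * max 0 x) (at (x::real))"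
  unfolding has_field_derivative_def has_derivative_at_alt
proof (intro conjI allI impI)
  show "bounded_linear ((*) (2 * max 0 x))" by (rule bounded_linear_mult_right)
  fix e :: real assume "0 < e"
  have quad: "\<bar>(max 0 y)\<^sup>2 - (max 0 x)\<^sup>2 - 2 * max 0 x * (y - x)\<bar> \<le> (y - x)\<^sup>2" for y
  proof -
    consider "0 \<le> x" "0 \<le> y" | "0 \<le> x" "y < 0" | "x < 0" "0 \<le> y" | "x < 0" "y < 0" by linarith
    then show ?thesis
    proof cases
      case 1
      then have "(max 0 y)\<^sup>2 - (max 0 x)\<^sup>2 - 2 * max 0 x * (y - x) = (y - x)\<^sup>2"
        by (simp add: power2_eq_square algebra_simps)
      then show ?thesis by simp
    next
      case 2
      then have "(max 0 y)\<^sup>2 - (max 0 x)\<^sup>2 - 2 * max 0 x * (y - x) = x\<^sup>2 - 2 * (x * y)"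
        by (simp add: power2_eq_square algebra_simps)
      moreover have "x * y \<le> 0" using 2 by (simp add: mult_nonneg_nonpos)
      moreover have "(y - x)\<^sup>2 = y\<^sup>2 + x\<^sup>2 - 2 * (x * y)" by (simp add: power2_eq_square algebra_simps)
      ultimately show ?thesis using zero_le_power2[of x] zero_le_power2[of y] by linarith
    next
      case 3
      then have "y\<^sup>2 \<le> (y - x)\<^sup>2" by (intro power_mono) auto
      then show ?thesis using 3 by simp
    qed simp
  qed
  show "\<exists>d>0. \<forall>y. norm (y - x) < d \<longrightarrow>
      norm ((max 0 y)\<^sup>2 - (max 0 x)\<^sup>2 - 2 * max 0 x * (y - x)) \<le> e * norm (y - x)"
  proof (intro exI[of _ e] conjI allI impI)
    fix y assume "norm (y - x) < e"
    then have "(y - x)\<^sup>2 \<le> e * \<bar>y - x\<bar>"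
      using mult_right_mono[of "\<bar>y - x\<bar>" e "\<bar>y - x\<bar>"] by (simp add: power2_eq_square)
    then show "norm ((max 0 y)\<^sup>2 - (max 0 x)\<^sup>2 - 2 * max 0 x * (y - x)) \<le> e * norm (y - x)"
      using quad[of y] by simp
  qed fact
qed

text \<open>Test functions of class \<open>C\<^sup>1\<close> supported in \<open>[a,b]\<close> that increase to the indicator of the open interval. They
have the form \<open>n p / (1 + n p)\<close> with \<open>p = ((t - a)\<^sup>+ (b - t)\<^sup>+)\<^sup>2\<close>.\<close>

definition bump :: "real \<Rightarrow> real \<Rightarrow> nat \<Rightarrow> real \<Rightarrow> real" where
  "bump a b n t = 1 - 1 / (1 + real n * ((max 0 (t - a))\<^sup>2 * (max 0 (b - t))\<^sup>2))"

lemma bump_denominator_pos: "0 < 1 + real n * ((max 0 (t - a))\<^sup>2 * (max 0 (b - t))\<^sup>2)"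
  by (intro add_pos_nonneg) auto

lemma bump_bounded: "0 \<le> bump a b n t" "bump a b n t \<le> 1"
  using bump_denominator_pos[of n t a b] by (auto simp: bump_def divide_le_eq_1)

lemma bump_outside: "t \<notin> {a<..<b} \<Longrightarrow> bump a b n t = 0"
  by (auto simp: bump_def not_less max_def)

lemma bump_derivative:
  obtains \<psi> where "\<And>t. (bump a b n has_real_derivative \<psi> t) (at t)" "continuous_on UNIV \<psi>"
proof
  let ?D = "\<lambda>t. 1 + real n * ((max 0 (t - a))\<^sup>2 * (max 0 (b - t))\<^sup>2)"
  let ?N = "\<lambda>t. real n * (2 * max 0 (t - a) * (max 0 (b - t))\<^sup>2 - (max 0 (t - a))\<^sup>2 * (2 * max 0 (b - t)))"
  have D: "?D t \<noteq> 0" for t using bump_denominator_pos[of n t a b] by simp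
  show "(bump a b n has_real_derivative ?N t / (?D t * ?D t)) (at t)" for t
  proof -
    have 1: "((\<lambda>t. (max 0 (t - a))\<^sup>2) has_real_derivative 2 * max 0 (t - a) * 1) (at t)"
      by (rule DERIV_chain2[OF has_derivative_max0_square]) (auto intro!: derivative_eq_intros)
    have 2: "((\<lambda>t. (max 0 (b - t))\<^sup>2) has_real_derivative 2 * max 0 (b - t) * (-1)) (at t)"
      by (rule DERIV_chain2[OF has_derivative_max0_square]) (auto intro!: derivative_eq_intros)
    have 3: "(?D has_real_derivative ?N t) (at t)"
      by (rule DERIV_cong[OF DERIV_add[OF DERIV_const DERIV_cmult[OF DERIV_mult[OF 1 2]]]])
        (simp add: algebra_simps)
    have "((\<lambda>t. 1 - 1 / ?D t) has_real_derivative ?N t / (?D t * ?D t)) (at t)"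
      by (rule DERIV_cong[OF DERIV_diff[OF DERIV_const DERIV_divide[OF DERIV_const 3 D]]]) simp
    then show ?thesis by (simp add: bump_def[abs_def])
  qed
  show "continuous_on UNIV (\<lambda>t. ?N t / (?D t * ?D t))"
    by (intro continuous_intros) (use D in auto)
qed

lemma bump_LIMSEQ: "(\<lambda>n. bump a b n t) \<longlonglongrightarrow> indicator {a<..<b} t"
proof (cases "t \<in> {a<..<b}")
  case True
  define p where "p = (max 0 (t - a))\<^sup>2 * (max 0 (b - t))\<^sup>2"
  have p: "0 < p" using True by (simp add: p_def)
  have "filterlim (\<lambda>n. real n * p) at_top sequentially"
    using p by (intro filterlim_at_top_mult_tendsto_pos[OF tendsto_const _ filterlim_real_sequentially])
  then have "filterlim (\<lambda>n. 1 + real n * p) at_top sequentially"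
    by (intro filterlim_tendsto_add_at_top[OF tendsto_const])
  then have "(\<lambda>n. 1 / (1 + real n * p)) \<longlonglongrightarrow> 0"
    by (intro real_tendsto_divide_at_top[OF tendsto_const])
  then have "(\<lambda>n. 1 - 1 / (1 + real n * p)) \<longlonglongrightarrow> 1 - 0" by (intro tendsto_diff tendsto_const)
  then show ?thesis using True by (simp add: bump_def p_def)
next
  case False
  then show ?thesis by (simp add: bump_outside)
qed

text \<open>In the limit the integrals over all intervals with rational end points vanish, and so does \<open>w\<close> at each of
its Lebesgue points. Countably many test functions suffice; this matters because a weak derivative satisfies
its equation outside a null set that depends on the test function.\<close>

lemma zero_if_bump_integrals_zero:
  fixes w :: "real \<Rightarrow> real^'n"
  assumes w: "integrable (time_measure T) w"
    and zero: "\<And>(q :: rat) (r :: rat) n. 0 < q \<Longrightarrow> q < r \<Longrightarrow> of_rat r < T \<Longrightarrow>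
      (\<integral>t. bump (of_rat q) (of_rat r) n t *\<^sub>R w t \<partial>time_measure T) = 0"
  shows "AE t in time_measure T. w t = 0"
proof -
  define h where "h t = indicator {0..T} t *\<^sub>R w t" for t
  have h: "integrable lborel h"
    using w unfolding h_def time_measure_def by (subst (asm) integrable_restrict_space) auto
  have [measurable]: "h \<in> borel_measurable borel" using h by auto
  have bm: "bump a b n \<in> borel_measurable borel" for a b n unfolding bump_def[abs_def] by measurable
  have int0: "(LINT u:{of_rat q..of_rat r}|lborel. h u) = 0" if "0 < q" "q < r" "of_rat r < T" for q r :: rat
  proof -
    let ?a = "of_rat q :: real" and ?b = "of_rat r :: real"
    have ab: "0 < ?a" "?a < ?b" using that by (simp_all add: of_rat_less)
    have "(\<lambda>n. \<integral>t. bump ?a ?b n t *\<^sub>R h t \<partial>lborel) \<longlonglongrightarrow> (\<integral>t. indicator {?a<..<?b} t *\<^sub>R h t \<partial>lborel)"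
    proof (rule integral_dominated_convergence[where w = "\<lambda>t. norm (h t)"])
      show "integrable lborel (\<lambda>t. norm (h t))" using h by simp
      show "AE t in lborel. (\<lambda>n. bump ?a ?b n t *\<^sub>R h t) \<longlonglongrightarrow> indicator {?a<..<?b} t *\<^sub>R h t"
        by (intro AE_I2 tendsto_scaleR bump_LIMSEQ tendsto_const)
      show "AE t in lborel. norm (bump ?a ?b n t *\<^sub>R h t) \<le> norm (h t)" for n
        using bump_bounded[of ?a ?b n] by (intro AE_I2) (simp add: mult_left_le_one_le)
    qed (use bm in measurable)
    moreover have "(\<integral>t. bump ?a ?b n t *\<^sub>R h t \<partial>lborel) = 0" for n
    proof -
      have "(\<integral>t. bump ?a ?b n t *\<^sub>R h t \<partial>lborel) = (\<integral>t. indicator {0..T} t *\<^sub>R (bump ?a ?b n t *\<^sub>R w t) \<partial>lborel)"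
        by (simp add: h_def ac_simps)
      also have "\<dots> = (\<integral>t. bump ?a ?b n t *\<^sub>R w t \<partial>time_measure T)"
        unfolding time_measure_def by (subst integral_restrict_space) auto
      finally show ?thesis using zero[OF that] by simp
    qed
    ultimately have "(\<lambda>n :: nat. 0) \<longlonglongrightarrow> (\<integral>t. indicator {?a<..<?b} t *\<^sub>R h t \<partial>lborel)" by simp
    then have "(\<integral>t. indicator {?a<..<?b} t *\<^sub>R h t \<partial>lborel) = 0"
      by (rule LIMSEQ_unique[OF _ tendsto_const])
    also have "(\<integral>t. indicator {?a<..<?b} t *\<^sub>R h t \<partial>lborel) = (LINT u:{?a..?b}|lborel. h u)"
      unfolding set_lebesgue_integral_def
    proof (rule integral_cong_AE)
      show "AE t in lborel. indicator {?a<..<?b} t *\<^sub>R h t = indicator {?a..?b} t *\<^sub>R h t"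
        using AE_lborel_singleton[of ?a] AE_lborel_singleton[of ?b]
        by eventually_elim (auto split: split_indicator)
    qed measurable
    finally show ?thesis .
  qed
  have "AE t in lborel. 0 < t \<and> t < T \<longrightarrow> h t = 0"
    using AE_Lebesgue_point_vec[OF h]
  proof eventually_elim
    case (elim t)
    show ?case
    proof (rule impI, rule ccontr)
      assume t: "0 < t \<and> t < T" and "h t \<noteq> 0"
      then have "0 < norm (h t) / 2" by simp
      then obtain d where d: "d > 0" "\<And>a b. a \<le> t \<and> t \<le> b \<and> b - a < d \<Longrightarrow>
           norm ((LINT u:{a..b}|lborel. h u) - (b - a) *\<^sub>R h t) \<le> norm (h t) / 2 * (b - a)"
        using elim by blast
      obtain q :: rat where q: "max 0 (t - d / 2) < of_rat q" "of_rat q < t"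
        using of_rat_dense[of "max 0 (t - d / 2)" t] t d(1) by auto
      obtain r :: rat where r: "t < of_rat r" "of_rat r < min T (t + d / 2)"
        using of_rat_dense[of t "min T (t + d / 2)"] t d(1) by auto
      have "(0 :: real) < of_rat q" "(of_rat q :: real) < of_rat r" "of_rat r < T" using q r by auto
      then have "(LINT u:{of_rat q..of_rat r}|lborel. h u) = 0" by (intro int0) (auto simp: of_rat_less)
      moreover have "of_rat q \<le> t \<and> t \<le> of_rat r \<and> of_rat r - of_rat q < d" using q r by auto
      ultimately have "norm ((of_rat r - of_rat q) *\<^sub>R h t) \<le> norm (h t) / 2 * (of_rat r - of_rat q)"
        using d(2)[of "of_rat q" "of_rat r"] by simp
      moreover define c :: real where "c = of_rat r - of_rat q"
      moreover have "0 < c" using q r by (simp add: c_def)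
      ultimately have "c * norm (h t) \<le> c * norm (h t) / 2" by (simp add: mult.commute)
      moreover have "0 < c * norm (h t)" using \<open>0 < c\<close> \<open>h t \<noteq> 0\<close> by simp
      ultimately show False by linarith
    qed
  qed
  then show ?thesis unfolding AE_time_measure by eventually_elim (auto simp: h_def)
qed

text \<open>Write the path as \<open>\<omega> 0\<close> plus the integral of its velocity and exchange the order of integration.\<close>

lemma path_integration_by_parts:
  fixes \<omega> :: "real \<Rightarrow> real^'n"
  assumes T: "0 < T" and \<omega>: "\<omega> \<in> topspace (path_topology T)" and ac: "abs_continuous_path T \<omega>"
    and \<phi>: "\<And>t. (\<phi> has_real_derivative \<psi> t) (at t)" "continuous_on UNIV \<psi>" "\<phi> 0 = 0" "\<phi> T = 0"
  shows "(\<integral>t. \<psi> t *\<^sub>R \<omega> t \<partial>time_measure T) = - (\<integral>t. \<phi> t *\<^sub>R right_velocity T \<omega> t \<partial>time_measure T)"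
proof -
  let ?M = "time_measure T"
  define v where "v = right_velocity T \<omega>"
  interpret finite_measure ?M by (rule finite_measure_time_measure)
  interpret P: pair_sigma_finite ?M ?M ..
  have space: "space ?M = {0..T}" by (simp add: time_measure_def space_restrict_space)
  have set_int: "(\<integral>t. f t \<partial>?M) = (LINT t:{0..T}|lborel. f t)" for f :: "real \<Rightarrow> real^'n"
    unfolding time_measure_def set_lebesgue_integral_def by (subst integral_restrict_space) auto
  have v: "integrable ?M v"
    using abs_continuous_path_velocity(2)[OF T \<omega> ac] unfolding v_def time_measure_def set_integrable_def
    by (subst integrable_restrict_space) auto
  have incr: "(\<integral>u. indicator {0..t} u *\<^sub>R v u \<partial>?M) = \<omega> t - \<omega> 0" if "t \<in> {0..T}" for t
  proof -
    have "(\<integral>u. indicator {0..t} u *\<^sub>R v u \<partial>?M) = (LINT u:{0..t}|lborel. v u)"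
      unfolding set_int set_lebesgue_integral_def
      using that by (intro Bochner_Integration.integral_cong) (auto split: split_indicator)
    then show ?thesis using abs_continuous_path_velocity(3)[OF T \<omega> ac, of 0 t] that by (simp add: v_def)
  qed
  have [measurable]: "\<psi> \<in> borel_measurable borel" using \<phi>(2) by (rule borel_measurable_continuous_onI)
  have "compact (\<psi> ` {0..T})"
    using \<phi>(2) by (intro compact_continuous_image) (auto intro: continuous_on_subset)
  then obtain C where C: "\<And>t. t \<in> {0..T} \<Longrightarrow> \<bar>\<psi> t\<bar> \<le> C"
    using compact_imp_bounded bounded_iff by (metis imageI real_norm_def)
  have \<psi>int: "(LINT t:{u..T}|lborel. \<psi> t) = \<phi> T - \<phi> u" if "u \<le> T" for u
    unfolding set_lebesgue_integral_def
  proof (rule integral_FTC_atLeastAtMost[OF that])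
    show "(\<phi> has_vector_derivative \<psi> t) (at t within {u..T})" for t
      using \<phi>(1)[of t] has_real_derivative_iff_has_vector_derivative has_vector_derivative_at_within by blast
    show "continuous_on {u..T} \<psi>" using \<phi>(2) by (rule continuous_on_subset) simp
  qed
  have [measurable]: "v \<in> borel_measurable ?M" using v by auto
  have idm: "(\<lambda>t. t) \<in> borel_measurable ?M" by (rule measurable_time_measure) simp
  have \<psi>m: "\<psi> \<in> borel_measurable ?M" by (rule measurable_time_measure) measurable
  have \<psi>i: "integrable ?M (\<lambda>t. \<psi> t)"
    by (rule integrable_const_bound[of _ C]) (use C \<psi>m in \<open>auto simp: space\<close>)
  have [measurable]: "(\<lambda>p. fst p) \<in> borel_measurable (?M \<Otimes>\<^sub>M ?M)" "(\<lambda>p. snd p) \<in> borel_measurable (?M \<Otimes>\<^sub>M ?M)"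
      "(\<lambda>p. \<psi> (fst p)) \<in> borel_measurable (?M \<Otimes>\<^sub>M ?M)" "(\<lambda>p. v (snd p)) \<in> borel_measurable (?M \<Otimes>\<^sub>M ?M)"
    using measurable_compose[OF measurable_fst idm] measurable_compose[OF measurable_snd idm]
      measurable_compose[OF measurable_fst \<psi>m] measurable_compose[OF measurable_snd \<open>v \<in> borel_measurable ?M\<close>]
    by auto
  define f where "f t u = (if u \<le> t then \<psi> t *\<^sub>R v u else 0)" for t u
  have fm: "case_prod f \<in> borel_measurable (?M \<Otimes>\<^sub>M ?M)"
    unfolding f_def split_beta' by measurable
  have f_ind: "f t u = \<psi> t *\<^sub>R (indicator {0..t} u *\<^sub>R v u)" if "u \<in> {0..T}" for t u
    using that by (auto simp: f_def split: split_indicator)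
  have f_bound: "norm (f t u) \<le> C * norm (v u)" if "t \<in> {0..T}" for t u
    using C[OF that] by (auto simp: f_def intro: mult_right_mono mult_nonneg_nonneg order_trans[OF abs_ge_zero])
  have fi: "integrable ?M (f t)" if t: "t \<in> {0..T}" for t
  proof (rule Bochner_Integration.integrable_bound[of _ "\<lambda>u. C * norm (v u)"])
    show "f t \<in> borel_measurable ?M" unfolding f_def using idm by measurable
  qed (use v f_bound[OF t] in \<open>auto intro!: order_trans[OF _ abs_ge_self]\<close>)
  have inner: "(\<integral>u. f t u \<partial>?M) = \<psi> t *\<^sub>R (\<omega> t - \<omega> 0)" if "t \<in> {0..T}" for t
  proof -
    have "(\<integral>u. f t u \<partial>?M) = (\<integral>u. \<psi> t *\<^sub>R (indicator {0..t} u *\<^sub>R v u) \<partial>?M)"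
      by (rule Bochner_Integration.integral_cong) (auto simp: f_ind space)
    also have "\<dots> = \<psi> t *\<^sub>R (\<omega> t - \<omega> 0)" unfolding integral_scaleR_right incr[OF that] ..
    finally show ?thesis .
  qed
  have prod: "integrable (?M \<Otimes>\<^sub>M ?M) (case_prod f)"
  proof (rule P.Fubini_integrable[OF fm])
    show "AE t in ?M. integrable ?M (\<lambda>u. case_prod f (t, u))"
      using fi by (intro AE_I2) (simp add: space)
    show "integrable ?M (\<lambda>t. \<integral>u. norm (case_prod f (t, u)) \<partial>?M)"
    proof (rule integrable_const_bound[of _ "\<integral>u. C * norm (v u) \<partial>?M"])
      show "AE t in ?M. norm (\<integral>u. norm (case_prod f (t, u)) \<partial>?M) \<le> (\<integral>u. C * norm (v u) \<partial>?M)"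
      proof (rule AE_I2)
        fix t assume "t \<in> space ?M"
        then have t: "t \<in> {0..T}" by (simp add: space)
        have "(\<integral>u. norm (f t u) \<partial>?M) \<le> (\<integral>u. C * norm (v u) \<partial>?M)"
          using v fi[OF t] f_bound[OF t] by (intro integral_mono) auto
        then show "norm (\<integral>u. norm (case_prod f (t, u)) \<partial>?M) \<le> (\<integral>u. C * norm (v u) \<partial>?M)" by simp
      qed
      show "(\<lambda>t. \<integral>u. norm (case_prod f (t, u)) \<partial>?M) \<in> borel_measurable ?M"
        using fm by measurable
    qed
  qed
  have swap: "(\<integral>t. (\<integral>u. f t u \<partial>?M) \<partial>?M) = (\<integral>u. (\<integral>t. f t u \<partial>?M) \<partial>?M)"
    by (rule P.Fubini_integral[OF prod, symmetric])
  have outer: "(\<integral>t. f t u \<partial>?M) = - (\<phi> u *\<^sub>R v u)" if u: "u \<in> {0..T}" for u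
  proof -
    have "(\<integral>t. f t u \<partial>?M) = (\<integral>t. (indicator {u..T} t * \<psi> t) *\<^sub>R v u \<partial>?M)"
      by (rule Bochner_Integration.integral_cong) (auto simp: f_def space split: split_indicator)
    also have "\<dots> = (\<integral>t. indicator {u..T} t * \<psi> t \<partial>?M) *\<^sub>R v u"
    proof (rule integral_scaleR_left)
      have "{u..T} \<in> sets ?M" using u by (auto simp: time_measure_def sets_restrict_space_iff)
      from integrable_mult_indicator[OF this \<psi>i]
      show "integrable ?M (\<lambda>t. indicator {u..T} t * \<psi> t)" by simp
    qed
    also have "(\<integral>t. indicator {u..T} t * \<psi> t \<partial>?M) = (LINT t:{u..T}|lborel. \<psi> t)"
      unfolding time_measure_def set_lebesgue_integral_def using u
      by (subst integral_restrict_space)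
        (auto intro!: Bochner_Integration.integral_cong split: split_indicator)
    also have "\<dots> = - \<phi> u" using \<psi>int[of u] u \<phi>(4) by simp
    finally show ?thesis by simp
  qed
  have "integrable ?M (\<lambda>t. \<integral>u. f t u \<partial>?M)" using P.integrable_fst'[OF prod] by simp
  then have i1: "integrable ?M (\<lambda>t. \<psi> t *\<^sub>R (\<omega> t - \<omega> 0))"
    by (rule Bochner_Integration.integrable_cong[THEN iffD1, rotated 2]) (auto simp: inner space)
  have \<psi>0: "(\<integral>t. \<psi> t \<partial>?M) = 0"
    using \<psi>int[of 0] T \<phi>(3,4) unfolding time_measure_def set_lebesgue_integral_def
    by (subst integral_restrict_space) auto
  have "(\<integral>t. \<psi> t *\<^sub>R \<omega> t \<partial>?M) = (\<integral>t. \<psi> t *\<^sub>R (\<omega> t - \<omega> 0) + \<psi> t *\<^sub>R \<omega> 0 \<partial>?M)"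
    by (simp add: algebra_simps)
  also have "\<dots> = (\<integral>t. \<psi> t *\<^sub>R (\<omega> t - \<omega> 0) \<partial>?M) + (\<integral>t. \<psi> t *\<^sub>R \<omega> 0 \<partial>?M)"
    using i1 \<psi>i by (intro Bochner_Integration.integral_add) auto
  also have "\<dots> = (\<integral>t. \<psi> t *\<^sub>R (\<omega> t - \<omega> 0) \<partial>?M)" using \<psi>i \<psi>0 by simp
  also have "\<dots> = (\<integral>t. (\<integral>u. f t u \<partial>?M) \<partial>?M)"
    by (rule Bochner_Integration.integral_cong) (auto simp: inner space)
  also have "\<dots> = (\<integral>u. - (\<phi> u *\<^sub>R v u) \<partial>?M)"
    unfolding swap by (rule Bochner_Integration.integral_cong) (auto simp: outer space)
  finally show ?thesis by (simp add: v_def)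
qed

section \<open>The flow given by a random path\<close>

lemma integrable_if_square_integrable:
  fixes f :: "'a \<Rightarrow> real^'n"
  assumes "finite_measure M" "f \<in> borel_measurable M" "(\<integral>\<^sup>+x. ennreal ((norm (f x))\<^sup>2) \<partial>M) < \<infinity>"
  shows "integrable M f"
proof (rule integrableI_bounded[OF assms(2)])
  have "(\<integral>\<^sup>+x. ennreal (norm (f x)) \<partial>M) \<le> (\<integral>\<^sup>+x. 1 + ennreal ((norm (f x))\<^sup>2) \<partial>M)"
  proof (rule nn_integral_mono)
    fix x
    have "norm (f x) \<le> 1 + (norm (f x))\<^sup>2"
    proof -
      have "0 \<le> (norm (f x) - 1)\<^sup>2" by simp
      also have "\<dots> = (norm (f x))\<^sup>2 - 2 * norm (f x) + 1" by (simp add: power2_eq_square algebra_simps)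
      finally show ?thesis using norm_ge_zero[of "f x"] by linarith
    qed
    then have "ennreal (norm (f x)) \<le> ennreal (1 + (norm (f x))\<^sup>2)" by (rule ennreal_leI)
    then show "ennreal (norm (f x)) \<le> 1 + ennreal ((norm (f x))\<^sup>2)" by simp
  qed
  also have "\<dots> = emeasure M (space M) + (\<integral>\<^sup>+x. ennreal ((norm (f x))\<^sup>2) \<partial>M)"
    using assms(2) by (subst nn_integral_add) auto
  also have "\<dots> < \<infinity>"
    using assms(3) finite_measure.emeasure_finite[OF assms(1), of "space M"] by (simp add: less_top)
  finally show "(\<integral>\<^sup>+x. ennreal (norm (f x)) \<partial>M) < \<infinity>" .
qed

locale cube_flow =
  fixes T :: real and G :: "real^'n \<Rightarrow> real \<Rightarrow> real^'n"
  assumes T: "0 < T" and G: "G \<in> mu_D \<rightarrow>\<^sub>M path_borel T"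
    and finite_action: "(\<integral>\<^sup>+x. path_action T (G x) \<partial>mu_D) < \<infinity>"
begin

definition position :: "real \<Rightarrow> real^'n \<Rightarrow> real^'n" where "position t x = G x t"

definition velocity :: "real \<Rightarrow> real^'n \<Rightarrow> real^'n" where "velocity t x = right_velocity T (G x) t"

sublocale D: prob_space "mu_D :: (real^'n) measure" by (rule mu_D_prob_space)
sublocale time: finite_measure "time_measure T" by (rule finite_measure_time_measure)
sublocale pair_sigma_finite "time_measure T" "mu_D :: (real^'n) measure" ..

lemma space_time: "space (time_measure T) = {0..T}"
  by (simp add: time_measure_def space_restrict_space)

lemma G_path: "x \<in> space mu_D \<Longrightarrow> G x \<in> topspace (path_topology T)"
  using measurable_space[OF G] by (simp add: space_path_borel)

lemma time_path_measurable:
  "(\<lambda>(t, x). (t, G x)) \<in> time_measure T \<Otimes>\<^sub>M mu_D \<rightarrow>\<^sub>M borel \<Otimes>\<^sub>M path_borel T"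
  unfolding split_beta'
  by (intro measurable_Pair measurable_compose[OF measurable_fst] measurable_compose[OF measurable_snd G]
      measurable_time_measure) simp

lemma position_measurable: "(\<lambda>(t, x). position t x) \<in> borel_measurable (time_measure T \<Otimes>\<^sub>M mu_D)"
proof (rule measurable_cong[THEN iffD1])
  show "(\<lambda>p. G (snd p) (clip T (fst p))) \<in> borel_measurable (time_measure T \<Otimes>\<^sub>M mu_D)"
    using measurable_compose[OF time_path_measurable eval_clip_measurable] T by (simp add: split_beta')
qed (auto simp: space_pair_measure space_time position_def clip_def)

lemma velocity_measurable: "(\<lambda>(t, x). velocity t x) \<in> borel_measurable (time_measure T \<Otimes>\<^sub>M mu_D)"
  using measurable_compose[OF time_path_measurable right_velocity_measurable] T by (simp add: split_beta' velocity_def)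

lemma energy_swap:
  fixes u :: "real \<Rightarrow> real^'n \<Rightarrow> real^'n"
  assumes [measurable]: "(\<lambda>(t, x). u t x) \<in> borel_measurable (time_measure T \<Otimes>\<^sub>M mu_D)"
  shows "(\<integral>\<^sup>+t. \<integral>\<^sup>+x. ennreal (c * (norm (u t x))\<^sup>2) \<partial>mu_D \<partial>time_measure T) =
         (\<integral>\<^sup>+x. \<integral>\<^sup>+t. ennreal (c * (norm (u t x))\<^sup>2) \<partial>time_measure T \<partial>mu_D)"
  by (rule Fubini'[symmetric]) measurable

lemma AE_abs_continuous: "AE x in mu_D. abs_continuous_path T (G x)"
proof -
  have "AE x in mu_D. path_action T (G x) \<noteq> \<infinity>"
    using finite_action measurable_compose[OF G path_action_measurable[OF T]]
    by (intro nn_integral_noteq_infinite) auto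
  then show ?thesis
  proof eventually_elim
    case (elim x)
    then show ?case by (cases "abs_continuous_path T (G x)") (simp_all add: path_action_def)
  qed
qed

text \<open>Tonelli's theorem. Finite mean action makes almost every path absolutely continuous.\<close>

lemma energy_velocity:
  "ennreal T * (\<integral>\<^sup>+t. \<integral>\<^sup>+x. ennreal (1/2 * (norm (velocity t x))\<^sup>2) \<partial>mu_D \<partial>time_measure T) =
     (\<integral>\<^sup>+x. path_action T (G x) \<partial>mu_D)"
proof -
  note [measurable] = velocity_measurable
  have "(\<lambda>(x, t). ennreal (1/2 * (norm (velocity t x))\<^sup>2)) \<in> borel_measurable (mu_D \<Otimes>\<^sub>M time_measure T)"
    by measurable
  then have m: "(\<lambda>x. \<integral>\<^sup>+t. ennreal (1/2 * (norm (velocity t x))\<^sup>2) \<partial>time_measure T) \<in> borel_measurable mu_D"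
    by (rule time.borel_measurable_nn_integral)
  have "ennreal T * (\<integral>\<^sup>+t. \<integral>\<^sup>+x. ennreal (1/2 * (norm (velocity t x))\<^sup>2) \<partial>mu_D \<partial>time_measure T) =
      (\<integral>\<^sup>+x. ennreal T * (\<integral>\<^sup>+t. ennreal (1/2 * (norm (velocity t x))\<^sup>2) \<partial>time_measure T) \<partial>mu_D)"
    unfolding energy_swap[OF velocity_measurable] by (rule nn_integral_cmult[OF m, symmetric])
  also have "\<dots> = (\<integral>\<^sup>+x. path_action T (G x) \<partial>mu_D)"
  proof (rule nn_integral_cong_AE)
    show "AE x in mu_D. ennreal T * (\<integral>\<^sup>+t. ennreal (1/2 * (norm (velocity t x))\<^sup>2) \<partial>time_measure T) = path_action T (G x)"
      using AE_abs_continuous AE_space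
      by eventually_elim (simp add: path_action_eq[OF T G_path] velocity_def)
  qed
  finally show ?thesis .
qed

lemma L2_position: "L2_time_space T position"
  unfolding L2_time_space_def
proof
  have "bounded (unit_cube :: (real^'n) set)" unfolding unit_cube_def by (rule bounded_cbox)
  then obtain B where B: "\<And>x. x \<in> (unit_cube :: (real^'n) set) \<Longrightarrow> norm x \<le> B" unfolding bounded_iff by blast
  have "(\<integral>\<^sup>+t. \<integral>\<^sup>+x. ennreal ((norm (position t x))\<^sup>2) \<partial>mu_D \<partial>time_measure T) \<le>
      (\<integral>\<^sup>+t. \<integral>\<^sup>+x. ennreal (B\<^sup>2) \<partial>(mu_D :: (real^'n) measure) \<partial>time_measure T)"
  proof (intro nn_integral_mono ennreal_leI power_mono norm_ge_zero)
    fix t x assume "t \<in> space (time_measure T)" "x \<in> space (mu_D :: (real^'n) measure)"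
    then have "position t x \<in> unit_cube"
      using G_path[of x] by (auto simp: space_time topspace_path_topology position_def Pi_iff)
    then show "norm (position t x) \<le> B" by (rule B)
  qed
  also have "\<dots> < \<infinity>"
    using time.emeasure_finite[of "space (time_measure T)"]
    by (simp add: D.emeasure_space_1 less_top[symmetric] ennreal_mult_eq_top_iff)
  finally show "(\<integral>\<^sup>+t. \<integral>\<^sup>+x. ennreal ((norm (position t x))\<^sup>2) \<partial>mu_D \<partial>time_measure T) < \<infinity>" .
qed (rule position_measurable)

lemma L2_velocity: "L2_time_space T velocity"
  unfolding L2_time_space_def
proof
  note [measurable] = velocity_measurable
  have "(\<integral>\<^sup>+t. \<integral>\<^sup>+x. ennreal ((norm (velocity t x))\<^sup>2) \<partial>mu_D \<partial>time_measure T) =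
      (\<integral>\<^sup>+t. \<integral>\<^sup>+x. 2 * ennreal (1/2 * (norm (velocity t x))\<^sup>2) \<partial>mu_D \<partial>time_measure T)"
    by (intro nn_integral_cong) (simp flip: ennreal_mult ennreal_numeral)
  also have "\<dots> = 2 * (\<integral>\<^sup>+t. \<integral>\<^sup>+x. ennreal (1/2 * (norm (velocity t x))\<^sup>2) \<partial>mu_D \<partial>time_measure T)"
    by (subst nn_integral_cmult[symmetric], measurable, intro nn_integral_cong nn_integral_cmult, measurable)
  also have "\<dots> < \<infinity>"
  proof -
    have "ennreal T * (\<integral>\<^sup>+t. \<integral>\<^sup>+x. ennreal (1/2 * (norm (velocity t x))\<^sup>2) \<partial>mu_D \<partial>time_measure T) < \<infinity>"
      unfolding energy_velocity by (rule finite_action)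
    then show ?thesis using T by (auto simp: ennreal_mult_less_top ennreal_mult_eq_top_iff less_top)
  qed
  finally show "(\<integral>\<^sup>+t. \<integral>\<^sup>+x. ennreal ((norm (velocity t x))\<^sup>2) \<partial>mu_D \<partial>time_measure T) < \<infinity>" .
qed (rule velocity_measurable)

lemma weak_derivative_velocity: "has_weak_time_derivative T position velocity"
  unfolding has_weak_time_derivative_def
proof (intro allI impI, elim conjE exE)
  fix \<phi> \<psi> :: "real \<Rightarrow> real" and a b
  assume \<phi>: "\<forall>t. (\<phi> has_real_derivative \<psi> t) (at t)" "continuous_on UNIV \<psi>" "0 < a" "b < T" "\<forall>t. t \<notin> {a..b} \<longrightarrow> \<phi> t = 0"
  show "AE x in mu_D. (\<integral>t. \<psi> t *\<^sub>R position t x \<partial>time_measure T) = - (\<integral>t. \<phi> t *\<^sub>R velocity t x \<partial>time_measure T)"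
    using AE_abs_continuous AE_space
  proof eventually_elim
    case (elim x)
    then show ?case
      unfolding position_def velocity_def using \<phi>
      by (intro path_integration_by_parts[OF T G_path]) auto
  qed
qed

lemma W12_position: "W12_flow T position"
  unfolding W12_flow_def using L2_position L2_velocity weak_derivative_velocity by blast

lemma L2_imp_AE_integrable:
  assumes "L2_time_space T u"
  shows "AE x in mu_D. integrable (time_measure T) (\<lambda>t. u t x :: real^'n)"
proof -
  have um: "(\<lambda>(t, x). u t x) \<in> borel_measurable (time_measure T \<Otimes>\<^sub>M mu_D)"
    and fin: "(\<integral>\<^sup>+t. \<integral>\<^sup>+x. ennreal ((norm (u t x))\<^sup>2) \<partial>mu_D \<partial>time_measure T) < \<infinity>"
    using assms by (auto simp: L2_time_space_def)
  note [measurable] = um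
  have "(\<integral>\<^sup>+x. \<integral>\<^sup>+t. ennreal ((norm (u t x))\<^sup>2) \<partial>time_measure T \<partial>mu_D) < \<infinity>"
    using fin energy_swap[OF um, of 1] by simp
  moreover have "(\<lambda>(x, t). ennreal ((norm (u t x))\<^sup>2)) \<in> borel_measurable (mu_D \<Otimes>\<^sub>M time_measure T)"
    by measurable
  then have "(\<lambda>x. \<integral>\<^sup>+t. ennreal ((norm (u t x))\<^sup>2) \<partial>time_measure T) \<in> borel_measurable mu_D"
    by (rule time.borel_measurable_nn_integral)
  ultimately have "AE x in mu_D. (\<integral>\<^sup>+t. ennreal ((norm (u t x))\<^sup>2) \<partial>time_measure T) \<noteq> \<infinity>"
    by (intro nn_integral_noteq_infinite) auto
  then show ?thesis
    using AE_space
  proof eventually_elim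
    case (elim x)
    have "(\<lambda>t. u t x) \<in> borel_measurable (time_measure T)"
      using measurable_compose[OF _ um, of "\<lambda>t. (t, x)"] elim(2) by simp
    then show ?case
      using elim(1) by (intro integrable_if_square_integrable time.finite_measure_axioms) (auto simp: less_top)
  qed
qed

text \<open>Two weak derivatives agree when tested against countably many bump functions, outside one common null set of
points \<open>x\<close>.\<close>

lemma weak_derivative_unique:
  assumes u: "L2_time_space T u" "has_weak_time_derivative T position u"
  shows "AE x in mu_D. AE t in time_measure T. velocity t x = u t x"
proof -
  have test: "AE x in mu_D. 0 < q \<and> q < r \<and> of_rat r < T \<longrightarrow>
      (\<integral>t. bump (of_rat q) (of_rat r) n t *\<^sub>R velocity t x \<partial>time_measure T) =
      (\<integral>t. bump (of_rat q) (of_rat r) n t *\<^sub>R u t x \<partial>time_measure T)" for q r :: rat and n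
  proof (cases "0 < q \<and> q < r \<and> of_rat r < T")
    case True
    obtain \<psi> where \<psi>: "\<And>t. (bump (of_rat q) (of_rat r) n has_real_derivative \<psi> t) (at t)" "continuous_on UNIV \<psi>"
      by (rule bump_derivative) (rule that)
    have "\<exists>a b. 0 < a \<and> b < T \<and> (\<forall>t. t \<notin> {a..b} \<longrightarrow> bump (of_rat q) (of_rat r) n t = 0)"
      using True by (intro exI[of _ "of_rat q"] exI[of _ "of_rat r"]) (auto intro!: bump_outside)
    with \<psi> have "(\<forall>t. (bump (of_rat q) (of_rat r) n has_real_derivative \<psi> t) (at t)) \<and> continuous_on UNIV \<psi> \<and>
        (\<exists>a b. 0 < a \<and> b < T \<and> (\<forall>t. t \<notin> {a..b} \<longrightarrow> bump (of_rat q) (of_rat r) n t = 0))" by blast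
    then have "AE x in mu_D. (\<integral>t. \<psi> t *\<^sub>R position t x \<partial>time_measure T) = - (\<integral>t. bump (of_rat q) (of_rat r) n t *\<^sub>R u t x \<partial>time_measure T)"
      "AE x in mu_D. (\<integral>t. \<psi> t *\<^sub>R position t x \<partial>time_measure T) = - (\<integral>t. bump (of_rat q) (of_rat r) n t *\<^sub>R velocity t x \<partial>time_measure T)"
      using u(2) weak_derivative_velocity unfolding has_weak_time_derivative_def by blast+
    then show ?thesis by eventually_elim simp
  qed auto
  have "AE x in mu_D. \<forall>(q :: rat) (r :: rat) n. 0 < q \<and> q < r \<and> of_rat r < T \<longrightarrow>
      (\<integral>t. bump (of_rat q) (of_rat r) n t *\<^sub>R velocity t x \<partial>time_measure T) =
      (\<integral>t. bump (of_rat q) (of_rat r) n t *\<^sub>R u t x \<partial>time_measure T)"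
    unfolding AE_all_countable using test by blast
  then show ?thesis
    using L2_imp_AE_integrable[OF u(1)] L2_imp_AE_integrable[OF L2_velocity]
  proof eventually_elim
    case (elim x)
    have bi: "integrable (time_measure T) (\<lambda>t. bump a b n t *\<^sub>R w t)"
      if w: "integrable (time_measure T) w" for a b n and w :: "real \<Rightarrow> real^'n"
    proof (rule Bochner_Integration.integrable_bound[OF w])
      have "bump a b n \<in> borel_measurable (time_measure T)"
        unfolding bump_def[abs_def] by (rule measurable_time_measure) measurable
      then show "(\<lambda>t. bump a b n t *\<^sub>R w t) \<in> borel_measurable (time_measure T)" using w by measurable
      show "AE t in time_measure T. norm (bump a b n t *\<^sub>R w t) \<le> norm (w t)"
        using bump_bounded[of a b n] by (intro AE_I2) (simp add: mult_left_le_one_le)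
    qed
    have "AE t in time_measure T. velocity t x - u t x = 0"
    proof (rule zero_if_bump_integrals_zero)
      show "integrable (time_measure T) (\<lambda>t. velocity t x - u t x)" using elim by auto
      show "(\<integral>t. bump (of_rat q) (of_rat r) n t *\<^sub>R (velocity t x - u t x) \<partial>time_measure T) = 0"
        if "0 < q" "q < r" "of_rat r < T" for q r :: rat and n
        unfolding scaleR_diff_right
        using elim that by (subst Bochner_Integration.integral_diff) (auto intro!: bi)
    qed
    then show ?case by eventually_elim simp
  qed
qed

text \<open>The action of a flow is defined through some weak derivative; by uniqueness it may be computed with the
pointwise velocity of the paths.\<close>

lemma flow_action_position: "flow_action T position = (\<integral>\<^sup>+x. path_action T (G x) \<partial>mu_D)"
proof -
  let ?u = "flow_velocity T position"
  have "L2_time_space T ?u \<and> has_weak_time_derivative T position ?u"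
    unfolding flow_velocity_def by (rule someI[of _ velocity]) (use L2_velocity weak_derivative_velocity in blast)
  then have u: "L2_time_space T ?u" "has_weak_time_derivative T position ?u" by auto
  have "(\<integral>\<^sup>+t. \<integral>\<^sup>+x. ennreal (1/2 * (norm (?u t x))\<^sup>2) \<partial>mu_D \<partial>time_measure T) =
      (\<integral>\<^sup>+x. \<integral>\<^sup>+t. ennreal (1/2 * (norm (?u t x))\<^sup>2) \<partial>time_measure T \<partial>mu_D)"
    using u(1) by (intro energy_swap) (simp add: L2_time_space_def)
  also have "\<dots> = (\<integral>\<^sup>+x. \<integral>\<^sup>+t. ennreal (1/2 * (norm (velocity t x))\<^sup>2) \<partial>time_measure T \<partial>mu_D)"
  proof (rule nn_integral_cong_AE)
    show "AE x in mu_D. (\<integral>\<^sup>+t. ennreal (1/2 * (norm (?u t x))\<^sup>2) \<partial>time_measure T) =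
        (\<integral>\<^sup>+t. ennreal (1/2 * (norm (velocity t x))\<^sup>2) \<partial>time_measure T)"
      using weak_derivative_unique[OF u]
    proof eventually_elim
      case (elim x)
      show ?case by (rule nn_integral_cong_AE) (use elim in \<open>eventually_elim, simp\<close>)
    qed
  qed
  also have "\<dots> = (\<integral>\<^sup>+t. \<integral>\<^sup>+x. ennreal (1/2 * (norm (velocity t x))\<^sup>2) \<partial>mu_D \<partial>time_measure T)"
    by (rule energy_swap[OF velocity_measurable, symmetric])
  finally show ?thesis unfolding flow_action_def using energy_velocity by simp
qed

end

theorem theorem5p3:
  fixes T :: real
    and \<gamma> :: "((real^'n) \<times> (real^'n)) measure"
    and \<eta> :: "(real \<Rightarrow> real^'n) measure"
  assumes "0 < T"
    and "\<gamma> \<in> measure_preserving_plans"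
    and "generalized_incompressible_flow T \<eta>"
    and "distr \<eta> (mu_D \<Otimes>\<^sub>M mu_D) (\<lambda>\<omega>. (\<omega> 0, \<omega> T)) = \<gamma>"
    and "generalized_flow_action T \<eta> < \<infinity>"
  shows "\<exists>g :: nat \<Rightarrow> real \<Rightarrow> real^'n \<Rightarrow> real^'n.
           (\<forall>k. W12_flow T (g k) \<and>
                (\<forall>t\<in>{0..T}. g k t \<in> measure_preserving_maps) \<and>
                trajectory_map T (g k) \<in> mu_D \<rightarrow>\<^sub>M path_borel T \<and>
                generalized_incompressible_flow T (flow_measure T (g k)) \<and>
                flow_action T (g k) = generalized_flow_action T (flow_measure T (g k))) \<and>
           narrowly_converges (path_topology T) (\<lambda>k. flow_measure T (g k)) \<eta> \<and>
           (\<lambda>k. generalized_flow_action T (flow_measure T (g k)))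
              \<longlonglongrightarrow> generalized_flow_action T \<eta>"
proof -
  have \<eta>: "prob_space \<eta>" "sets \<eta> = sets (path_borel T)" "\<And>t. t \<in> {0..T} \<Longrightarrow> distr \<eta> mu_D (\<lambda>\<omega>. \<omega> t) = mu_D"
    using assms(3) by (auto simp: generalized_incompressible_flow_def)
  obtain G :: "real^'n \<Rightarrow> real \<Rightarrow> real^'n" where
    rep: "G \<in> mu_D \<rightarrow>\<^sub>M path_borel T" "distr mu_D (path_borel T) G = \<eta>"
    by (rule path_measure_represented_on_cube[OF assms(1) \<eta>(1,2)])
  have action: "(\<integral>\<^sup>+x. path_action T (G x) \<partial>mu_D) = generalized_flow_action T \<eta>"
    unfolding generalized_flow_action_def rep(2)[symmetric]
    by (rule nn_integral_distr[OF rep(1), symmetric]) (simp add: path_action_measurable[OF assms(1)])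
  interpret cube_flow T G
    by unfold_locales (use assms(1,5) rep(1) action in auto)
  have traj: "trajectory_map T position x = G x" if "x \<in> space mu_D" for x
    using G_path[OF that] by (auto simp: trajectory_map_def position_def topspace_path_topology extensional_def restrict_def)
  have traj_m: "trajectory_map T position \<in> mu_D \<rightarrow>\<^sub>M path_borel T"
    using rep(1) measurable_cong[of mu_D "trajectory_map T position" G] traj by blast
  have flow: "flow_measure T position = \<eta>"
    unfolding flow_measure_def rep(2)[symmetric] by (rule distr_cong) (auto simp: traj)
  have preserving: "position t \<in> measure_preserving_maps" if t: "t \<in> {0..T}" for t
  proof -
    have ev: "(\<lambda>\<omega>. \<omega> t) \<in> path_borel T \<rightarrow>\<^sub>M (mu_D :: (real^'n) measure)"
      using eval_measurable[OF t] t
      by (auto simp: measurable_mu_D_iff space_path_borel topspace_path_topology Pi_iff)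
    have "position t = (\<lambda>\<omega>. \<omega> t) \<circ> G" by (auto simp: position_def)
    then have "position t \<in> mu_D \<rightarrow>\<^sub>M mu_D" using measurable_comp[OF rep(1) ev] by simp
    moreover have "distr mu_D mu_D (position t) = mu_D"
      using distr_distr[OF ev rep(1)] \<eta>(3)[OF t] unfolding rep(2) \<open>position t = _\<close> by simp
    ultimately show ?thesis by (simp add: measure_preserving_maps_def)
  qed
  show ?thesis
  proof (intro exI[of _ "\<lambda>_. position"] conjI allI ballI)
    show "flow_action T position = generalized_flow_action T (flow_measure T position)"
      unfolding flow_action_position action flow ..
    show "generalized_incompressible_flow T (flow_measure T position)" unfolding flow by (rule assms(3))
    show "narrowly_converges (path_topology T) (\<lambda>_. flow_measure T position) \<eta>"
      unfolding narrowly_converges_def flow by simp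
    show "(\<lambda>_. generalized_flow_action T (flow_measure T position)) \<longlonglongrightarrow> generalized_flow_action T \<eta>"
      unfolding flow by (rule tendsto_const)
  qed (use W12_position traj_m preserving in auto)
qed

end
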